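(* Let $(W,S)$ be a Coxeter system that admits a Vinberg representation $(V,U,K)$, and let $s\in S$. Let $\Delta^{\rm odd}$ be its odd Coxeter diagram, and let $W_\Omega$, $\Gamma_\Omega$, $p_\gamma$ and $r_{\gamma,u}$ be as defined in the context. Then: (1) The set of elements of $W$ of the form $r_{\gamma,u}$, where $\gamma$ is an edge-path in $\Delta^{\rm odd}$ starting at $s$ (and $u\in S$ is evenly joined to the endpoint of $\gamma$), forms a Coxeter system for $W_\Omega$. (2) The map $\pi_1(\Delta^{\rm odd},s)\to W$ given by $\gamma\mapsto p_\gamma$ is an isomorphism onto $\Gamma_\Omega$.
   Context: Coxeter systems. A Coxeter system $(W,S)$ is a group $W$ with a generating set $S$ of involutions such that the relations $(ss')^{o(ss')}=1$ ($s,s'\in S$) present $W$, where $o(ss')$ is the order of $ss'$ (no relation if it is $\infty$). The Coxeter diagram $\Delta$ has vertex set $S$, with distinct $s,s'$ joined by an edge labeled $o(ss')$. Edges labeled $2$ are usually not drawn, but label $2$ counts as even. The label $\infty$ is neither even nor odd. So distinct $t,u\in S$ are "evenly joined" if $o(tu)$ is finite and even (including $2$), and "oddly joined" if $o(tu)$ is finite and odd. The odd Coxeter diagram $\Delta^{\rm odd}$ is the graph with vertex set $S$ and distinct $s,s'$ joined iff $o(ss')$ is odd. A reflection in $W$ is an element conjugate into $S$. Vinberg representations. A reflection of a real vector space is a linear map that fixes a hyperplane (its mirror) pointwise and negates a complementary line. Let $V$ be a finite-dimensional real vector space, $\Gamma\subseteq \mathrm{GL}(V)$ a subgroup generated by reflections,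 and $U\subseteq V$ an open convex subset that $\Gamma$ preserves and on which it acts properly discontinuously; then $(V,U)$ is called a Vinberg representation of $\Gamma$. A chamber is the closure in $U$ of a component of the complement in $U$ of the mirrors of all reflections in $\Gamma$; facets are its codimension-one faces. If $K$ is a chamber and $S$ is the set of reflections across its facets, then $(V,U,K)$ is called a Vinberg representation of $(\Gamma,S)$ (and $(\Gamma,S)$ is a Coxeter system). For $t\in S$, $F_t$ is the facet of $K$ in the mirror of $t$. The groups. For $s\in S$ let $V^s$ be its mirror and $U^s=U\cap V^s$. $W_\Omega$ is the subgroup of $W$ generated by all reflections in the centralizer $C_W(s)$ other than $s$; $(V^s,U^s)$ is a Vinberg representation of $W_\Omega$. Let $\frac12V$ be the half-space bounded by $V^s$ that contains $K$, and let $K_\Omega$ be the chamber of $W_\Omega$ in $U^s$ that contains $F_s$. $\Gamma_\Omega$ is the subgroup of $W$ preserving both $K_\Omega$ and $\frac12V$. The words. For an edge-path $\gamma=(t_0,\dots,t_n)$ in $\Delta^{\rm odd}$, with $2l_i+1=o(t_{i-1}t_i)$, set $p_\gamma:=(t_1t_0)^{l_1}(t_2t_1)^{l_2}\cdots(t_nt_{n-1})^{l_n}$, with $p_\gamma=1$ if $n=0$. If $u\in S$ is evenly joined to $t_n$, with $o(ut_n)=2\lambda$, set $r_{\gamma,u}:=p_\gamma\cdot(ut_n)^{\lambda-1}u\cdot p_\gamma^{-1}$. *)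

theory Defs
  imports "HOL-Analysis.Analysis" "HOL-Algebra.Multiplicative_Group" "HOL-Algebra.Generated_Groups"
begin

text \<open>The letter \<open>(x, True)\<close> stands for the generator \<open>x\<close> and \<open>(x, False)\<close> for its formal inverse.\<close>

type_synonym 'a word = "('a \<times> bool) list"

definition word_val :: "('a, 'm) monoid_scheme \<Rightarrow> 'a word \<Rightarrow> 'a" where
  "word_val G w =
    foldr (\<lambda>(x, b) y. (if b then x else inv\<^bsub>G\<^esub> x) \<otimes>\<^bsub>G\<^esub> y) w \<one>\<^bsub>G\<^esub>"

inductive word_step :: "'a set \<Rightarrow> 'a word set \<Rightarrow> 'a word \<Rightarrow> 'a word \<Rightarrow> bool"
  for X :: "'a set" and R :: "'a word set" where
  cancel: "x \<in> X \<Longrightarrow> word_step X R (u @ [(x, b), (x, \<not> b)] @ v) (u @ v)"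
| relator: "r \<in> R \<Longrightarrow> word_step X R (u @ r @ v) (u @ v)"

text \<open>
  The classes of words over \<open>X\<close> modulo \<open>equivclp (word_step X R)\<close> form the quotient of the free
  group on \<open>X\<close> by the normal closure of \<open>R\<close>; the group is presented by \<open>X\<close> and \<open>R\<close> if
  evaluation of words is a well-defined bijection from this quotient to the group.
\<close>

definition presents :: "('a, 'm) monoid_scheme \<Rightarrow> 'a set \<Rightarrow> 'a word set \<Rightarrow> bool" where
  "presents G X R \<longleftrightarrow>
     generate G X = carrier G \<and>
     (\<forall>u v. fst ` set u \<subseteq> X \<longrightarrow> fst ` set v \<subseteq> X \<longrightarrow>
        (word_val G u = word_val G v \<longleftrightarrow> equivclp (word_step X R) u v))"

text \<open>\<open>group.ord G x\<close> is \<open>0\<close> if \<open>x\<close> has infinite order.\<close>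

definition coxeter_relators :: "('a, 'm) monoid_scheme \<Rightarrow> 'a set \<Rightarrow> 'a word set" where
  "coxeter_relators G S =
     {concat (replicate (group.ord G (s \<otimes>\<^bsub>G\<^esub> s')) [(s, True), (s', True)]) | s s'.
        s \<in> S \<and> s' \<in> S \<and> group.ord G (s \<otimes>\<^bsub>G\<^esub> s') > 0}"

definition coxeter_system :: "('a, 'm) monoid_scheme \<Rightarrow> 'a set \<Rightarrow> bool" where
  "coxeter_system G S \<longleftrightarrow>
     group G \<and> S \<subseteq> carrier G \<and>
     (\<forall>s\<in>S. s \<noteq> \<one>\<^bsub>G\<^esub> \<and> s \<otimes>\<^bsub>G\<^esub> s = \<one>\<^bsub>G\<^esub>) \<and>
     presents G S (coxeter_relators G S)"

definition evenly_joined :: "('a, 'm) monoid_scheme \<Rightarrow> 'a set \<Rightarrow> 'a \<Rightarrow> 'a \<Rightarrow> bool" where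
  "evenly_joined G S t u \<longleftrightarrow>
     t \<in> S \<and> u \<in> S \<and> t \<noteq> u \<and>
     group.ord G (t \<otimes>\<^bsub>G\<^esub> u) > 0 \<and> even (group.ord G (t \<otimes>\<^bsub>G\<^esub> u))"

text \<open>The adjacency relation of the odd Coxeter diagram, whose vertex set is \<open>S\<close>.\<close>

definition oddly_joined :: "('a, 'm) monoid_scheme \<Rightarrow> 'a set \<Rightarrow> 'a \<Rightarrow> 'a \<Rightarrow> bool" where
  "oddly_joined G S t u \<longleftrightarrow>
     t \<in> S \<and> u \<in> S \<and> t \<noteq> u \<and> odd (group.ord G (t \<otimes>\<^bsub>G\<^esub> u))"

definition group_reflection :: "('a, 'm) monoid_scheme \<Rightarrow> 'a set \<Rightarrow> 'a \<Rightarrow> bool" where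
  "group_reflection G S r \<longleftrightarrow>
     (\<exists>s\<in>S. \<exists>g\<in>carrier G. r = g \<otimes>\<^bsub>G\<^esub> s \<otimes>\<^bsub>G\<^esub> inv\<^bsub>G\<^esub> g)"

text \<open>Backtracking is allowed; an edge-path is given by its nonempty list of vertices.\<close>

definition edge_path :: "'a set \<Rightarrow> ('a \<Rightarrow> 'a \<Rightarrow> bool) \<Rightarrow> 'a list \<Rightarrow> bool" where
  "edge_path X E p \<longleftrightarrow> p \<noteq> [] \<and> set p \<subseteq> X \<and> successively E p"

definition edge_loops :: "'a set \<Rightarrow> ('a \<Rightarrow> 'a \<Rightarrow> bool) \<Rightarrow> 'a \<Rightarrow> 'a list set" where
  "edge_loops X E x = {p. edge_path X E p \<and> hd p = x \<and> last p = x}"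

inductive backtrack :: "'a set \<Rightarrow> ('a \<Rightarrow> 'a \<Rightarrow> bool) \<Rightarrow> 'a list \<Rightarrow> 'a list \<Rightarrow> bool"
  for X :: "'a set" and E :: "'a \<Rightarrow> 'a \<Rightarrow> bool" where
  "edge_path X E (p @ [a, b, a] @ q) \<Longrightarrow> backtrack X E (p @ [a, b, a] @ q) (p @ [a] @ q)"

text \<open>Homotopy of edge-paths rel endpoints is generated by removing and inserting backtrackings.\<close>

definition path_class :: "'a set \<Rightarrow> ('a \<Rightarrow> 'a \<Rightarrow> bool) \<Rightarrow> 'a list \<Rightarrow> 'a list set" where
  "path_class X E p = {q. equivclp (backtrack X E) p q}"

text \<open>
  The product is induced by concatenation, traversing the left factor first. The repeated base
  point is dropped by \<open>tl\<close>.
\<close>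

definition graph_pi1 :: "'a set \<Rightarrow> ('a \<Rightarrow> 'a \<Rightarrow> bool) \<Rightarrow> 'a \<Rightarrow> 'a list set monoid" where
  "graph_pi1 X E x =
     \<lparr>carrier = path_class X E ` edge_loops X E x,
      mult = (\<lambda>A B. \<Union>p\<in>A. \<Union>q\<in>B. path_class X E (p @ tl q)),
      one = path_class X E [x]\<rparr>"

text \<open>
  Restriction to a subspace \<open>V\<close> is built in, so that the same notions apply to the action on the
  whole space (\<open>V = UNIV\<close>) and to the induced action on an invariant subspace.
\<close>

definition reflection_on :: "'v::euclidean_space set \<Rightarrow> ('v \<Rightarrow> 'v) \<Rightarrow> bool" where
  "reflection_on V r \<longleftrightarrow>
     linear r \<and> r ` V \<subseteq> V \<and>
     (\<exists>H v. subspace H \<and> H \<subseteq> V \<and> dim H + 1 = dim V \<and> (\<forall>x\<in>H. r x = x) \<and>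
            v \<in> V \<and> v \<notin> H \<and> r v = - v)"

text \<open>For a reflection of \<open>V\<close>, the hyperplane \<open>H\<close> above is its full fixed space in \<open>V\<close>.\<close>

definition mirror_on :: "'v::euclidean_space set \<Rightarrow> ('v \<Rightarrow> 'v) \<Rightarrow> 'v set" where
  "mirror_on V r = {x \<in> V. r x = x}"

definition is_chamber :: "'v::euclidean_space set \<Rightarrow> 'v set \<Rightarrow> ('v \<Rightarrow> 'v) set \<Rightarrow> 'v set \<Rightarrow> bool" where
  "is_chamber V U \<Gamma> K \<longleftrightarrow>
     (\<exists>C \<in> components (U - \<Union>{mirror_on V r | r. r \<in> \<Gamma> \<and> reflection_on V r}).
        K = U \<inter> closure C)"

definition GL :: "('v::euclidean_space \<Rightarrow> 'v) monoid" where
  "GL = \<lparr>carrier = {f. linear f \<and> bij f}, mult = (\<circ>), one = id\<rparr>"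

text \<open>
  The injective homomorphism \<open>\<rho>\<close> identifies the group \<open>W\<close> with the subgroup \<open>\<Gamma> = \<rho> ` carrier W\<close>
  of the general linear group.
\<close>

definition vinberg_rep ::
  "('a, 'm) monoid_scheme \<Rightarrow> ('a \<Rightarrow> 'v::euclidean_space \<Rightarrow> 'v) \<Rightarrow> 'v set \<Rightarrow> bool" where
  "vinberg_rep W \<rho> U \<longleftrightarrow>
     \<rho> \<in> mon W GL \<and>
     generate W {g \<in> carrier W. reflection_on UNIV (\<rho> g)} = carrier W \<and>
     open U \<and> convex U \<and>
     (\<forall>g \<in> carrier W. \<rho> g ` U = U) \<and>
     (\<forall>C. compact C \<longrightarrow> C \<subseteq> U \<longrightarrow> finite {g \<in> carrier W. \<rho> g ` C \<inter> C \<noteq> {}})"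

definition vinberg_rep_chamber ::
  "('a, 'm) monoid_scheme \<Rightarrow> 'a set \<Rightarrow> ('a \<Rightarrow> 'v::euclidean_space \<Rightarrow> 'v) \<Rightarrow> 'v set \<Rightarrow> 'v set \<Rightarrow> bool"
  where
  "vinberg_rep_chamber W S \<rho> U K \<longleftrightarrow>
     vinberg_rep W \<rho> U \<and>
     is_chamber UNIV U (\<rho> ` carrier W) K \<and>
     S = {g \<in> carrier W. reflection_on UNIV (\<rho> g) \<and>
            (\<exists>F. F facet_of K \<and> F \<subseteq> mirror_on UNIV (\<rho> g))}"

definition facet_in :: "'v::euclidean_space set \<Rightarrow> 'v set \<Rightarrow> 'v set" where
  "facet_in H K = (THE F. F facet_of K \<and> F \<subseteq> H)"

text \<open>The inner product is only used to write down the linear functionals with kernel \<open>H\<close>.\<close>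

definition half_space_of :: "'v::euclidean_space set \<Rightarrow> 'v set \<Rightarrow> 'v set" where
  "half_space_of H K =
     (THE P. (\<exists>a. a \<noteq> 0 \<and> H = {x. a \<bullet> x = 0} \<and> P = {x. a \<bullet> x \<ge> 0}) \<and> K \<subseteq> P)"

definition W_Omega :: "('a, 'm) monoid_scheme \<Rightarrow> 'a set \<Rightarrow> 'a \<Rightarrow> 'a set" where
  "W_Omega W S s =
     generate W {r. group_reflection W S r \<and> r \<otimes>\<^bsub>W\<^esub> s = s \<otimes>\<^bsub>W\<^esub> r \<and> r \<noteq> s}"

definition K_Omega ::
  "('a, 'm) monoid_scheme \<Rightarrow> 'a set \<Rightarrow> ('a \<Rightarrow> 'v::euclidean_space \<Rightarrow> 'v) \<Rightarrow> 'v set \<Rightarrow> 'v set \<Rightarrow> 'a \<Rightarrow> 'v set"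
  where
  "K_Omega W S \<rho> U K s =
     (let Vs = mirror_on UNIV (\<rho> s)
      in THE C. is_chamber Vs (U \<inter> Vs) (\<rho> ` W_Omega W S s) C \<and> facet_in Vs K \<subseteq> C)"

definition Gamma_Omega ::
  "('a, 'm) monoid_scheme \<Rightarrow> 'a set \<Rightarrow> ('a \<Rightarrow> 'v::euclidean_space \<Rightarrow> 'v) \<Rightarrow> 'v set \<Rightarrow> 'v set \<Rightarrow> 'a \<Rightarrow> 'a set"
  where
  "Gamma_Omega W S \<rho> U K s =
     {g \<in> carrier W.
        \<rho> g ` K_Omega W S \<rho> U K s = K_Omega W S \<rho> U K s \<and>
        \<rho> g ` half_space_of (mirror_on UNIV (\<rho> s)) K = half_space_of (mirror_on UNIV (\<rho> s)) K}"

text \<open>If \<open>o(t u) = 2 l + 1\<close> then \<open>l = o(t u) div 2\<close>. The value on \<open>[]\<close>, which is no edge-path, is irrelevant.\<close>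

fun p_elt :: "('a, 'm) monoid_scheme \<Rightarrow> 'a list \<Rightarrow> 'a" where
  "p_elt W [] = \<one>\<^bsub>W\<^esub>"
| "p_elt W [t] = \<one>\<^bsub>W\<^esub>"
| "p_elt W (t # u # ts) =
     ((u \<otimes>\<^bsub>W\<^esub> t) [^]\<^bsub>W\<^esub> (group.ord W (t \<otimes>\<^bsub>W\<^esub> u) div 2)) \<otimes>\<^bsub>W\<^esub> p_elt W (u # ts)"

definition r_elt :: "('a, 'm) monoid_scheme \<Rightarrow> 'a list \<Rightarrow> 'a \<Rightarrow> 'a" where
  "r_elt W \<gamma> u =
     (let t = last \<gamma>; l = group.ord W (u \<otimes>\<^bsub>W\<^esub> t) div 2
      in p_elt W \<gamma> \<otimes>\<^bsub>W\<^esub> ((u \<otimes>\<^bsub>W\<^esub> t) [^]\<^bsub>W\<^esub> (l - 1) \<otimes>\<^bsub>W\<^esub> u) \<otimes>\<^bsub>W\<^esub> inv\<^bsub>W\<^esub> p_elt W \<gamma>)"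

end

theory Submission
  imports Defs
begin

text \<open>
  Let \<open>N(w)\<close> be the set of reflections whose mirrors separate a point of the chamber \<open>K\<close> from its
  image under \<open>w\<close>. This is a cocycle with \<open>N(s) = {s}\<close> for \<open>s \<in> S\<close>, and the exchange condition, hence
  the Coxeter presentation, follows from these two facts alone. The reflections \<open>r \<noteq> s\<close> commuting
  with \<open>s\<close> form a set \<open>T'\<close> closed under conjugation by \<open>W\<^sub>\<Omega>\<close>, and \<open>N(w) \<inter> T'\<close> is again such a
  cocycle, so \<open>W\<^sub>\<Omega>\<close> is a Coxeter group on the \<open>r \<in> T'\<close> with \<open>N(r) \<inter> T' = {r}\<close>.

  Suppose \<open>t g = g s\<close> with \<open>t \<in> S\<close>, \<open>t \<notin> N(g)\<close>, and let \<open>u \<in> N(g) \<inter> S\<close>. Then \<open>t\<close> and \<open>u\<close> are both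
  descents of \<open>t g = g s\<close>, so \<open>t u\<close> has finite order and an alternating word in \<open>t, u\<close> splits off
  \<open>g\<close>. By induction, \<open>g\<^sup>-\<^sup>1\<close> is a product of elements \<open>r\<^bsub>\<gamma>,u\<^esub>\<close> times one \<open>p\<^sub>\<gamma>\<close>. As
  \<open>N(p\<^sub>\<gamma>) \<inter> T' = {}\<close> and \<open>N(r\<^bsub>\<gamma>,u\<^esub>) \<inter> T' = {r\<^bsub>\<gamma>,u\<^esub>}\<close>, the \<open>r\<^bsub>\<gamma>,u\<^esub>\<close> are the canonical
  generators of \<open>W\<^sub>\<Omega>\<close>, and the \<open>p\<^sub>\<gamma>\<close> of loops are the elements that fix the half-space and have
  \<open>N \<inter> T' = {}\<close>, which geometrically means preserving \<open>K\<^sub>\<Omega>\<close>.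

  For injectivity, a path without backtracking is recovered from \<open>p\<^sub>\<gamma>\<close>: its previous vertex is the
  only neighbour of the last vertex in \<open>\<Delta>\<^sup>o\<^sup>d\<^sup>d\<close> that is a descent of \<open>p\<^sub>\<gamma>\<^sup>-\<^sup>1\<close>.
\<close>

text \<open>The cocycle is read off a point inside \<open>K\<close>, whereas \<open>K_Omega\<close>
  lives in the wall of \<open>s\<close>, which does not contain that point. For reflections
  commuting with \<open>s\<close>, a relative interior point of the facet can replace it, since no
  mirror passes between two points of \<open>K\<close>; this turns
  \<open>N(w) \<inter> T' = {}\<close> into a statement about the wall. A second obstacle is that
  the chambers of \<open>W_Omega\<close> are cut out by all its elements that act on the wall as
  reflections, and such an element need not a priori be a reflection of the whole space.
  \<open>W_Omega\<close> turns out to act freely on the points of the wall off the mirrors of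
  \<open>T'\<close>, so no further mirrors occur. The descent arguments rest on one fact: a reduced
  word all of whose letters are descents of an element is a prefix of it. With two letters this
  gives the finite order that starts each move. With three letters it bounds the length of the words
  abcabc..., which forces two odd neighbours that are both descents to commute.\<close>

section \<open>Words\<close>

fun alt :: "'a \<Rightarrow> 'a \<Rightarrow> nat \<Rightarrow> 'a list" where
  "alt a b 0 = []"
| "alt a b (Suc n) = a # alt b a n"

lemma length_alt [simp]: "length (alt a b n) = n"
  by (induction n arbitrary: a b) auto

lemma set_alt: "set (alt a b n) \<subseteq> {a, b}"
  by (induction n arbitrary: a b) auto

lemma alt_snoc: "alt a b (Suc n) = alt a b n @ [if even n then a else b]"
proof (induction n arbitrary: a b)
  case (Suc n)
  have "alt a b (Suc (Suc n)) = a # alt b a (Suc n)" by (rule alt.simps)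
  also have "\<dots> = a # (alt b a n @ [if even n then b else a])" by (simp only: Suc)
  finally show ?case by simp
qed simp

text \<open>The last letter of the whole word is \<open>b\<close> or \<open>a\<close> according to
  the parity of \<open>k + n\<close>, and the tail read backwards starts with it. The case
  \<open>k = n\<close> cuts a relator into the two sides of a braid relation.\<close>

lemma alt_split:
  "alt a b (k + n) = alt a b k @ rev (if even (k + n) then alt b a n else alt a b n)"
proof (induction n)
  case (Suc n)
  have "alt a b (k + Suc n) = alt a b (k + n) @ [if even (k + n) then a else b]"
    using alt_snoc[of a b "k + n"] by simp
  then show ?case using Suc by simp
qed simp

lemma alt_double: "alt a b (2 * m) = alt a b m @ rev (alt b a m)"
  using alt_split[of a b m m] by (simp add: mult_2)

lemma concat_replicate_alt:
  "concat (replicate m [(a, c), (b, c)]) = map (\<lambda>x. (x, c)) (alt a b (2 * m))"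
  by (induction m) auto

text \<open>The periodic word abcabc..., a source of arbitrarily long reduced words in three
  letters.\<close>

fun cyc :: "'a \<Rightarrow> 'a \<Rightarrow> 'a \<Rightarrow> nat \<Rightarrow> 'a list" where
  "cyc a b c 0 = []"
| "cyc a b c (Suc n) = a # cyc b c a n"

lemma length_cyc [simp]: "length (cyc a b c n) = n"
  by (induction n arbitrary: a b c) auto

lemma set_cyc: "set (cyc a b c n) \<subseteq> {a, b, c}"
  by (induction n arbitrary: a b c) auto

lemma word_step_context: "word_step X R a b \<Longrightarrow> word_step X R (c @ a @ d) (c @ b @ d)"
proof (induction rule: word_step.induct)
  case (cancel x u b v)
  show ?case using word_step.cancel[OF cancel, of R "c @ u" b "v @ d"] by simp
next
  case (relator r u v)
  show ?case using word_step.relator[OF relator, of X "c @ u" "v @ d"] by simp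
qed

lemma equivclp_word_step_context:
  "equivclp (word_step X R) a b \<Longrightarrow> equivclp (word_step X R) (c @ a @ d) (c @ b @ d)"
proof (induction rule: equivclp_induct)
  case (step y z)
  then have "equivclp (word_step X R) (c @ y @ d) (c @ z @ d)"
    using word_step_context[of X R y z c d] word_step_context[of X R z y c d] by (auto intro: equivclp_sym)
  with step show ?case by (blast intro: equivclp_trans)
qed simp

section \<open>Edge-paths up to backtracking\<close>

definition backtrack_free :: "'a list \<Rightarrow> bool" where
  "backtrack_free \<gamma> \<longleftrightarrow> \<not> (\<exists>p a b q. \<gamma> = p @ [a, b, a] @ q)"

lemma backtrack_free_appendD: "backtrack_free (p @ q) \<Longrightarrow> backtrack_free p"
  unfolding backtrack_free_def by (metis append.assoc)

lemma backtrack_free_snocD: "backtrack_free (p @ [a, b, c]) \<Longrightarrow> a \<noteq> c"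
  unfolding backtrack_free_def by (metis append_Nil2)

lemma backtrack_edge_path:
  assumes "backtrack X E x y"
  shows "edge_path X E x \<and> edge_path X E y \<and> hd x = hd y \<and> last x = last y"
  using assms
proof cases
  case (1 p a b q)
  then show ?thesis by (auto simp: edge_path_def successively_append_iff successively_Cons hd_append split: list.splits)
qed

lemma backtrack_equiv_edge_path:
  assumes "equivclp (backtrack X E) x y" "edge_path X E x"
  shows "edge_path X E y \<and> hd x = hd y \<and> last x = last y"
  using assms(1)
proof (induction rule: equivclp_induct)
  case (step y z)
  then show ?case using backtrack_edge_path[of X E y z] backtrack_edge_path[of X E z y] by auto
qed (use assms in simp)

text \<open>Deleting a backtracking shortens the path. Uniqueness of the result is not shown on
  paths alone; it comes out of \<open>backtrack_free_unique\<close>, through the values of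
  \<open>p_elt\<close>.\<close>

lemma backtrack_free_equiv:
  assumes "edge_path X E \<gamma>"
  shows "\<exists>\<delta>. backtrack_free \<delta> \<and> equivclp (backtrack X E) \<gamma> \<delta>"
  using assms
proof (induction "length \<gamma>" arbitrary: \<gamma> rule: less_induct)
  case less
  show ?case
  proof (cases "backtrack_free \<gamma>")
    case False
    then obtain p a b q where g: "\<gamma> = p @ [a, b, a] @ q" unfolding backtrack_free_def by blast
    then have bt: "backtrack X E \<gamma> (p @ [a] @ q)" using backtrack.intros[of X E p a b q] less.prems unfolding g by blast
    then obtain \<delta> where \<delta>: "backtrack_free \<delta>" "equivclp (backtrack X E) (p @ [a] @ q) \<delta>"
      using less.hyps[of "p @ [a] @ q"] backtrack_edge_path[OF bt] g by auto
    have "equivclp (backtrack X E) \<gamma> \<delta>" using r_into_equivclp[of "backtrack X E", OF bt] \<delta>(2) by (rule equivclp_trans)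
    then show ?thesis using \<delta>(1) by blast
  qed auto
qed

text \<open>\<open>graph_pi1\<close> drops the repeated vertex from the right factor. A backtracking
  at the start of that factor needs the vertex, so it is also made available as dropped from the
  left one.\<close>

lemma edge_path_join:
  assumes "edge_path X E p" "edge_path X E q" "last p = hd q"
  shows "edge_path X E (butlast p @ q)" "p @ tl q = butlast p @ q"
proof -
  obtain p' x where p: "p = p' @ [x]" using assms by (metis edge_path_def append_butlast_last_id)
  obtain q' where q: "q = x # q'" using assms p by (cases q) (auto simp: edge_path_def)
  show "p @ tl q = butlast p @ q" by (simp add: p q)
  show "edge_path X E (butlast p @ q)"
    using assms unfolding p q by (auto simp: edge_path_def successively_append_iff)
qed

lemma backtrack_join_left:
  assumes "backtrack X E p p'" "edge_path X E q" "last p = hd q"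
  shows "backtrack X E (p @ tl q) (p' @ tl q)"
  using assms(1)
proof cases
  case (1 a x y b)
  have "edge_path X E (p @ tl q)" using edge_path_join[of X E p q] backtrack_edge_path[OF assms(1)] assms by simp
  then have "edge_path X E (a @ [x, y, x] @ (b @ tl q))" using 1 by simp
  from backtrack.intros[OF this] show ?thesis using 1 by simp
qed

lemma backtrack_join_right:
  assumes "backtrack X E q q'" "edge_path X E p" "last p = hd q"
  shows "backtrack X E (p @ tl q) (p @ tl q')"
  using assms(1)
proof cases
  case (1 a x y b)
  note ep = backtrack_edge_path[OF assms(1)]
  note j = edge_path_join[OF assms(2) _ assms(3)] edge_path_join[OF assms(2), of q']
  have "edge_path X E ((butlast p @ a) @ [x, y, x] @ b)" using j ep 1 by simp
  from backtrack.intros[OF this] show ?thesis using j ep 1 assms(3) by simp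
qed

lemma equiv_join:
  assumes "equivclp (backtrack X E) p p'" "equivclp (backtrack X E) q q'" "edge_path X E p" "edge_path X E q" "last p = hd q"
  shows "equivclp (backtrack X E) (p @ tl q) (p' @ tl q')"
proof -
  have "equivclp (backtrack X E) (p @ tl q) (p' @ tl q)"
    using assms(1)
  proof (induction rule: equivclp_induct)
    case (step y z)
    have "edge_path X E y \<and> last p = last y" "edge_path X E z \<and> last p = last z"
      using backtrack_equiv_edge_path[OF _ assms(3)] step by (blast intro: equivclp_into_equivclp)+
    then show ?case using step backtrack_join_left[of X E y z q] backtrack_join_left[of X E z y q] assms
      by (metis equivclp_into_equivclp)
  qed simp
  also have "equivclp (backtrack X E) (p' @ tl q) (p' @ tl q')"
    using assms(2)
  proof (induction rule: equivclp_induct)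
    case (step y z)
    have p': "edge_path X E p'" "last p' = hd q" using backtrack_equiv_edge_path[OF assms(1,3)] assms(5) by auto
    have "edge_path X E y \<and> hd q = hd y" "edge_path X E z \<and> hd q = hd z"
      using backtrack_equiv_edge_path[OF _ assms(4)] step by (blast intro: equivclp_into_equivclp)+
    then show ?case using step backtrack_join_right[of X E y z p'] backtrack_join_right[of X E z y p'] p'
      by (metis equivclp_into_equivclp)
  qed simp
  finally show ?thesis .
qed

lemma path_class_eq: "path_class X E p = path_class X E q \<longleftrightarrow> equivclp (backtrack X E) p q"
  unfolding path_class_def
  by (metis (mono_tags) equivclp_refl equivclp_sym equivclp_trans mem_Collect_eq Collect_cong)

section \<open>Reflection systems\<close>

context group
begin

lemma inv_cancel_left [simp]:
  "x \<in> carrier G \<Longrightarrow> y \<in> carrier G \<Longrightarrow> x \<otimes> (inv x \<otimes> y) = y"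
  "x \<in> carrier G \<Longrightarrow> y \<in> carrier G \<Longrightarrow> inv x \<otimes> (x \<otimes> y) = y"
  by (simp_all flip: m_assoc)

text \<open>In contrast to \<open>word_val\<close>, letters carry no sign: all generators evaluated
  here are involutions.\<close>

definition val :: "'a list \<Rightarrow> 'a" where
  "val ws = foldr (\<otimes>) ws \<one>"

lemma val_Nil [simp]: "val [] = \<one>"
  and val_Cons [simp]: "val (w # ws) = w \<otimes> val ws"
  by (simp_all add: val_def)

lemma val_closed [intro, simp]: "set ws \<subseteq> carrier G \<Longrightarrow> val ws \<in> carrier G"
  by (induction ws) auto

lemma val_append: "set us \<subseteq> carrier G \<Longrightarrow> set vs \<subseteq> carrier G \<Longrightarrow> val (us @ vs) = val us \<otimes> val vs"
  by (induction us) (auto simp: m_assoc)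

lemma generate_words:
  assumes "X \<subseteq> carrier G" "\<And>x. x \<in> X \<Longrightarrow> inv x = x" "g \<in> generate G X"
  shows "\<exists>ws. set ws \<subseteq> X \<and> val ws = g"
  using assms(3)
proof (induction rule: generate.induct)
  case one
  show ?case by (rule exI[of _ "[]"]) simp
next
  case (incl h)
  then show ?case using assms by (intro exI[of _ "[h]"]) auto
next
  case (inv h)
  then show ?case using assms by (intro exI[of _ "[h]"]) auto
next
  case (eng h1 h2)
  then obtain us vs where "set us \<subseteq> X" "val us = h1" "set vs \<subseteq> X" "val vs = h2" by blast
  then show ?case using assms(1) by (intro exI[of _ "us @ vs"]) (auto simp: val_append)
qed

lemma pow_push: "a \<in> carrier G \<Longrightarrow> b \<in> carrier G \<Longrightarrow> a \<otimes> (b \<otimes> a) [^] (i::nat) = (a \<otimes> b) [^] i \<otimes> a"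
proof (induction i)
  case (Suc i)
  have "a \<otimes> (b \<otimes> a) [^] Suc i = (a \<otimes> (b \<otimes> a) [^] i) \<otimes> (b \<otimes> a)" using Suc.prems by (simp add: m_assoc)
  also have "\<dots> = (a \<otimes> b) [^] i \<otimes> a \<otimes> (b \<otimes> a)" using Suc by simp
  also have "\<dots> = (a \<otimes> b) [^] Suc i \<otimes> a" using Suc.prems by (simp add: m_assoc)
  finally show ?case .
qed simp

lemma val_alt:
  assumes "a \<in> carrier G" "b \<in> carrier G"
  shows "val (alt a b (2 * i)) = (a \<otimes> b) [^] i"
    and "val (alt a b (Suc (2 * i))) = (a \<otimes> b) [^] i \<otimes> a"
proof -
  have *: "val (alt a b (2 * i)) = (a \<otimes> b) [^] i" if "a \<in> carrier G" "b \<in> carrier G" for a b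
    using that
  proof (induction i)
    case (Suc i)
    then show ?case using nat_pow_Suc2[of "a \<otimes> b" i] by (simp add: m_assoc)
  qed simp
  show "val (alt a b (2 * i)) = (a \<otimes> b) [^] i" using * assms by blast
  show "val (alt a b (Suc (2 * i))) = (a \<otimes> b) [^] i \<otimes> a" using *[of b a] pow_push[of a b i] assms by simp
qed

end

text \<open>
  For a reflection group, \<open>N g\<close> is the set of reflections whose mirrors separate the base point
  \<open>x\<close> from \<open>g x\<close>; the cocycle rule \<open>N_mult\<close> is the symmetric difference of
  \<open>N g\<close> and \<open>g N h g\<^sup>-\<^sup>1\<close>.
\<close>

locale reflection_system = group G for G (structure) +
  fixes S T :: "'a set" and N :: "'a \<Rightarrow> 'a set"
  assumes S_sub_T: "S \<subseteq> T"
    and T_sub: "T \<subseteq> carrier G"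
    and T_sq: "t \<in> T \<Longrightarrow> t \<otimes> t = \<one>"
    and T_conj: "g \<in> carrier G \<Longrightarrow> t \<in> T \<Longrightarrow> g \<otimes> t \<otimes> inv g \<in> T"
    and N_sub: "g \<in> carrier G \<Longrightarrow> N g \<subseteq> T"
    and N_fin: "g \<in> carrier G \<Longrightarrow> finite (N g)"
    and N_mult: "g \<in> carrier G \<Longrightarrow> h \<in> carrier G \<Longrightarrow> t \<in> T \<Longrightarrow>
        t \<in> N (g \<otimes> h) \<longleftrightarrow> (t \<in> N g) \<noteq> (inv g \<otimes> t \<otimes> g \<in> N h)"
    and N_simple: "s \<in> S \<Longrightarrow> N s = {s}"
    and N_self: "t \<in> T \<Longrightarrow> t \<in> N t"
    and S_gen: "generate G S = carrier G"
begin

section \<open>Length, strong exchange and reduced words\<close>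

definition len :: "'a \<Rightarrow> nat" where
  "len g = card (N g)"

declare T_sq [simp]

lemma T_closed [simp]: "t \<in> T \<Longrightarrow> t \<in> carrier G" using T_sub by auto
lemma S_T [simp]: "s \<in> S \<Longrightarrow> s \<in> T" using S_sub_T by auto
lemma S_sub: "S \<subseteq> carrier G" using S_sub_T T_sub by auto
lemma words_closed [simp]: "set ws \<subseteq> S \<Longrightarrow> set ws \<subseteq> carrier G" using S_sub by auto

lemma T_inv [simp]: "t \<in> T \<Longrightarrow> inv t = t"
  by (simp add: T_sq inv_equality)

lemma T_cancel [simp]: "t \<in> T \<Longrightarrow> y \<in> carrier G \<Longrightarrow> t \<otimes> (t \<otimes> y) = y"
  by (simp add: T_sq flip: m_assoc)

lemma T_conj': "g \<in> carrier G \<Longrightarrow> t \<in> T \<Longrightarrow> inv g \<otimes> t \<otimes> g \<in> T"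
  using T_conj[of "inv g" t] by simp

lemma T_conj_refl: "r \<in> T \<Longrightarrow> t \<in> T \<Longrightarrow> r \<otimes> t \<otimes> r \<in> T"
  using T_conj[of r t] by simp

lemma N_one [simp]: "N \<one> = {}"
  using N_mult[of \<one> \<one>] N_sub[of \<one>] by auto

lemma T_ne_one: "t \<in> T \<Longrightarrow> t \<noteq> \<one>"
  using N_self by force

lemma N_inv: 
  assumes "g \<in> carrier G" "t \<in> T"
  shows "t \<in> N (inv g) \<longleftrightarrow> g \<otimes> t \<otimes> inv g \<in> N g"
  using N_mult[of "inv g" g t] assms by simp

lemma N_simple_mult:
  assumes "s \<in> S" "g \<in> carrier G" "t \<in> T"
  shows "t \<in> N (s \<otimes> g) \<longleftrightarrow> (t = s) \<noteq> (s \<otimes> t \<otimes> s \<in> N g)"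
  using N_mult[of s g t] N_simple[of s] assms by simp

lemma N_simple_up:
  assumes "s \<in> S" "g \<in> carrier G" "s \<notin> N g"
  shows "N (s \<otimes> g) = insert s ((\<lambda>t. s \<otimes> t \<otimes> s) ` N g)"
proof -
  have sub: "N (s \<otimes> g) \<subseteq> T" "N g \<subseteq> T" using N_sub assms by auto
  show ?thesis
  proof (intro equalityI subsetI)
    fix t assume t: "t \<in> N (s \<otimes> g)"
    then have tT: "t \<in> T" using sub by auto
    show "t \<in> insert s ((\<lambda>t. s \<otimes> t \<otimes> s) ` N g)"
    proof (cases "t = s")
      case False
      then have "s \<otimes> t \<otimes> s \<in> N g" using t tT N_simple_mult assms by auto
      moreover have "t = s \<otimes> (s \<otimes> t \<otimes> s) \<otimes> s" using tT assms(1) by (simp add: m_assoc)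
      ultimately show ?thesis by blast
    qed simp
  next
    fix t assume "t \<in> insert s ((\<lambda>t. s \<otimes> t \<otimes> s) ` N g)"
    then consider "t = s" | r where "r \<in> N g" "t = s \<otimes> r \<otimes> s" by blast
    then show "t \<in> N (s \<otimes> g)"
    proof cases
      case 1
      then show ?thesis using N_simple_mult[of s g s] assms by (simp add: m_assoc)
    next
      case 2
      have rT: "r \<in> T" using 2 sub by auto
      have "s \<otimes> t \<otimes> s = r" using 2 rT assms(1) by (simp add: m_assoc)
      moreover have "t \<in> T" using 2 rT T_conj_refl assms by auto
      moreover have "t \<noteq> s"
      proof
        assume "t = s"
        with \<open>s \<otimes> t \<otimes> s = r\<close> assms(1) have "r = s" by (simp add: m_assoc)
        with 2 assms show False by simp
      qed
      ultimately show ?thesis using N_simple_mult[of s g t] 2 assms by simp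
    qed
  qed
qed

lemma len_simple_up:
  assumes "s \<in> S" "g \<in> carrier G" "s \<notin> N g"
  shows "len (s \<otimes> g) = Suc (len g)"
proof -
  have sub: "N g \<subseteq> T" using N_sub assms by auto
  have "s \<notin> (\<lambda>t. s \<otimes> t \<otimes> s) ` N g"
  proof
    assume "s \<in> (\<lambda>t. s \<otimes> t \<otimes> s) ` N g"
    then obtain r where r: "r \<in> N g" "s = s \<otimes> r \<otimes> s" by blast
    then have "r \<in> T" using sub by auto
    then have "s \<otimes> (s \<otimes> r \<otimes> s) \<otimes> s = r" using assms(1) by (simp add: m_assoc)
    then show False using r assms by simp
  qed
  moreover have "inj_on (\<lambda>t. s \<otimes> t \<otimes> s) (N g)"
    using sub assms(1) by (intro inj_on_inverseI[where g = "\<lambda>t. s \<otimes> t \<otimes> s"]) (auto simp: m_assoc)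
  ultimately show ?thesis
    using N_fin[OF assms(2)] by (simp add: len_def card_image N_simple_up[OF assms])
qed

lemma len_simple_down:
  assumes "s \<in> S" "g \<in> carrier G" "s \<in> N g"
  shows "Suc (len (s \<otimes> g)) = len g"
proof -
  have "s \<notin> N (s \<otimes> g)" using N_simple_mult[of s g s] assms by simp
  then show ?thesis using len_simple_up[of s "s \<otimes> g"] assms by simp
qed

lemma len_simple_iff:
  assumes "s \<in> S" "g \<in> carrier G"
  shows "s \<in> N g \<longleftrightarrow> len (s \<otimes> g) < len g"
  using len_simple_up[OF assms] len_simple_down[OF assms] by (cases "s \<in> N g") auto

lemma len_one [simp]: "len \<one> = 0" by (simp add: len_def)

lemma len_simple [simp]: "s \<in> S \<Longrightarrow> len s = 1" by (simp add: len_def N_simple)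

lemma len_val_le: "set ws \<subseteq> S \<Longrightarrow> len (val ws) \<le> length ws"
proof (induction ws)
  case (Cons w ws)
  then have "w \<in> S" "val ws \<in> carrier G" "len (val ws) \<le> length ws" by auto
  then show ?case using len_simple_up[of w "val ws"] len_simple_down[of w "val ws"]
    by (cases "w \<in> N (val ws)") auto
qed simp

text \<open>This is strong exchange, for reflections that need not be simple. By the cocycle rule,
  \<open>t\<close> conjugated by the letters passed so far stays an inversion of the remaining word
  until it equals the next letter, which is then deleted.\<close>

lemma exchange:
  assumes "set ws \<subseteq> S" "t \<in> T" "t \<in> N (val ws)"
  shows "\<exists>us x vs. ws = us @ x # vs \<and> t \<otimes> val ws = val (us @ vs)"
  using assms
proof (induction ws arbitrary: t)
  case (Cons w ws)
  then have w: "w \<in> S" and ws: "set ws \<subseteq> S" "val ws \<in> carrier G" by auto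
  show ?case
  proof (cases "t = w")
    case True
    then show ?thesis using w ws by (intro exI[of _ "[]"]) auto
  next
    case False
    then have "w \<otimes> t \<otimes> w \<in> N (val ws)" using Cons.prems N_simple_mult[of w "val ws" t] w ws by simp
    moreover have "w \<otimes> t \<otimes> w \<in> T" using T_conj_refl w Cons.prems by simp
    ultimately obtain us x vs where 1: "ws = us @ x # vs" "w \<otimes> t \<otimes> w \<otimes> val ws = val (us @ vs)"
      using Cons.IH ws by blast
    have "t \<otimes> val (w # ws) = w \<otimes> (w \<otimes> t \<otimes> w \<otimes> val ws)"
      using Cons.prems w ws by (simp add: m_assoc)
    then have "t \<otimes> val (w # ws) = val ((w # us) @ vs)" using 1 by simp
    then show ?thesis using 1 by (intro exI[of _ "w # us"]) auto
  qed
qed simp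

text \<open>Taking the letters from \<open>ws\<close> itself, rather than from all of
  \<open>S\<close>, is what \<open>simple_val_in\<close> needs.\<close>

lemma reduced_subword:
  assumes "set ws \<subseteq> S"
  shows "\<exists>vs. set vs \<subseteq> set ws \<and> val vs = val ws \<and> length vs = len (val ws)"
  using assms
proof (induction ws)
  case (Cons w ws)
  then obtain vs where vs: "set vs \<subseteq> set ws" "val vs = val ws" "length vs = len (val ws)" by auto
  have w: "w \<in> S" and c: "val ws \<in> carrier G" "set vs \<subseteq> S" using Cons.prems vs by auto
  show ?case
  proof (cases "w \<in> N (val ws)")
    case True
    then obtain us x us' where 1: "vs = us @ x # us'" "w \<otimes> val vs = val (us @ us')"
      using exchange[of vs w] w c vs by auto
    moreover have "Suc (len (w \<otimes> val ws)) = len (val ws)" using len_simple_down w c True by blast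
    ultimately show ?thesis using vs by (intro exI[of _ "us @ us'"]) auto
  next
    case False
    then show ?thesis using len_simple_up[OF w c(1)] vs by (intro exI[of _ "w # vs"]) auto
  qed
qed simp

lemma words_exist:
  assumes "g \<in> carrier G"
  shows "\<exists>ws. set ws \<subseteq> S \<and> val ws = g"
  using generate_words[of S g] S_sub S_gen assms by auto

lemma reduced_word:
  assumes "g \<in> carrier G"
  obtains ws where "set ws \<subseteq> S" "val ws = g" "length ws = len g"
  using words_exist[OF assms] reduced_subword by (metis order_trans)

text \<open>Algebraic form of the fact that only the identity fixes a chamber. Applied to a
  subsystem it yields \<open>generate_commuting_one\<close>.\<close>

lemma N_empty: "g \<in> carrier G \<Longrightarrow> N g = {} \<Longrightarrow> g = \<one>"
  using reduced_word[of g] by (metis card.empty len_def length_0_conv val_Nil)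

lemma descent_exists:
  assumes "g \<in> carrier G" "g \<noteq> \<one>"
  obtains s where "s \<in> S" "s \<in> N g"
proof -
  obtain ws where ws: "set ws \<subseteq> S" "val ws = g" "length ws = len g" using reduced_word assms by blast
  then obtain w vs where w: "ws = w # vs" using assms by (cases ws) auto
  have "w \<in> N g"
  proof (rule ccontr)
    assume "w \<notin> N g"
    then have "len (w \<otimes> g) = Suc (len g)" using len_simple_up w ws assms by auto
    moreover have "w \<otimes> g = val vs" using w ws by auto
    ultimately show False using len_val_le[of vs] ws w by auto
  qed
  then show ?thesis using that w ws by auto
qed

lemma len_refl_less:
  assumes "g \<in> carrier G" "t \<in> T" "t \<in> N g"
  shows "len (t \<otimes> g) < len g"
proof -
  obtain ws where ws: "set ws \<subseteq> S" "val ws = g" "length ws = len g" using reduced_word assms by blast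
  then obtain us x vs where "ws = us @ x # vs" "t \<otimes> g = val (us @ vs)" using exchange assms by blast
  then show ?thesis using len_val_le[of "us @ vs"] ws by auto
qed

lemma N_iff_len:
  assumes "g \<in> carrier G" "t \<in> T"
  shows "t \<in> N g \<longleftrightarrow> len (t \<otimes> g) < len g"
proof (cases "t \<in> N g")
  case False
  then have "t \<in> N (t \<otimes> g)" using N_mult[of t g t] N_self[of t] assms by simp
  then have "len (t \<otimes> (t \<otimes> g)) < len (t \<otimes> g)" using len_refl_less[of "t \<otimes> g" t] assms by simp
  then show ?thesis using False assms by simp
qed (use len_refl_less assms in auto)

lemma len_mult_le:
  assumes "g \<in> carrier G" "h \<in> carrier G"
  shows "len (g \<otimes> h) \<le> len g + len h"
proof -
  have "N (g \<otimes> h) \<subseteq> N g \<union> (\<lambda>t. g \<otimes> t \<otimes> inv g) ` N h"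
  proof
    fix t assume t: "t \<in> N (g \<otimes> h)"
    then have tT: "t \<in> T" using N_sub assms by blast
    then have "t \<in> N g \<or> inv g \<otimes> t \<otimes> g \<in> N h" using N_mult t assms by blast
    moreover have "t = g \<otimes> (inv g \<otimes> t \<otimes> g) \<otimes> inv g" using tT assms by (simp add: m_assoc)
    ultimately show "t \<in> N g \<union> (\<lambda>t. g \<otimes> t \<otimes> inv g) ` N h" by blast
  qed
  then have "card (N (g \<otimes> h)) \<le> card (N g \<union> (\<lambda>t. g \<otimes> t \<otimes> inv g) ` N h)"
    using N_fin assms by (intro card_mono) auto
  also have "\<dots> \<le> card (N g) + card (N h)"
    using card_Un_le card_image_le[OF N_fin[OF assms(2)]] by (metis (no_types, lifting) add_left_mono order_trans)
  finally show ?thesis by (simp add: len_def)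
qed

text \<open>A reflection is an inversion of itself. Following it through a word for itself, the
  cocycle rule turns it into a letter of that word by conjugation.\<close>

lemma T_eq_conj_S:
  assumes "t \<in> T"
  shows "\<exists>s\<in>S. \<exists>g\<in>carrier G. t = g \<otimes> s \<otimes> inv g"
proof -
  have "\<lbrakk>set ws \<subseteq> S; r \<in> T; r \<in> N (val ws)\<rbrakk> \<Longrightarrow> \<exists>s\<in>S. \<exists>g\<in>carrier G. r = g \<otimes> s \<otimes> inv g" for ws r
  proof (induction ws arbitrary: r)
    case (Cons w ws)
    then have w: "w \<in> S" and ws: "set ws \<subseteq> S" "val ws \<in> carrier G" by auto
    show ?case
    proof (cases "r = w")
      case True
      then show ?thesis using w by (intro bexI[of _ w] bexI[of _ \<one>]) auto
    next
      case False
      then have "w \<otimes> r \<otimes> w \<in> N (val ws)" using Cons.prems N_simple_mult[of w "val ws" r] w ws by simp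
      then obtain s g where sg: "s \<in> S" "g \<in> carrier G" "w \<otimes> r \<otimes> w = g \<otimes> s \<otimes> inv g"
        using Cons.IH ws T_conj_refl w Cons.prems by (metis S_T)
      have "r = w \<otimes> (w \<otimes> r \<otimes> w) \<otimes> w" using w Cons.prems by (simp add: m_assoc)
      also have "\<dots> = (w \<otimes> g) \<otimes> s \<otimes> inv (w \<otimes> g)" using sg w by (simp add: m_assoc inv_mult_group)
      finally show ?thesis using sg w by (metis S_T T_closed m_closed)
    qed
  qed simp
  then show ?thesis using words_exist[of t] N_self assms by (metis T_closed)
qed

text \<open>A reduced word of a simple reflection has a single letter. In a subsystem, this places
  each canonical generator inside every generating set made of canonical generators.\<close>

lemma simple_val_in:
  assumes "set ws \<subseteq> S" "val ws \<in> S"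
  shows "val ws \<in> set ws"
proof -
  obtain vs where vs: "set vs \<subseteq> set ws" "val vs = val ws" "length vs = len (val ws)"
    using reduced_subword assms by blast
  then have "length vs = 1" using assms by simp
  then obtain x where "vs = [x]" by (cases vs) auto
  then show ?thesis using vs assms by auto
qed

section \<open>Dihedral subgroups and common descents\<close>

lemma ord_swap: "a \<in> T \<Longrightarrow> b \<in> T \<Longrightarrow> ord (b \<otimes> a) = ord (a \<otimes> b)"
  using ord_inv[of "a \<otimes> b"] by (simp add: inv_mult_group)

text \<open>Peeling off the first letter swaps \<open>a\<close> and \<open>b\<close>. The peeled
  letter is a new inversion: if it equalled \<open>(b \<otimes> a) [^] i \<otimes> b\<close> with
  \<open>i < k\<close>, then \<open>(b \<otimes> a) [^] Suc i\<close> would be trivial although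
  \<open>Suc i\<close> is below the order.\<close>

lemma N_alt_len_alt:
  assumes "a \<in> S" "b \<in> S" "ord (a \<otimes> b) = 0 \<or> k \<le> ord (a \<otimes> b)"
  shows "N (val (alt a b k)) = (\<lambda>i. (a \<otimes> b) [^] i \<otimes> a) ` {..<k} \<and> len (val (alt a b k)) = k"
  using assms
proof (induction k arbitrary: a b)
  case (Suc k)
  let ?g = "val (alt b a k)"
  have c [simp]: "a \<in> carrier G" "b \<in> carrier G" "a \<in> T" "b \<in> T" using Suc.prems by simp_all
  have gc: "?g \<in> carrier G" using set_alt[of b a k] by (intro val_closed) auto
  have IH: "N ?g = (\<lambda>i. (b \<otimes> a) [^] i \<otimes> b) ` {..<k}" "len ?g = k"
    using Suc.IH[of b a] Suc.prems ord_swap[of a b] by auto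
  have "a \<notin> N ?g"
  proof
    assume "a \<in> N ?g"
    then obtain i where i: "i < k" "a = (b \<otimes> a) [^] i \<otimes> b" using IH by auto
    then have "(b \<otimes> a) [^] Suc i = \<one>"
      by (metis T_sq c(1,2,3) m_assoc m_closed nat_pow_Suc nat_pow_closed)
    then have "ord (b \<otimes> a) dvd Suc i" using pow_eq_id[of "b \<otimes> a" "Suc i"] by simp
    then show False using i Suc.prems ord_swap[of a b] by (auto dest: dvd_imp_le)
  qed
  note up = N_simple_up[OF Suc.prems(1) gc this] len_simple_up[OF Suc.prems(1) gc this]
  have "a \<otimes> ((b \<otimes> a) [^] i \<otimes> b) \<otimes> a = (a \<otimes> b) [^] Suc i \<otimes> a" for i :: nat
    using pow_push[of a b i] by (simp flip: m_assoc)
  then have "(\<lambda>t. a \<otimes> t \<otimes> a) ` N ?g = (\<lambda>i. (a \<otimes> b) [^] i \<otimes> a) ` Suc ` {..<k}"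
    unfolding IH by (simp add: image_image)
  moreover have "insert a ((\<lambda>i. (a \<otimes> b) [^] i \<otimes> a) ` Suc ` {..<k}) = (\<lambda>i. (a \<otimes> b) [^] i \<otimes> a) ` insert 0 (Suc ` {..<k})"
    by simp
  moreover have "insert 0 (Suc ` {..<k}) = {..<Suc k}" by (simp add: lessThan_Suc_eq_insert_0)
  ultimately show ?case using up IH by simp
qed simp

lemmas N_alt = N_alt_len_alt[THEN conjunct1] and len_alt = N_alt_len_alt[THEN conjunct2]

lemma val_alt_closed [simp]: "a \<in> S \<Longrightarrow> b \<in> S \<Longrightarrow> val (alt a b k) \<in> carrier G"
  using set_alt[of a b k] by (intro val_closed) auto

lemma set_alt_S [simp]: "a \<in> S \<Longrightarrow> b \<in> S \<Longrightarrow> set (alt a b k) \<subseteq> S"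
  using set_alt[of a b k] by auto

lemma reduced_appendD:
  assumes "set us \<subseteq> S" "set vs \<subseteq> S" "len (val (us @ vs)) = length (us @ vs)"
  shows "len (val us) = length us" "len (val vs) = length vs"
  using len_mult_le[of "val us" "val vs"] len_val_le[of us] len_val_le[of vs] assms
  by (auto simp: val_append)

text \<open>A reduced word in descents of \<open>y\<close> is a prefix of \<open>y\<close>. Let
  \<open>j # us\<close> be such a word and \<open>u\<close> the value of \<open>us\<close>. Then
  \<open>j\<close> is an inversion of \<open>y\<close> but not of \<open>u\<close>, so its conjugate
  by \<open>u\<close> is an inversion of \<open>inv u \<otimes> y\<close>; hence passing from
  \<open>u\<close> to \<open>j \<otimes> u\<close> shortens the remainder. The triangle inequality
  shows that it shortens by exactly one.\<close>

lemma descents_reduced_prefix: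
  assumes "y \<in> carrier G" "set ws \<subseteq> S" "set ws \<subseteq> N y" "len (val ws) = length ws"
  shows "len (inv (val ws) \<otimes> y) + length ws = len y"
  using assms(2-)
proof (induction ws)
  case (Cons j us)
  define u where "u = val us"
  have j: "j \<in> S" "j \<in> N y" and us: "set us \<subseteq> S" "set us \<subseteq> N y" using Cons.prems by auto
  have u: "u \<in> carrier G" "len u = length us"
    using us reduced_appendD[of "[j]" us] Cons.prems by (auto simp: u_def)
  have IH: "len (inv u \<otimes> y) + length us = len y" using Cons.IH us u by (simp add: u_def)
  have "j \<notin> N u" using len_simple_iff[OF j(1) u(1)] u Cons.prems by (simp add: u_def)
  moreover have "j \<in> N (u \<otimes> (inv u \<otimes> y))" using j u assms by simp
  ultimately have "inv u \<otimes> j \<otimes> u \<in> N (inv u \<otimes> y)" using N_mult[of u "inv u \<otimes> y" j] j u assms by simp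
  then have "len (inv u \<otimes> j \<otimes> u \<otimes> (inv u \<otimes> y)) < len (inv u \<otimes> y)"
    using len_refl_less T_conj'[of u j] u j assms by simp
  moreover have "inv u \<otimes> j \<otimes> u \<otimes> (inv u \<otimes> y) = inv (j \<otimes> u) \<otimes> y"
    using u j assms by (simp add: m_assoc inv_mult_group)
  moreover have "len y \<le> len (j \<otimes> u) + len (inv (j \<otimes> u) \<otimes> y)"
    using len_mult_le[of "j \<otimes> u" "inv (j \<otimes> u) \<otimes> y"] u j assms by simp
  ultimately show ?case using IH Cons.prems by (simp add: u_def)
qed (use assms in simp)

text \<open>If the order were infinite, all alternating words would be reduced, and one of length
  \<open>Suc (len g)\<close> would be a prefix of \<open>g\<close>.\<close>

lemma dihedral_descent:
  assumes "g \<in> carrier G" "a \<in> S" "b \<in> S" "a \<in> N g" "b \<in> N g"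
  shows "ord (a \<otimes> b) > 0" "len (inv (val (alt a b (ord (a \<otimes> b)))) \<otimes> g) + ord (a \<otimes> b) = len g"
proof -
  have *: "len (inv (val (alt a b k)) \<otimes> g) + k = len g" if "ord (a \<otimes> b) = 0 \<or> k \<le> ord (a \<otimes> b)" for k
    using descents_reduced_prefix[of g "alt a b k"] set_alt[of a b k] assms len_alt[of a b k] that by fastforce
  show "ord (a \<otimes> b) > 0"
  proof (rule ccontr)
    assume "\<not> ord (a \<otimes> b) > 0"
    then show False using *[of "Suc (len g)"] by simp
  qed
  show "len (inv (val (alt a b (ord (a \<otimes> b)))) \<otimes> g) + ord (a \<otimes> b) = len g" using * by simp
qed

lemma ord_ne_1: "t \<in> S \<Longrightarrow> u \<in> S \<Longrightarrow> t \<noteq> u \<Longrightarrow> ord (t \<otimes> u) \<noteq> 1"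
  using ord_eq_1[of "t \<otimes> u"] by (metis S_T T_closed T_inv inv_equality m_closed)

lemma alt_prefix_descent:
  assumes "a \<in> S" "b \<in> S" "h \<in> carrier G" "Suc k + len h \<le> len (val (alt a b (Suc k)) \<otimes> h)"
  shows "a \<in> N (val (alt a b (Suc k)) \<otimes> h)"
proof -
  let ?g = "val (alt a b (Suc k)) \<otimes> h"
  have g: "?g \<in> carrier G" using assms(1-3) by (intro m_closed val_alt_closed)
  have "a \<otimes> ?g = val (alt b a k) \<otimes> h" using assms(1-3) by (simp add: m_assoc)
  then have "len (a \<otimes> ?g) \<le> len (val (alt b a k)) + len h"
    using len_mult_le[of "val (alt b a k)" h] assms(1-3) by simp
  also have "\<dots> \<le> k + len h" using len_val_le[of "alt b a k"] assms(1,2) by simp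
  finally show ?thesis using len_simple_iff[OF assms(1) g] assms(4) by simp
qed

text \<open>\<open>g\<close> begins with the alternating word of length
  \<open>m = ord (a \<otimes> b)\<close>, which is at least 2. Without its first letter
  \<open>a\<close> this word begins with \<open>b\<close>; if \<open>m\<close> is at least 3, it
  then begins with \<open>a\<close> again after the removal of \<open>b\<close>.\<close>

lemma dihedral_descents:
  assumes "g \<in> carrier G" "a \<in> S" "b \<in> S" "a \<noteq> b" "a \<in> N g" "b \<in> N g"
  shows "b \<in> N (a \<otimes> g)" and "ord (a \<otimes> b) \<noteq> 2 \<Longrightarrow> a \<in> N (b \<otimes> (a \<otimes> g))"
proof -
  define m h where "m = ord (a \<otimes> b)" and "h = inv (val (alt a b m)) \<otimes> g"
  have h: "h \<in> carrier G" "g = val (alt a b m) \<otimes> h" using assms(1-3) by (simp_all add: h_def)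
  have l: "len h + m = len g" "m \<noteq> 0" "m \<noteq> 1"
    using dihedral_descent[OF assms(1-3,5,6)] ord_ne_1[OF assms(2-4)] by (simp_all add: m_def h_def)
  then obtain k where k: "m = Suc (Suc k)" by (metis One_nat_def not0_implies_Suc)
  have ag: "a \<otimes> g = val (alt b a (Suc k)) \<otimes> h" using assms(2,3) h(1) unfolding h(2) k by (simp add: m_assoc)
  have la: "Suc (len (a \<otimes> g)) = len g" using len_simple_down[OF assms(2,1,5)] .
  then show b: "b \<in> N (a \<otimes> g)"
    unfolding ag using l(1) k by (intro alt_prefix_descent assms(2,3) h(1)) simp
  assume "ord (a \<otimes> b) \<noteq> 2"
  then obtain k' where k': "k = Suc k'" using k by (cases k) (auto simp: m_def)
  have bag: "b \<otimes> (a \<otimes> g) = val (alt a b (Suc k')) \<otimes> h" using assms(2,3) h(1) unfolding ag k' by (simp add: m_assoc)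
  have "Suc (len (b \<otimes> (a \<otimes> g))) = len (a \<otimes> g)" using len_simple_down[OF assms(3) _ b] assms(1,2) by simp
  then show "a \<in> N (b \<otimes> (a \<otimes> g))"
    unfolding bag using l(1) la k k' by (intro alt_prefix_descent assms(2,3) h(1)) simp
qed

text \<open>Multiplying by \<open>t\<close> already shortens the left factor, and no length is lost
  in the product.\<close>

lemma N_mono_reduced:
  assumes "u \<in> carrier G" "h \<in> carrier G" "len (u \<otimes> h) = len u + len h" "t \<in> N u"
  shows "t \<in> N (u \<otimes> h)"
proof -
  have t: "t \<in> T" using N_sub assms by auto
  have "len (t \<otimes> u \<otimes> h) \<le> len (t \<otimes> u) + len h" using len_mult_le t assms by simp
  also have "\<dots> < len (u \<otimes> h)" using len_refl_less[of u t] t assms by simp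
  finally show ?thesis using N_iff_len[of "u \<otimes> h" t] t assms by (simp add: m_assoc)
qed

lemma val_rev: "set ws \<subseteq> S \<Longrightarrow> val (rev ws) = inv (val ws)"
  by (induction ws) (auto simp: val_append inv_mult_group)

lemma len_inv:
  assumes "g \<in> carrier G"
  shows "len (inv g) = len g"
proof -
  have *: "len (inv g) \<le> len g" if "g \<in> carrier G" for g
  proof -
    obtain ws where ws: "set ws \<subseteq> S" "val ws = g" "length ws = len g" using reduced_word \<open>g \<in> carrier G\<close> by blast
    then show ?thesis using len_val_le[of "rev ws"] val_rev[of ws] by simp
  qed
  show ?thesis using *[of g] *[of "inv g"] assms by simp
qed

subsection \<open>The Coxeter presentation\<close>

definition weq :: "('a \<times> bool) list \<Rightarrow> ('a \<times> bool) list \<Rightarrow> bool" where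
  "weq = equivclp (word_step S (coxeter_relators G S))"

abbreviation pos :: "'a list \<Rightarrow> ('a \<times> bool) list" where
  "pos \<equiv> map (\<lambda>x. (x, True))"

lemma weq_refl [simp]: "weq a a" by (simp add: weq_def)
lemma weq_sym: "weq a b \<Longrightarrow> weq b a" unfolding weq_def by (rule equivclp_sym)
lemma weq_trans [trans]: "weq a b \<Longrightarrow> weq b c \<Longrightarrow> weq a c" unfolding weq_def by (rule equivclp_trans)
lemma weq_context: "weq a b \<Longrightarrow> weq (c @ a @ d) (c @ b @ d)"
  unfolding weq_def by (rule equivclp_word_step_context)
lemma weq_step: "word_step S (coxeter_relators G S) a b \<Longrightarrow> weq a b"
  unfolding weq_def by blast

lemma weq_Cons: "weq (pos a) (pos b) \<Longrightarrow> weq (pos (x # a)) (pos (x # b))"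
  using weq_context[of "pos a" "pos b" "[(x, True)]" "[]"] by simp

lemma weq_relator:
  assumes "a \<in> S" "b \<in> S"
  shows "weq (pos (alt a b (2 * ord (a \<otimes> b)))) []"
proof (cases "ord (a \<otimes> b) = 0")
  case False
  then have "concat (replicate (ord (a \<otimes> b)) [(a, True), (b, True)]) \<in> coxeter_relators G S"
    using assms unfolding coxeter_relators_def by auto
  from weq_step[OF word_step.relator[OF this, of S "[]" "[]"]] show ?thesis
    by (simp add: concat_replicate_alt)
qed simp

text \<open>The relator with \<open>s = s'\<close> has exponent 1, the order of the identity, and is
  the square of the letter.\<close>

lemma weq_square: "x \<in> S \<Longrightarrow> weq (pos [x, x]) []"
  using weq_relator[of x x] by (simp add: numeral_2_eq_2)

lemma weq_rev: "set ws \<subseteq> S \<Longrightarrow> weq (pos (rev ws @ ws)) []"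
proof (induction ws)
  case (Cons w ws)
  have "weq (pos (rev ws) @ pos [w, w] @ pos ws) (pos (rev ws) @ [] @ pos ws)"
    using Cons.prems by (intro weq_context weq_square) auto
  then show ?case using Cons by (auto intro: weq_trans)
qed simp

text \<open>Insert \<open>rev w @ w\<close> for \<open>w = alt b a m\<close> on the right. By
  \<open>alt_double\<close> the left part becomes the relator.\<close>

lemma weq_braid:
  assumes "a \<in> S" "b \<in> S" "m = ord (a \<otimes> b)"
  shows "weq (pos (alt a b m)) (pos (alt b a m))"
proof -
  let ?w = "alt b a m"
  have "weq (pos (alt a b m) @ [] @ []) (pos (alt a b m) @ pos (rev ?w @ ?w) @ [])"
    using assms by (intro weq_context weq_sym[OF weq_rev]) auto
  also have "pos (alt a b m) @ pos (rev ?w @ ?w) @ [] = [] @ pos (alt a b (2 * m)) @ pos ?w"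
    by (simp add: alt_double)
  also have "weq \<dots> ([] @ [] @ pos ?w)"
    unfolding assms by (intro weq_context weq_relator) (use assms in auto)
  finally show ?thesis by simp
qed

lemma val_braid:
  assumes "a \<in> S" "b \<in> S"
  shows "val (alt a b (ord (a \<otimes> b))) = val (alt b a (ord (a \<otimes> b)))"
proof -
  let ?m = "ord (a \<otimes> b)"
  have "val (alt a b (2 * ?m)) = \<one>" using val_alt(1)[of a b ?m] assms by simp
  then have "val (alt a b ?m) \<otimes> inv (val (alt b a ?m)) = \<one>"
    using assms by (simp add: alt_double val_append val_rev)
  then show ?thesis using assms by (metis inv_equality inv_inv inv_closed val_alt_closed)
qed

text \<open>Matsumoto's argument. If the first letters \<open>a\<close> and \<open>b\<close> differ,
  both are descents, so there are reduced words \<open>alt a b m @ hw\<close> and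
  \<open>alt b a m @ hw\<close> for the same element. A braid move joins these two, and each shares
  its first letter with one of the given words, so induction applies to the tails.\<close>

lemma reduced_words_equiv:
  assumes "set us \<subseteq> S" "set vs \<subseteq> S" "val us = val vs"
    "length us = len (val us)" "length vs = len (val vs)"
  shows "weq (pos us) (pos vs)"
  using assms
proof (induction "length us" arbitrary: us vs rule: less_induct)
  case less
  define g where "g = val us"
  have g: "g \<in> carrier G" "val vs = g" "length us = len g" "length vs = len g" using less.prems by (auto simp: g_def)
  show ?case
  proof (cases us)
    case Nil
    then have "vs = []" using g by auto
    then show ?thesis using Nil by simp
  next
    case (Cons a us')
    then obtain b vs' where vs: "vs = b # vs'" using g by (cases vs) auto
    have a: "a \<in> S" "set us' \<subseteq> S" and b: "b \<in> S" "set vs' \<subseteq> S" using less.prems Cons vs by auto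
    have same_head: "weq (pos (x # xs)) (pos (x # ys))"
      if "x \<in> S" "set xs \<subseteq> S" "set ys \<subseteq> S" "val (x # xs) = g" "val (x # ys) = g"
        "length (x # xs) = len g" "length (x # ys) = len g" for x xs ys
    proof (rule weq_Cons, rule less.hyps)
      have "val (x # xs) = val (x # ys)" using that by simp
      then show "val xs = val ys" using that by (metis S_T T_cancel val_Cons val_closed words_closed)
      show "length xs < length us" using that g by simp
      show "length xs = len (val xs)" "length ys = len (val ys)"
        using reduced_appendD[of "[x]" xs] reduced_appendD[of "[x]" ys] that by auto
    qed (use that in auto)
    show ?thesis
    proof (cases "a = b")
      case True
      then show ?thesis using same_head[of a us' vs'] Cons vs a b g g_def by auto
    next
      case False
      define m where "m = ord (a \<otimes> b)"
      have desc: "a \<in> N g" "b \<in> N g"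
      proof -
        have "g = a \<otimes> val us'" "g = b \<otimes> val vs'" using g_def g(2) Cons vs by auto
        then have "val us' = a \<otimes> g" "val vs' = b \<otimes> g" using a b by (metis S_T T_cancel val_closed words_closed)+
        then have "len (a \<otimes> g) < len g" "len (b \<otimes> g) < len g"
          using len_val_le[of us'] len_val_le[of vs'] a b g Cons vs by auto
        then show "a \<in> N g" "b \<in> N g" using len_simple_iff a b g by auto
      qed
      have m: "m > 0" "len (inv (val (alt a b m)) \<otimes> g) + m = len g"
        using dihedral_descent[OF g(1) a(1) b(1) desc] by (auto simp: m_def)
      define h where "h = inv (val (alt a b m)) \<otimes> g"
      have h: "h \<in> carrier G" using a b g by (simp add: h_def)
      obtain hw where hw: "set hw \<subseteq> S" "val hw = h" "length hw = len h" using reduced_word[OF h] by blast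
      have br: "val (alt a b m) = val (alt b a m)" using val_braid a b by (simp add: m_def)
      have ga: "val (alt a b m @ hw) = g" "val (alt b a m @ hw) = g"
        using a b g hw h br by (auto simp: val_append h_def)
      obtain k where k: "m = Suc k" using m(1) by (cases m) auto
      have l: "length hw + m = len g" using hw m by (simp add: h_def)
      have "weq (pos us) (pos (alt a b m @ hw))"
        using same_head[of a us' "alt b a k @ hw"] a b g hw Cons ga l g_def by (simp add: k)
      also have "weq \<dots> (pos (alt b a m @ hw))"
        using weq_context[OF weq_braid[OF a(1) b(1) m_def], of "[]" "pos hw"] by simp
      also have "weq \<dots> (pos vs)"
        using same_head[of b "alt a b k @ hw" vs'] a b g hw vs ga l by (simp add: k)
      finally show ?thesis .
    qed
  qed
qed

text \<open>If the next letter \<open>w\<close> lowers the length, the reduced word can be exchanged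
  for one beginning with \<open>w\<close>, by \<open>reduced_words_equiv\<close>, and the square of
  \<open>w\<close> cancels.\<close>

lemma word_reduces:
  assumes "set ws \<subseteq> S"
  shows "\<exists>vs. set vs \<subseteq> S \<and> val vs = val ws \<and> length vs = len (val ws) \<and> weq (pos ws) (pos vs)"
  using assms
proof (induction ws)
  case (Cons w ws)
  then obtain vs where vs: "set vs \<subseteq> S" "val vs = val ws" "length vs = len (val ws)" "weq (pos ws) (pos vs)" by auto
  have w: "w \<in> S" and c: "val ws \<in> carrier G" using Cons.prems by auto
  have e: "weq (pos (w # ws)) (pos (w # vs))" using vs(4) by (rule weq_Cons)
  show ?case
  proof (cases "w \<in> N (val ws)")
    case False
    then show ?thesis using len_simple_up[OF w c] vs e w by (intro exI[of _ "w # vs"]) auto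
  next
    case True
    obtain us where us: "set us \<subseteq> S" "val us = w \<otimes> val ws" "length us = len (w \<otimes> val ws)"
      using reduced_word[of "w \<otimes> val ws"] w c by auto
    have "weq (pos vs) (pos (w # us))"
      using len_simple_down[OF w c True] us vs w c by (intro reduced_words_equiv) auto
    from weq_Cons[OF this, of w] have "weq (pos (w # ws)) (pos (w # w # us))" using e by (blast intro: weq_trans)
    also have "weq \<dots> (pos us)" using weq_context[OF weq_square[OF w], of "[]" "pos us"] by simp
    finally show ?thesis using us by auto
  qed
qed (auto intro: exI[of _ "[]"])

lemma words_equiv:
  assumes "set us \<subseteq> S" "set vs \<subseteq> S" "val us = val vs"
  shows "weq (pos us) (pos vs)"
proof -
  obtain us' where us: "set us' \<subseteq> S" "val us' = val us" "length us' = len (val us)" "weq (pos us) (pos us')"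
    using word_reduces assms by blast
  obtain vs' where vs: "set vs' \<subseteq> S" "val vs' = val vs" "length vs' = len (val vs)" "weq (pos vs) (pos vs')"
    using word_reduces assms by blast
  have "weq (pos us') (pos vs')" using us vs assms by (intro reduced_words_equiv) auto
  then show ?thesis using us vs by (blast intro: weq_trans weq_sym)
qed

lemma weq_pos:
  assumes "fst ` set w \<subseteq> S"
  shows "weq w (pos (map fst w))"
  using assms
proof (induction w)
  case (Cons p w)
  obtain x b where p: "p = (x, b)" by (cases p)
  have x: "x \<in> S" using Cons.prems p by auto
  have "weq [(x, b)] [(x, True)]"
  proof (cases b)
    case False
    have "weq ([(x, False)] @ [] @ []) ([(x, False)] @ pos [x, x] @ [])"
      by (rule weq_context[OF weq_sym[OF weq_square[OF x]]])
    also have "weq \<dots> [(x, True)]"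
      using weq_step[OF word_step.cancel[OF x, of _ "[]" False "[(x, True)]"]] by simp
    finally show ?thesis using False by simp
  qed simp
  from weq_context[OF this, of "[]" w] have "weq (p # w) ((x, True) # w)" by (simp add: p)
  also have "weq \<dots> ((x, True) # pos (map fst w))"
    using weq_context[OF Cons.IH, of "[(x, True)]" "[]"] Cons.prems by simp
  finally show ?case by (simp add: p)
qed simp

lemma word_val_append:
  assumes "fst ` set u \<subseteq> S" "fst ` set v \<subseteq> S"
  shows "word_val G u \<in> carrier G" "word_val G (u @ v) = word_val G u \<otimes> word_val G v"
proof -
  have c: "word_val G w \<in> carrier G" if "fst ` set w \<subseteq> S" for w
    using that by (induction w) (auto simp: word_val_def)
  then show "word_val G u \<in> carrier G" using assms(1) .
  show "word_val G (u @ v) = word_val G u \<otimes> word_val G v"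
    using assms(1) c[OF assms(2)] c by (induction u) (auto simp: word_val_def m_assoc)
qed

lemma word_val_eq: "fst ` set w \<subseteq> S \<Longrightarrow> word_val G w = val (map fst w)"
  by (induction w) (auto simp: word_val_def)

text \<open>Contexts in \<open>word_step\<close> are arbitrary words, so an induction over
  \<open>equivclp\<close> must carry along that all letters lie in \<open>S\<close>.\<close>

lemma word_step_sound:
  assumes "word_step S (coxeter_relators G S) u v"
  shows "(fst ` set u \<subseteq> S \<longleftrightarrow> fst ` set v \<subseteq> S) \<and> (fst ` set u \<subseteq> S \<longrightarrow> word_val G u = word_val G v)"
proof -
  have drop: "word_val G (a @ r @ c) = word_val G (a @ c)"
    if "fst ` set a \<subseteq> S" "fst ` set r \<subseteq> S" "fst ` set c \<subseteq> S" "word_val G r = \<one>" for a r c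
    using that by (simp add: word_val_append image_Un)
  show ?thesis
    using assms
  proof cases
    case (cancel x a b c)
    then have "word_val G [(x, b), (x, \<not> b)] = \<one>" by (simp add: word_val_def)
    then show ?thesis using cancel drop[of a "[(x, b), (x, \<not> b)]" c] by auto
  next
    case (relator r a c)
    then obtain s s' where r: "s \<in> S" "s' \<in> S" "r = concat (replicate (ord (s \<otimes> s')) [(s, True), (s', True)])"
      unfolding coxeter_relators_def by auto
    have r': "map fst r = alt s s' (2 * ord (s \<otimes> s'))"
      unfolding r(3) concat_replicate_alt by (simp add: comp_def)
    then have rS: "fst ` set r \<subseteq> S" using r(1,2) by (metis set_alt_S set_map)
    then have "word_val G r = \<one>"
      unfolding word_val_eq[OF rS] r' using r(1,2) val_alt(1)[of s s' "ord (s \<otimes> s')"] by simp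
    then show ?thesis using relator(1,2) rS drop[of a r c] by (auto simp: image_Un)
  qed
qed

theorem coxeter_system: "coxeter_system G S"
proof -
  have "presents G S (coxeter_relators G S)"
    unfolding presents_def
  proof (intro conjI allI impI S_gen)
    fix u v :: "('a \<times> bool) list"
    assume u: "fst ` set u \<subseteq> S" and v: "fst ` set v \<subseteq> S"
    show "word_val G u = word_val G v \<longleftrightarrow> equivclp (word_step S (coxeter_relators G S)) u v"
    proof
      assume "word_val G u = word_val G v"
      then have "weq (pos (map fst u)) (pos (map fst v))" using u v by (intro words_equiv) (auto simp: word_val_eq)
      then have "weq u v" using weq_pos[OF u] weq_pos[OF v] by (blast intro: weq_trans weq_sym)
      then show "equivclp (word_step S (coxeter_relators G S)) u v" by (simp add: weq_def)
    next
      assume "equivclp (word_step S (coxeter_relators G S)) u v"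
      then have "fst ` set v \<subseteq> S \<and> word_val G u = word_val G v"
      proof (induction rule: equivclp_induct)
        case (step y z)
        then show ?case using word_step_sound[of y z] word_step_sound[of z y] by auto
      qed (use u in auto)
      then show "word_val G u = word_val G v" by simp
    qed
  qed
  then show ?thesis
    using S_sub T_ne_one by (auto simp: coxeter_system_def)
qed

subsection \<open>Reflection subgroups\<close>

text \<open>Exchange applied to a reduced word of \<open>t\<close> and to \<open>t\<close> itself
  gives \<open>us @ x # vs\<close> with \<open>us @ vs\<close> of value \<open>\<one>\<close>. Both
  parts are reduced, so they have equal length and \<open>t\<close> is the conjugate of
  \<open>x\<close> by \<open>us\<close>. Conjugating with the first letter of \<open>us\<close>
  removes two letters.\<close>

lemma refl_shorten:
  assumes "t \<in> T" "t \<notin> S"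
  obtains s where "s \<in> S" "len (s \<otimes> t \<otimes> s) < len t"
proof -
  obtain ws where ws: "set ws \<subseteq> S" "val ws = t" "length ws = len t" using reduced_word assms by (metis T_closed)
  obtain us x vs where d: "ws = us @ x # vs" "t \<otimes> val ws = val (us @ vs)"
    using exchange[of ws t] ws N_self assms by auto
  have S: "set us \<subseteq> S" "x \<in> S" "set vs \<subseteq> S" using d ws by auto
  have one: "val us \<otimes> val vs = \<one>" using d ws assms S by (simp add: val_append)
  have lu: "len (val us) = length us" and lv: "len (val vs) = length vs"
    using reduced_appendD[of us "x # vs"] reduced_appendD[of "us @ [x]" vs] d ws S by auto
  have vs: "val vs = inv (val us)" using one S by (metis inv_equality inv_inv inv_closed val_closed words_closed)
  have "length us = length vs" using vs lu lv len_inv[of "val us"] S by simp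
  show thesis
  proof (cases us)
    case Nil
    then show ?thesis using d ws \<open>length us = length vs\<close> S assms by simp
  next
    case (Cons s us')
    have s: "s \<in> S" "set us' \<subseteq> S" using S Cons by auto
    have "t = val us \<otimes> x \<otimes> inv (val us)" using d ws S vs by (auto simp: val_append m_assoc)
    then have "s \<otimes> t \<otimes> s = val us' \<otimes> x \<otimes> inv (val us')"
      using Cons s S by (simp add: m_assoc inv_mult_group)
    then have "s \<otimes> t \<otimes> s = val (us' @ x # rev us')" using s S by (simp add: val_append val_rev m_assoc)
    then have "len (s \<otimes> t \<otimes> s) \<le> length (us' @ x # rev us')" using len_val_le[of "us' @ x # rev us'"] s S by simp
    also have "\<dots> < len t" using \<open>length us = length vs\<close> Cons ws d by auto
    finally show ?thesis using that s by blast
  qed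
qed

text \<open>Dyer's canonical generators. Geometrically they are the reflections in the walls of the
  region around the base point that is cut out by the mirrors of \<open>T'\<close>.\<close>

definition canonical :: "'a set \<Rightarrow> 'a set" where
  "canonical T' = {t \<in> T'. N t \<inter> T' = {t}}"

text \<open>
  Dyer's argument: if a simple reflection \<open>s\<close> shortening \<open>t\<close> is not in \<open>T'\<close>, conjugate
  everything by \<open>s\<close>; since \<open>N s\<close> misses \<open>T'\<close>, this conjugates the canonical generators.
\<close>

lemma canonical_generate:
  assumes "T' \<subseteq> T" "\<And>r t. r \<in> T' \<Longrightarrow> t \<in> T' \<Longrightarrow> r \<otimes> t \<otimes> r \<in> T'" "t \<in> T'"
  shows "t \<in> generate G (canonical T')"
  using assms
proof (induction "len t" arbitrary: t T' rule: less_induct)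
  case less
  have tT: "t \<in> T" using less.prems by auto
  show ?case
  proof (cases "t \<in> S")
    case True
    then show ?thesis using less.prems by (intro generate.incl) (auto simp: canonical_def N_simple)
  next
    case False
    obtain s where s: "s \<in> S" "len (s \<otimes> t \<otimes> s) < len t" using refl_shorten[OF tT False] .
    show ?thesis
    proof (cases "s \<in> T'")
      case True
      then have "s \<otimes> t \<otimes> s \<in> generate G (canonical T')" using less.hyps[OF s(2) less.prems(1,2)] less.prems by blast
      moreover have sg: "s \<in> generate G (canonical T')"
        using True s by (intro generate.incl) (auto simp: canonical_def N_simple)
      ultimately have "s \<otimes> (s \<otimes> t \<otimes> s) \<otimes> s \<in> generate G (canonical T')" by (blast intro: generate.eng)
      then show ?thesis using s tT by (simp add: m_assoc)
    next
      case False
      define c where "c = (\<lambda>r. s \<otimes> r \<otimes> s)"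
      have cc: "c (c r) = r" if "r \<in> carrier G" for r using that s by (simp add: c_def m_assoc)
      have cm: "c (a \<otimes> b) = c a \<otimes> c b" if "a \<in> carrier G" "b \<in> carrier G" for a b
        using that s by (simp add: c_def m_assoc)
      have ccl: "c r \<in> carrier G" if "r \<in> carrier G" for r using that s by (simp add: c_def)
      have T'c: "r \<in> carrier G" "r \<in> T" if "r \<in> T'" for r using that less.prems by auto
      have "c t \<in> generate G (canonical (c ` T'))"
      proof (rule less.hyps)
        show "len (c t) < len t" using s by (simp add: c_def)
        show "c ` T' \<subseteq> T" using T'c T_conj_refl s by (auto simp: c_def)
        fix r t assume "r \<in> c ` T'" "t \<in> c ` T'"
        then obtain r' t' where rt: "r' \<in> T'" "t' \<in> T'" "r = c r'" "t = c t'" by blast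
        then have "r \<otimes> t \<otimes> r = c (r' \<otimes> t' \<otimes> r')" by (simp add: cm T'c)
        then show "r \<otimes> t \<otimes> r \<in> c ` T'" using rt less.prems by blast
      qed (use less.prems in auto)
      moreover have *: "c h \<in> canonical T' \<and> h \<in> T" if h: "h \<in> canonical (c ` T')" for h
        proof -
          obtain r where r: "r \<in> T'" "h = c r" "N h \<inter> c ` T' = {h}" using h by (auto simp: canonical_def)
          have "x \<in> N r \<longleftrightarrow> c x \<in> N h" if x: "x \<in> T'" for x
          proof -
            have "s \<noteq> x" "r \<otimes> x \<otimes> r \<noteq> s" using x r False less.prems by auto
            have sr: "h = s \<otimes> (r \<otimes> s)" using r s T'c by (simp add: c_def m_assoc)
            have "c x \<in> T" using x T'c T_conj_refl s by (auto simp: c_def)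
            then have "c x \<in> N h \<longleftrightarrow> (c x = s) \<noteq> (c (c x) \<in> N (r \<otimes> s))"
              using N_simple_mult[of s "r \<otimes> s" "c x"] s r T'c sr by (simp add: c_def)
            moreover have "c x \<noteq> s" using \<open>s \<noteq> x\<close> cc[of x] T'c x s by (auto simp: c_def)
            moreover have "x \<in> N (r \<otimes> s) \<longleftrightarrow> (x \<in> N r) \<noteq> (r \<otimes> x \<otimes> r = s)"
              using N_mult[of r s x] r s T'c x N_simple[of s] by simp
            ultimately show ?thesis using \<open>r \<otimes> x \<otimes> r \<noteq> s\<close> cc T'c x by auto
          qed
          then have "N r \<inter> T' = {r}" using r N_self[of r] T'c cc by (auto dest: imageI) (metis IntI cc imageI singletonD T'c(1) r(1))
          then show ?thesis using r T'c cc T_conj_refl[of s r] s by (simp add: canonical_def c_def)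
        qed
      moreover have "c g \<in> generate G (canonical T')" if "g \<in> generate G (canonical (c ` T'))" for g
        using that
      proof (induction rule: generate.induct)
        case one
        then show ?case using s by (simp add: c_def generate.one)
      next
        case (incl h)
        then show ?case using * by (blast intro: generate.incl)
      next
        case (inv h)
        then have "c (inv h) = c h" using * by auto
        then show ?case using * inv by (metis generate.incl)
      next
        case (eng h1 h2)
        have "canonical (c ` T') \<subseteq> carrier G" using T'c ccl by (auto simp: canonical_def)
        then have "h1 \<in> carrier G" "h2 \<in> carrier G" using eng generate_in_carrier by blast+
        then show ?case using eng cm generate.eng by metis
      qed
      ultimately have "c (c t) \<in> generate G (canonical T')" by blast
      then show ?thesis using cc tT by simp
    qed
  qed
qed

lemma subsystem:
  assumes "T' \<subseteq> T" "\<And>r t. r \<in> T' \<Longrightarrow> t \<in> T' \<Longrightarrow> r \<otimes> t \<otimes> r \<in> T'"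
  shows "reflection_system (G\<lparr>carrier := generate G T'\<rparr>) (canonical T') T' (\<lambda>g. N g \<inter> T')"
proof -
  let ?H = "G\<lparr>carrier := generate G T'\<rparr>"
  have T'c: "T' \<subseteq> carrier G" using assms T_sub by auto
  have sub: "subgroup (generate G T') G" by (rule generate_is_subgroup[OF T'c])
  have cl: "g \<in> carrier G" if "g \<in> generate G T'" for g using that generate_in_carrier T'c by blast
  have invs: "inv\<^bsub>?H\<^esub> g = inv g" if "g \<in> generate G T'" for g
    using that sub by simp
  have conj: "g \<in> generate G T' \<Longrightarrow> t \<in> T' \<Longrightarrow> g \<otimes> t \<otimes> inv g \<in> T'" for g t
  proof (induction arbitrary: t rule: generate.induct)
    case one then show ?case using assms by auto
  next
    case (incl h) then show ?case using assms by (metis T_inv subsetD)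
  next
    case (inv h) then show ?case using assms by (metis T_inv subsetD)
  next
    case (eng h1 h2)
    then have "h1 \<in> carrier G" "h2 \<in> carrier G" "t \<in> carrier G" using cl T'c by auto
    then have "h1 \<otimes> h2 \<otimes> t \<otimes> inv (h1 \<otimes> h2) = h1 \<otimes> (h2 \<otimes> t \<otimes> inv h2) \<otimes> inv h1"
      by (simp add: m_assoc inv_mult_group)
    then show ?case using eng by simp
  qed
  have can: "canonical T' \<subseteq> T'" by (auto simp: canonical_def)
  have gen: "generate G (canonical T') = generate G T'"
  proof
    show "generate G (canonical T') \<subseteq> generate G T'" using can by (rule mono_generate)
    have "subgroup (generate G (canonical T')) G" using can T'c by (intro generate_is_subgroup) auto
    moreover have "T' \<subseteq> generate G (canonical T')" using canonical_generate[OF assms] by auto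
    ultimately show "generate G T' \<subseteq> generate G (canonical T')" by (intro generate_subgroup_incl)
  qed
  interpret H: group ?H using sub by (rule subgroup_imp_group)
  show ?thesis
  proof unfold_locales
    show "canonical T' \<subseteq> T'" by (rule can)
    show "T' \<subseteq> carrier (?H)" by (auto intro: generate.incl)
    show "t \<otimes>\<^bsub>?H\<^esub> t = \<one>\<^bsub>?H\<^esub>" if "t \<in> T'" for t
      using that assms by auto
    show "generate (?H) (canonical T') = carrier (?H)"
      using generate_consistent[of "canonical T'" "generate G T'"] can sub gen by (auto intro: generate.incl)
  next
    fix g t assume g: "g \<in> carrier (?H)" and t: "t \<in> T'"
    then show "g \<otimes>\<^bsub>?H\<^esub> t \<otimes>\<^bsub>?H\<^esub> inv\<^bsub>?H\<^esub> g \<in> T'"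
      using conj invs by simp
    fix h assume h: "h \<in> carrier (?H)"
    have "inv g \<otimes> t \<otimes> g \<in> T'"
      using conj[of "inv g" t] g t cl generate_m_inv_closed[OF T'c] by simp
    then show "(t \<in> N (g \<otimes>\<^bsub>?H\<^esub> h) \<inter> T') =
        ((t \<in> N g \<inter> T') \<noteq> (inv\<^bsub>?H\<^esub> g \<otimes>\<^bsub>?H\<^esub> t \<otimes>\<^bsub>?H\<^esub> g \<in> N h \<inter> T'))"
      using N_mult[of g h t] g h t cl invs assms by auto
  next
    fix g assume "g \<in> carrier (?H)"
    then show "finite (N g \<inter> T')" using N_fin cl by simp
  next
    fix t assume "t \<in> T'"
    then show "t \<in> N t \<inter> T'" using N_self assms by auto
  next
    fix s assume "s \<in> canonical T'"
    then show "N s \<inter> T' = {s}" by (simp add: canonical_def)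
  qed auto
qed

subsection \<open>Reflections commuting with a simple reflection\<close>

definition commuting :: "'a \<Rightarrow> 'a set" where
  "commuting s = {r \<in> T. r \<otimes> s = s \<otimes> r \<and> r \<noteq> s}"

lemma commutingD: "r \<in> commuting s \<Longrightarrow> r \<in> T \<and> r \<otimes> s = s \<otimes> r \<and> r \<noteq> s"
  by (simp add: commuting_def)

text \<open>The hypothesis \<open>s \<otimes> g = g \<otimes> t\<close> means geometrically that
  \<open>g\<close> maps the mirror of \<open>t\<close> to the mirror of \<open>s\<close>. Paths and
  elementary moves are tracked in this inverse-free form.\<close>

lemma conj_intertwine:
  assumes "g \<in> carrier G" "s \<in> T" "t \<in> T" "s \<otimes> g = g \<otimes> t"
  shows "inv g \<otimes> s \<otimes> g = t" "g \<otimes> t \<otimes> inv g = s" "t \<otimes> inv g = inv g \<otimes> s"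
proof -
  have "inv g \<otimes> s \<otimes> g = inv g \<otimes> (s \<otimes> g)" using assms(1,2) by (simp add: m_assoc)
  also have "\<dots> = t" unfolding assms(4) using assms(1,3) by simp
  finally show *: "inv g \<otimes> s \<otimes> g = t" .
  show "g \<otimes> t \<otimes> inv g = s" "t \<otimes> inv g = inv g \<otimes> s"
    using assms(1,2) by (simp_all flip: * add: m_assoc)
qed

lemma commuting_conj:
  assumes "g \<in> carrier G" "s \<in> T" "t \<in> T" "s \<otimes> g = g \<otimes> t" "r \<in> commuting s"
  shows "inv g \<otimes> r \<otimes> g \<in> commuting t"
proof -
  have r: "r \<in> T" "r \<otimes> s = s \<otimes> r" "r \<noteq> s" using commutingD[OF assms(5)] by auto
  have c: "g \<in> carrier G" "s \<in> carrier G" "r \<in> carrier G" using assms r by auto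
  have t: "t = inv g \<otimes> s \<otimes> g" using conj_intertwine(1)[OF assms(1-4)] by simp
  have "(inv g \<otimes> r \<otimes> g) \<otimes> t = inv g \<otimes> (r \<otimes> s) \<otimes> g" unfolding t using c by (simp add: m_assoc)
  also have "\<dots> = inv g \<otimes> (s \<otimes> r) \<otimes> g" using r by simp
  also have "\<dots> = t \<otimes> (inv g \<otimes> r \<otimes> g)" unfolding t using c by (simp add: m_assoc)
  finally have "(inv g \<otimes> r \<otimes> g) \<otimes> t = t \<otimes> (inv g \<otimes> r \<otimes> g)" .
  moreover have "inv g \<otimes> r \<otimes> g \<noteq> t"
  proof
    assume "inv g \<otimes> r \<otimes> g = t"
    then have "g \<otimes> (inv g \<otimes> r \<otimes> g) \<otimes> inv g = g \<otimes> (inv g \<otimes> s \<otimes> g) \<otimes> inv g" using t by simp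
    then have "r = s" using c by (simp add: m_assoc)
    then show False using r by simp
  qed
  ultimately show ?thesis using T_conj'[OF assms(1)] r by (simp add: commuting_def)
qed

lemma commuting_conj':
  assumes "g \<in> carrier G" "s \<in> T" "t \<in> T" "s \<otimes> g = g \<otimes> t" "r \<in> commuting t"
  shows "g \<otimes> r \<otimes> inv g \<in> commuting s"
  using commuting_conj[of "inv g" t s r] conj_intertwine(3)[OF assms(1-4)] assms(1-3,5) by simp

lemma N_inv_intertwine:
  assumes "g \<in> carrier G" "s \<in> T" "t \<in> T" "s \<otimes> g = g \<otimes> t"
  shows "t \<in> N (inv g) \<longleftrightarrow> s \<in> N g"
    and "N g \<inter> commuting s = {} \<Longrightarrow> N (inv g) \<inter> commuting t = {}"
proof -
  show "t \<in> N (inv g) \<longleftrightarrow> s \<in> N g"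
    using N_inv[OF assms(1,3)] conj_intertwine(2)[OF assms] by simp
  show "N (inv g) \<inter> commuting t = {}" if "N g \<inter> commuting s = {}"
    using that N_inv[OF assms(1)] commuting_conj'[OF assms] commutingD by blast
qed

lemma commuting_closed:
  assumes "s \<in> T" "r \<in> commuting s" "t \<in> commuting s"
  shows "r \<otimes> t \<otimes> r \<in> commuting s"
  using commuting_conj[of r s s t] commutingD[OF assms(2)] assms by simp

text \<open>Otherwise the Klein four-group generated by \<open>s\<close> and \<open>r\<close> would have the single canonical generator \<open>s\<close>.\<close>

lemma simple_not_inversion_of_commuting:
  assumes s: "s \<in> S" and r: "r \<in> commuting s"
  shows "s \<notin> N r"
proof
  note rD = commutingD[OF r]
  assume "s \<in> N r"
  have "x \<otimes> y \<otimes> x \<in> {s, r}" if "x \<in> {s, r}" "y \<in> {s, r}" for x y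
  proof -
    have "s \<otimes> r \<otimes> s = r" "r \<otimes> s \<otimes> r = s" using rD s by (simp_all add: m_assoc)
    then show ?thesis using that rD s by (auto simp: m_assoc)
  qed
  then have "r \<in> generate G (canonical {s, r})" using rD s by (intro canonical_generate) auto
  moreover have "canonical {s, r} \<subseteq> {s}" using \<open>s \<in> N r\<close> rD by (auto simp: canonical_def)
  ultimately have "r \<in> generate G {s}" using mono_generate by blast
  moreover have "subgroup {\<one>, s} G" using s by unfold_locales auto
  ultimately have "r \<in> {\<one>, s}" using generate_subgroup_incl[of "{s}" "{\<one>, s}"] by auto
  then show False using rD T_ne_one by auto
qed

subsection \<open>Elementary moves\<close>

text \<open>
  \<open>nu t u\<close> is the longest element of the dihedral group \<open>\<langle>t, u\<rangle>\<close> with \<open>t\<close> removed. Geometrically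
  it rotates the facet \<open>F\<^sub>t\<close> about the ridge \<open>F\<^sub>t \<inter> F\<^sub>u\<close> to the next facet in the same mirror.
\<close>

definition nu :: "'a \<Rightarrow> 'a \<Rightarrow> 'a" where
  "nu t u = val (alt u t (ord (t \<otimes> u) - 1))"

lemma nu_closed [simp]: "t \<in> S \<Longrightarrow> u \<in> S \<Longrightarrow> nu t u \<in> carrier G"
  by (simp add: nu_def)

lemma nu_odd: "t \<in> S \<Longrightarrow> u \<in> S \<Longrightarrow> odd (ord (t \<otimes> u)) \<Longrightarrow> nu t u = (u \<otimes> t) [^] (ord (t \<otimes> u) div 2)"
  using val_alt(1)[of u t "ord (t \<otimes> u) div 2"] by (simp add: nu_def)

lemma nu_even:
  assumes "t \<in> S" "u \<in> S" "even (ord (t \<otimes> u))" "ord (t \<otimes> u) > 0"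
  shows "nu t u = (u \<otimes> t) [^] (ord (t \<otimes> u) div 2 - 1) \<otimes> u"
proof -
  have "ord (t \<otimes> u) - 1 = Suc (2 * (ord (t \<otimes> u) div 2 - 1))"
    using assms(3,4) by (elim evenE) auto
  then show ?thesis using val_alt(2)[of u t "ord (t \<otimes> u) div 2 - 1"] assms(1,2) by (simp only: nu_def) simp
qed

lemma N_nu:
  assumes "t \<in> S" "u \<in> S" 
  shows "N (nu t u) = (\<lambda>i. (u \<otimes> t) [^] i \<otimes> u) ` {..<ord (t \<otimes> u) - 1}"
    "len (nu t u) = ord (t \<otimes> u) - 1"
  using N_alt[of u t "ord (t \<otimes> u) - 1"] len_alt[of u t "ord (t \<otimes> u) - 1"] assms ord_swap[of t u]
  by (auto simp: nu_def)

lemma nu_not_inversion: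
  assumes "t \<in> S" "u \<in> S"
  shows "t \<notin> N (nu t u)"
proof
  assume "t \<in> N (nu t u)"
  then obtain i where i: "i < ord (t \<otimes> u) - 1" "t = (u \<otimes> t) [^] i \<otimes> u" using N_nu assms by auto
  then have "(u \<otimes> t) [^] Suc i = \<one>"
    using assms by (metis T_sq S_T T_closed m_assoc m_closed nat_pow_Suc nat_pow_closed)
  then have "ord (u \<otimes> t) dvd Suc i" using pow_eq_id[of "u \<otimes> t" "Suc i"] assms by simp
  then show False using i ord_swap[of t u] assms by (auto dest: dvd_imp_le)
qed

text \<open>\<open>t \<otimes> nu t u\<close> is the longest element of the dihedral group. By the
  braid relation it also has the alternating word that starts with \<open>u\<close>, whose last
  letter is determined by the parity of the order.\<close>

lemma nu_conj:
  assumes "t \<in> S" "u \<in> S" "ord (t \<otimes> u) > 0"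
  shows "t \<otimes> nu t u = nu t u \<otimes> (if odd (ord (t \<otimes> u)) then u else t)"
proof -
  obtain k where k: "ord (t \<otimes> u) = Suc k" using assms(3) by (cases "ord (t \<otimes> u)") auto
  have "t \<otimes> nu t u = val (alt t u (Suc k))" by (simp add: nu_def k)
  also have "\<dots> = val (alt u t (Suc k))" using val_braid[OF assms(1,2)] k by simp
  also have "\<dots> = nu t u \<otimes> (if odd (ord (t \<otimes> u)) then u else t)"
    unfolding alt_snoc using assms by (simp add: val_append nu_def k)
  finally show ?thesis .
qed

lemma nu_inv_odd:
  assumes "t \<in> S" "u \<in> S" "odd (ord (t \<otimes> u))"
  shows "inv (nu t u) = nu u t"
  using assms nu_odd[of t u] nu_odd[of u t] ord_swap[of t u]
  by (simp flip: nat_pow_inv add: inv_mult_group)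

text \<open>An inversion \<open>(u \<otimes> t) [^] i \<otimes> u\<close> that commutes with
  \<open>t\<close> gives \<open>(u \<otimes> t) [^] (2 * Suc i) = \<one>\<close>. As
  \<open>Suc i\<close> is smaller than the order \<open>m\<close>, divisibility leaves only
  \<open>m = 2 * Suc i\<close>, and for this \<open>i\<close> the inversion is \<open>nu t u\<close>
  itself.\<close>

lemma N_nu_commuting:
  assumes "t \<in> S" "u \<in> S" "t \<noteq> u" "ord (t \<otimes> u) > 0"
  shows "N (nu t u) \<inter> commuting t = (if odd (ord (t \<otimes> u)) then {} else {nu t u})"
proof -
  let ?m = "ord (t \<otimes> u)"
  have m: "ord (u \<otimes> t) = ?m" using ord_swap[of t u] assms by simp
  have half: "even ?m \<and> i = ?m div 2 - 1"
    if i: "i < ?m - 1" and c: "(u \<otimes> t) [^] i \<otimes> u \<otimes> t = t \<otimes> ((u \<otimes> t) [^] i \<otimes> u)" for i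
  proof -
    have "(u \<otimes> t) [^] Suc i = (u \<otimes> t) [^] i \<otimes> u \<otimes> t" using assms by (simp add: m_assoc)
    also have "\<dots> = t \<otimes> (u \<otimes> t) [^] i \<otimes> u" using c assms by (simp add: m_assoc)
    also have "\<dots> = (t \<otimes> u) [^] Suc i" using pow_push[of t u i] assms by (simp add: m_assoc)
    finally have "(u \<otimes> t) [^] Suc i = inv ((u \<otimes> t) [^] Suc i)"
      using assms nat_pow_inv[of "u \<otimes> t" "Suc i"] by (simp add: inv_mult_group del: nat_pow_Suc)
    then have "(u \<otimes> t) [^] Suc i \<otimes> (u \<otimes> t) [^] Suc i = \<one>"
      using assms by (metis S_T T_closed m_closed nat_pow_closed r_inv)
    then have "(u \<otimes> t) [^] (Suc i + Suc i) = \<one>" using nat_pow_mult[of "u \<otimes> t" "Suc i" "Suc i"] assms by (metis S_T T_closed m_closed)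
    then have "?m dvd 2 * Suc i" using pow_eq_id[of "u \<otimes> t" "Suc i + Suc i"] m assms by (simp add: mult_2)
    then obtain k where k: "2 * Suc i = ?m * k" by (elim dvdE)
    then have "k = 1"
    proof -
      have "k \<noteq> 0"
      proof
        assume "k = 0"
        then show False using k by simp
      qed
      moreover have "\<not> k \<ge> 2"
      proof
        assume "k \<ge> 2"
        then have "?m * 2 \<le> 2 * Suc i" using k by (metis mult_le_mono2)
        then show False using i by simp
      qed
      ultimately show ?thesis by simp
    qed
    then have "?m = 2 * Suc i" using k by simp
    then show ?thesis by simp
  qed
  have sub: "N (nu t u) \<inter> commuting t \<subseteq> (if odd ?m then {} else {nu t u})"
  proof
    fix x assume x: "x \<in> N (nu t u) \<inter> commuting t"
    then obtain i where i: "i < ?m - 1" "x = (u \<otimes> t) [^] i \<otimes> u" using N_nu assms by auto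
    moreover have "x \<otimes> t = t \<otimes> x" using x commutingD by blast
    ultimately have "even ?m \<and> i = ?m div 2 - 1" using half by blast
    then show "x \<in> (if odd ?m then {} else {nu t u})" using i nu_even[of t u] assms by auto
  qed
  moreover have "nu t u \<in> N (nu t u) \<inter> commuting t" if "even ?m"
  proof -
    have "?m \<ge> 2" using that assms(4) by (elim evenE) auto
    then have "?m div 2 - 1 < ?m - 1" by simp
    then have "nu t u \<in> N (nu t u)" using nu_even[of t u] N_nu(1)[of t u] that assms by auto
    moreover have "nu t u \<in> T" using N_sub[of "nu t u"] assms calculation by auto
    ultimately show ?thesis using nu_conj[of t u] nu_not_inversion[of t u] that assms
      by (auto simp: commuting_def)
  qed
  ultimately show ?thesis by (auto split: if_splits)
qed

lemma nu_even_T: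
  assumes "t \<in> S" "u \<in> S" "t \<noteq> u" "ord (t \<otimes> u) > 0" "even (ord (t \<otimes> u))"
  shows "nu t u \<in> commuting t" "nu t u \<in> T" "nu t u \<in> N (nu t u)"
  using N_nu_commuting[OF assms(1-4)] assms(5) commutingD by auto

subsection \<open>Paths in the odd Coxeter diagram\<close>

abbreviation odd_path :: "'a list \<Rightarrow> bool" where
  "odd_path \<equiv> edge_path S (oddly_joined G S)"

lemma oddly_joinedD: "oddly_joined G S t u \<Longrightarrow> t \<in> S \<and> u \<in> S \<and> t \<noteq> u \<and> odd (ord (t \<otimes> u))"
  by (simp add: oddly_joined_def)

lemma odd_path_Cons:
  "odd_path (t # u # ts) \<longleftrightarrow> oddly_joined G S t u \<and> odd_path (u # ts)"
  by (auto simp: edge_path_def oddly_joined_def)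

lemma odd_path_single: "odd_path [t] \<longleftrightarrow> t \<in> S"
  by (auto simp: edge_path_def)

lemma odd_path_snoc: "\<gamma> \<noteq> [] \<Longrightarrow> odd_path (\<gamma> @ [t]) \<longleftrightarrow> odd_path \<gamma> \<and> oddly_joined G S (last \<gamma>) t"
  by (auto simp: edge_path_def oddly_joined_def successively_append_iff)

lemma p_elt_Cons: "odd_path (t # u # ts) \<Longrightarrow> p_elt G (t # u # ts) = nu t u \<otimes> p_elt G (u # ts)"
  using nu_odd[of t u] by (auto simp: odd_path_Cons oddly_joined_def)

lemma odd_path_induct [consumes 1, case_names single Cons]:
  assumes "odd_path \<gamma>" "\<And>t. t \<in> S \<Longrightarrow> P [t]"
    "\<And>t u ts. odd_path (t # u # ts) \<Longrightarrow> odd_path (u # ts) \<Longrightarrow> oddly_joined G S t u \<Longrightarrow> P (u # ts) \<Longrightarrow> P (t # u # ts)"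
  shows "P \<gamma>"
  using assms(1)
proof (induction \<gamma> rule: induct_list012)
  case 1 then show ?case by (simp add: edge_path_def)
next
  case (2 x) then show ?case using assms(2) by (simp add: odd_path_single)
next
  case (3 x y zs) then show ?case using assms(3) by (simp add: odd_path_Cons)
qed

lemma p_elt_closed [simp]: "odd_path \<gamma> \<Longrightarrow> p_elt G \<gamma> \<in> carrier G"
proof (induction rule: odd_path_induct)
  case (Cons t u ts)
  then show ?case unfolding p_elt_Cons[OF Cons(1)] using oddly_joinedD[OF Cons(3)] Cons(4) by (intro m_closed nu_closed) auto
qed simp

lemma odd_path_ends: "odd_path \<gamma> \<Longrightarrow> hd \<gamma> \<in> S \<and> last \<gamma> \<in> S"
  by (auto simp: edge_path_def)

lemma p_elt_conj: "odd_path \<gamma> \<Longrightarrow> hd \<gamma> \<otimes> p_elt G \<gamma> = p_elt G \<gamma> \<otimes> last \<gamma>"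
proof (induction rule: odd_path_induct)
  case (Cons t u ts)
  have tu: "t \<in> S" "u \<in> S" "odd (ord (t \<otimes> u))" using oddly_joinedD[OF Cons(3)] by auto
  define p where "p = p_elt G (u # ts)"
  have l: "last (u # ts) \<in> carrier G" "p \<in> carrier G" using odd_path_ends[OF Cons(2)] S_sub Cons by (auto simp: p_def)
  have "t \<otimes> (nu t u \<otimes> p) = nu t u \<otimes> u \<otimes> p"
    using nu_conj[of t u] tu l odd_pos[OF tu(3)] by (simp flip: m_assoc)
  also have "\<dots> = nu t u \<otimes> p \<otimes> last (u # ts)" using Cons tu l by (simp add: m_assoc p_def)
  finally show ?case using p_elt_Cons[OF Cons(1)] by (simp add: p_def)
qed simp

text \<open>An odd step from \<open>t\<close> to \<open>u\<close> has no inversion commuting with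
  \<open>t\<close>, and conjugation by \<open>nu t u\<close> carries the reflections commuting with
  \<open>t\<close> to those commuting with \<open>u\<close>. So the cocycle rule reduces the claim
  to the rest of the path.\<close>

lemma N_p_elt:
  assumes "odd_path \<gamma>"
  shows "N (p_elt G \<gamma>) \<inter> commuting (hd \<gamma>) = {} \<and> hd \<gamma> \<notin> N (p_elt G \<gamma>)"
  using assms
proof (induction rule: odd_path_induct)
  case (Cons t u ts)
  have tu: "t \<in> S" "u \<in> S" "t \<noteq> u" "odd (ord (t \<otimes> u))" using oddly_joinedD[OF Cons(3)] by auto
  define p where "p = p_elt G (u # ts)"
  have p: "p \<in> carrier G" "p_elt G (t # u # ts) = nu t u \<otimes> p" using Cons p_elt_Cons by (auto simp: p_def)
  have c: "t \<otimes> nu t u = nu t u \<otimes> u" using nu_conj[of t u] tu odd_pos[OF tu(4)] by simp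
  have "x \<notin> N (nu t u \<otimes> p)" if x: "x \<in> commuting t" for x
  proof -
    have "inv (nu t u) \<otimes> x \<otimes> nu t u \<in> commuting u" using commuting_conj[OF _ _ _ c x] tu by simp
    moreover have "x \<notin> N (nu t u)" using N_nu_commuting[of t u] tu odd_pos[OF tu(4)] x by auto
    ultimately show ?thesis using N_mult[of "nu t u" p x] p tu commutingD[OF x] Cons by (auto simp: p_def)
  qed
  moreover have "t \<notin> N (nu t u \<otimes> p)"
  proof -
    have "inv (nu t u) \<otimes> t \<otimes> nu t u = u" using conj_intertwine(1)[OF _ _ _ c] tu by simp
    then show ?thesis using N_mult[of "nu t u" p t] p tu nu_not_inversion[of t u] Cons by (auto simp: p_def)
  qed
  ultimately show ?case using p by auto
qed simp

lemma p_elt_append: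
  assumes "odd_path (\<gamma> @ [t])" "odd_path (t # \<delta>)"
  shows "p_elt G (\<gamma> @ t # \<delta>) = p_elt G (\<gamma> @ [t]) \<otimes> p_elt G (t # \<delta>)"
  using assms
proof (induction \<gamma> rule: induct_list012)
  case (2 x)
  then have xt: "odd_path [x, t]" "odd_path (x # t # \<delta>)" "x \<in> S" "t \<in> S"
    by (auto simp: odd_path_Cons dest: oddly_joinedD)
  show ?case using p_elt_Cons[OF xt(1)] p_elt_Cons[OF xt(2)] xt by simp
next
  case (3 x y zs)
  have xy: "x \<in> S" "y \<in> S" "odd_path (y # zs @ [t])" "oddly_joined G S x y"
    using 3 by (auto simp: odd_path_Cons dest: oddly_joinedD)
  have app: "odd_path (y # zs @ t # \<delta>)"
    using xy 3(4) by (auto simp: edge_path_def successively_append_iff simp flip: append_Cons)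
  have "p_elt G ((x # y # zs) @ t # \<delta>) = nu x y \<otimes> (p_elt G (y # zs @ [t]) \<otimes> p_elt G (t # \<delta>))"
    using p_elt_Cons[of x y "zs @ t # \<delta>"] 3 app xy by (auto simp: odd_path_Cons)
  also have "\<dots> = p_elt G ((x # y # zs) @ [t]) \<otimes> p_elt G (t # \<delta>)"
    using p_elt_Cons[of x y "zs @ [t]"] 3 xy by (auto simp: m_assoc)
  finally show ?case .
qed simp

lemma p_elt_snoc:
  assumes "odd_path \<gamma>" "oddly_joined G S (last \<gamma>) t"
  shows "p_elt G (\<gamma> @ [t]) = p_elt G \<gamma> \<otimes> nu (last \<gamma>) t"
proof -
  have ne: "\<gamma> \<noteq> []" using assms by (auto simp: edge_path_def)
  then have e: "butlast \<gamma> @ [last \<gamma>] = \<gamma>" by simp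
  have tS: "last \<gamma> \<in> S" "t \<in> S" using oddly_joinedD[OF assms(2)] by auto
  have "p_elt G (butlast \<gamma> @ last \<gamma> # [t]) = p_elt G (butlast \<gamma> @ [last \<gamma>]) \<otimes> p_elt G [last \<gamma>, t]"
    using assms e tS by (intro p_elt_append) (auto simp: odd_path_Cons odd_path_single)
  moreover have "butlast \<gamma> @ last \<gamma> # [t] = \<gamma> @ [t]" using e by (metis append.assoc append_Cons append_Nil)
  ultimately show ?thesis using e p_elt_Cons[of "last \<gamma>" t "[]"] assms tS
    by (auto simp: odd_path_Cons odd_path_single)
qed

lemma r_elt_eq:
  assumes "odd_path \<gamma>" "evenly_joined G S (last \<gamma>) u"
  shows "r_elt G \<gamma> u = p_elt G \<gamma> \<otimes> nu (last \<gamma>) u \<otimes> inv (p_elt G \<gamma>)"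
  using assms nu_even[of "last \<gamma>" u] ord_swap[of "last \<gamma>" u]
  by (auto simp: r_elt_def evenly_joined_def Let_def)

text \<open>With \<open>r = p \<otimes> v \<otimes> inv p\<close>, neither outer factor has a
  relevant inversion, by \<open>N_p_elt\<close> and \<open>N_inv\<close>. Among the commuting
  reflections only the inversion \<open>v\<close> of the middle factor survives, and conjugation by
  \<open>p\<close> turns it into \<open>r\<close>.\<close>

lemma r_elt_canonical:
  assumes "odd_path \<gamma>" "evenly_joined G S (last \<gamma>) u"
  shows "r_elt G \<gamma> u \<in> canonical (commuting (hd \<gamma>))"
proof -
  define s t p v where d: "s = hd \<gamma>" "t = last \<gamma>" "p = p_elt G \<gamma>" "v = nu t u"
  have st: "s \<in> S" "t \<in> S" "u \<in> S" "p \<in> carrier G" "s \<otimes> p = p \<otimes> t" "t \<noteq> u" "ord (t \<otimes> u) > 0" "even (ord (t \<otimes> u))"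
    using assms odd_path_ends[OF assms(1)] p_elt_conj[OF assms(1)] by (auto simp: d evenly_joined_def)
  have v: "v \<in> commuting t" "v \<in> T" "N v \<inter> commuting t = {v}"
    using nu_even_T[of t u] N_nu_commuting[of t u] st by (auto simp: d)
  define r where "r = p \<otimes> v \<otimes> inv p"
  have rs: "r \<in> commuting s" unfolding r_def using commuting_conj'[of p s t v] st v by simp
  have "x \<in> N r \<longleftrightarrow> x = r" if x: "x \<in> commuting s" for x
  proof -
    define y where "y = inv p \<otimes> x \<otimes> p"
    have xT: "x \<in> T" using x commutingD by blast
    have y: "y \<in> commuting t" "y \<in> T" unfolding y_def using commuting_conj[of p s t x] st x commutingD by auto
    have Np: "N p \<inter> commuting s = {}" using N_p_elt[OF assms(1)] by (simp add: d)
    have vy: "v \<otimes> y \<otimes> v \<in> commuting t" using commuting_closed[of t v y] st v y by simp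
    then have "p \<otimes> (v \<otimes> y \<otimes> v) \<otimes> inv p \<in> commuting s" using commuting_conj'[of p s t] st by simp
    then have "v \<otimes> y \<otimes> v \<notin> N (inv p)" using N_inv[of p "v \<otimes> y \<otimes> v"] st Np commutingD[OF vy] by auto
    then have "y \<in> N (v \<otimes> inv p) \<longleftrightarrow> y \<in> N v" using N_mult[of v "inv p" y] v y st by simp
    moreover have "x \<in> N (p \<otimes> (v \<otimes> inv p)) \<longleftrightarrow> y \<in> N (v \<otimes> inv p)"
      using N_mult[of p "v \<otimes> inv p" x] st v xT Np x by (auto simp: y_def)
    ultimately have "x \<in> N r \<longleftrightarrow> y = v" using v y st by (auto simp: r_def m_assoc)
    also have "\<dots> \<longleftrightarrow> x = r"
    proof
      assume "y = v" then show "x = r" using st xT by (auto simp: r_def y_def m_assoc)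
    next
      assume "x = r" then show "y = v" using st v by (auto simp: r_def y_def m_assoc)
    qed
    finally show ?thesis .
  qed
  then show ?thesis using rs r_elt_eq[OF assms] by (auto simp: canonical_def r_def d)
qed

text \<open>Since \<open>u \<otimes> v \<otimes> g = u \<otimes> g \<otimes> s\<close>, its length
  is at most \<open>len g\<close>, which is less than \<open>len (v \<otimes> g)\<close>.\<close>

lemma descent_persists:
  assumes "g \<in> carrier G" "s \<in> S" "v \<in> S" "v \<otimes> g = g \<otimes> s" "v \<notin> N g" "u \<in> S" "u \<in> N g"
  shows "u \<in> N (v \<otimes> g)"
proof -
  note c = assms(1-3,6)
  have tg: "len (v \<otimes> g) = Suc (len g)" using len_simple_up[of v g] c assms(5) by blast
  have "len (u \<otimes> (v \<otimes> g)) = len (u \<otimes> g \<otimes> s)" unfolding assms(4) using c by (simp add: m_assoc)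
  also have "\<dots> \<le> len (u \<otimes> g) + len s" using len_mult_le[of "u \<otimes> g" s] c by simp
  also have "\<dots> = len g" using len_simple_down[of u g] c assms(7) by simp
  finally show ?thesis using len_simple_iff[of u "v \<otimes> g"] tg c by simp
qed

text \<open>The longest element of the dihedral group is \<open>t \<otimes> nu t u\<close>.
  Splitting it off \<open>t \<otimes> g\<close> therefore amounts to splitting \<open>nu t u\<close>
  off \<open>g\<close>, with lengths adding up.\<close>

lemma elementary_step:
  assumes "g \<in> carrier G" "s \<in> S" "t \<in> S" "t \<otimes> g = g \<otimes> s" "t \<notin> N g" "u \<in> S" "u \<in> N g"
  defines "h \<equiv> inv (nu t u) \<otimes> g" and "t' \<equiv> if odd (ord (t \<otimes> u)) then u else t"
  shows "u \<noteq> t" "ord (t \<otimes> u) > 0" "len h + (ord (t \<otimes> u) - 1) = len g"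
    "t' \<otimes> h = h \<otimes> s" "t' \<notin> N h"
proof -
  note c = assms(1-3,6)
  show ut: "u \<noteq> t" using assms(5,7) by auto
  have tg: "len (t \<otimes> g) = Suc (len g)" using len_simple_up[of t g] c assms(5) by blast
  then have tN: "t \<in> N (t \<otimes> g)" using N_simple_mult[of t g t] c assms(5) by simp
  have "u \<in> N (t \<otimes> g)" by (rule descent_persists[OF assms(1-7)])
  note dd = dihedral_descent[OF _ c(3,4) tN this]
  show m: "ord (t \<otimes> u) > 0" using dd(1) c by simp
  then obtain k where k: "ord (t \<otimes> u) = Suc k" by (cases "ord (t \<otimes> u)") auto
  have "inv (val (alt t u (Suc k))) \<otimes> (t \<otimes> g) = h"
    unfolding h_def using c by (simp add: nu_def k inv_mult_group m_assoc)
  then show "len h + (ord (t \<otimes> u) - 1) = len g" using dd(2) k tg c by simp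
  have h: "h \<in> carrier G" "nu t u \<otimes> h = g" unfolding h_def using c by auto
  have t': "t' \<in> S" "t \<otimes> nu t u = nu t u \<otimes> t'" using c nu_conj[of t u] m unfolding t'_def by auto
  have conj: "inv (nu t u) \<otimes> t \<otimes> nu t u = t'" using conj_intertwine(1)[OF _ _ _ t'(2)] t'(1) c by simp
  have "t' \<otimes> h = inv (nu t u) \<otimes> (t \<otimes> g)" unfolding conj[symmetric] h_def using c by (simp add: m_assoc)
  also have "\<dots> = h \<otimes> s" unfolding assms(4) h_def using c by (simp add: m_assoc)
  finally show "t' \<otimes> h = h \<otimes> s" .
  show "t' \<notin> N h"
    using N_mult[of "nu t u" h t] nu_not_inversion[of t u] assms(5) c h(1) unfolding h(2) conj by simp
qed

definition R_set :: "'a \<Rightarrow> 'a set" where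
  "R_set s = {r_elt G \<gamma> u | \<gamma> u. odd_path \<gamma> \<and> hd \<gamma> = s \<and> evenly_joined G S (last \<gamma>) u}"

lemma R_set_canonical: "R_set s \<subseteq> canonical (commuting s)"
  unfolding R_set_def using r_elt_canonical by blast

lemma canonical_carrier: "canonical (commuting s) \<subseteq> carrier G"
  using commutingD unfolding canonical_def by auto

text \<open>
  Elementary moves along odd labels extend the path, those along even labels contribute a factor
  \<open>r_elt\<close>.
\<close>

lemma path_decomposition:
  assumes "g \<in> carrier G" "s \<in> S" "t \<in> S" "t \<otimes> g = g \<otimes> s" "t \<notin> N g"
  shows "\<exists>\<gamma> x. odd_path \<gamma> \<and> hd \<gamma> = s \<and> last \<gamma> = t \<and> x \<in> generate G (R_set s) \<and> inv g = x \<otimes> p_elt G \<gamma>"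
  using assms
proof (induction "len g" arbitrary: g t rule: less_induct)
  case less
  have Rc: "R_set s \<subseteq> carrier G" using R_set_canonical canonical_carrier by blast
  show ?case
  proof (cases "g = \<one>")
    case True
    then have "s = t" using less.prems(2-4) by simp
    then show ?thesis using True less.prems(2)
      by (intro exI[of _ "[s]"] exI[of _ \<one>]) (simp add: odd_path_single generate.one)
  next
    case False
    obtain u where u: "u \<in> S" "u \<in> N g" using descent_exists[OF less.prems(1) False] .
    note es = elementary_step[OF less.prems u]
    define h where "h = inv (nu t u) \<otimes> g"
    define t' where "t' = (if odd (ord (t \<otimes> u)) then u else t)"
    have h: "h \<in> carrier G" "t' \<in> S" "t' \<otimes> h = h \<otimes> s" "t' \<notin> N h"
      using es(4,5) u less.prems(1,3) unfolding h_def t'_def by auto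
    have "ord (t \<otimes> u) \<noteq> 1" using ord_ne_1[of t u] es(1) u less.prems(3) by auto
    then have "len h < len g" using es(2,3) by (simp add: h_def)
    then obtain \<gamma> x where \<gamma>: "odd_path \<gamma>" "hd \<gamma> = s" "last \<gamma> = t'" and x: "x \<in> generate G (R_set s)" "inv h = x \<otimes> p_elt G \<gamma>"
      using less.hyps[OF _ h(1) less.prems(2) h(2-4)] by blast
    have xc: "x \<in> carrier G" using x generate_in_carrier Rc by blast
    \<comment> \<open>The moves strip factors off the left of \<open>g\<close>, that is, at the end
      \<open>t\<close> of the path. A path that starts at \<open>s\<close> therefore spells the
      inverse of \<open>g\<close>.\<close>
    have "inv g = inv h \<otimes> inv (nu t u)" using u less.prems(1,3) by (simp add: h_def inv_mult_group m_assoc)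
    then have g: "inv g = x \<otimes> p_elt G \<gamma> \<otimes> inv (nu t u)" using x by simp
    show ?thesis
    proof (cases "odd (ord (t \<otimes> u))")
      case True
      then have j: "oddly_joined G S (last \<gamma>) t" "t' = u" "\<gamma> \<noteq> []"
        using es(1,2) u less.prems(2,3) \<gamma> ord_swap[of t u] by (auto simp: t'_def oddly_joined_def edge_path_def)
      have "p_elt G (\<gamma> @ [t]) = p_elt G \<gamma> \<otimes> inv (nu t u)"
        using p_elt_snoc[OF \<gamma>(1) j(1)] nu_inv_odd[of t u] True u less.prems(3) \<gamma> j by simp
      then have "inv g = x \<otimes> p_elt G (\<gamma> @ [t])" using g xc \<gamma> u less.prems(3) by (simp add: m_assoc)
      then show ?thesis using x \<gamma> j odd_path_snoc[of \<gamma> t] by (intro exI[of _ "\<gamma> @ [t]"] exI[of _ x]) auto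
    next
      case False
      then have j: "evenly_joined G S (last \<gamma>) u" "t' = t"
        using es(1,2) u less.prems(2,3) \<gamma> by (auto simp: t'_def evenly_joined_def)
      have nuT: "nu t u \<in> T" using nu_even_T[of t u] False es(1,2) u less.prems(3) by auto
      \<comment> \<open>For an even label \<open>nu t u\<close> is an involution, so it can be moved
        to the left of \<open>p_elt\<close> as a conjugate.\<close>
      have "inv g = x \<otimes> r_elt G \<gamma> u \<otimes> p_elt G \<gamma>"
        using g r_elt_eq[OF \<gamma>(1) j(1)] \<gamma> j xc nuT by (simp add: m_assoc)
      moreover have "r_elt G \<gamma> u \<in> R_set s" using \<gamma> j by (auto simp: R_set_def)
      ultimately show ?thesis using x \<gamma> j by (intro exI[of _ \<gamma>] exI[of _ "x \<otimes> r_elt G \<gamma> u"]) (auto intro: generate.intros)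
    qed
  qed
qed

subsection \<open>The centralizer of a simple reflection\<close>

lemma commuting_sub: "commuting s \<subseteq> T" "commuting s \<subseteq> carrier G"
  using commutingD by auto

lemma commuting_subsystem:
  "s \<in> S \<Longrightarrow> reflection_system (G\<lparr>carrier := generate G (commuting s)\<rparr>)
     (canonical (commuting s)) (commuting s) (\<lambda>g. N g \<inter> commuting s)"
  by (rule subsystem[OF commuting_sub(1)]) (rule commuting_closed, simp)

lemma generate_commuting_one:
  assumes "s \<in> S" "g \<in> generate G (commuting s)" "N g \<inter> commuting s = {}"
  shows "g = \<one>"
proof -
  interpret Sub: reflection_system "G\<lparr>carrier := generate G (commuting s)\<rparr>"
    "canonical (commuting s)" "commuting s" "\<lambda>g. N g \<inter> commuting s"
    using commuting_subsystem assms(1) .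
  show ?thesis using Sub.N_empty[of g] assms by simp
qed

lemma generate_commuting_commutes:
  assumes "s \<in> S" "g \<in> generate G (commuting s)"
  shows "s \<otimes> g = g \<otimes> s"
  using assms(2)
proof (induction rule: generate.induct)
  case (incl h)
  then show ?case using commutingD by metis
next
  case (inv h)
  then show ?case using commutingD T_inv by metis
next
  case (eng h1 h2)
  then have "h1 \<in> carrier G" "h2 \<in> carrier G" "s \<in> carrier G"
    using generate_in_carrier[OF commuting_sub(2)] assms by auto
  note c = this
  have "s \<otimes> (h1 \<otimes> h2) = s \<otimes> h1 \<otimes> h2" using c by (simp add: m_assoc)
  also have "\<dots> = h1 \<otimes> (s \<otimes> h2)" unfolding eng.IH(1) using c by (simp add: m_assoc)
  also have "\<dots> = h1 \<otimes> h2 \<otimes> s" unfolding eng.IH(2) using c by (simp add: m_assoc)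
  finally show ?case .
qed (use assms(1) in simp)

definition odd_loops :: "'a \<Rightarrow> 'a list set" where
  "odd_loops s = edge_loops S (oddly_joined G S) s"

lemma odd_loopsD: "\<gamma> \<in> odd_loops s \<Longrightarrow> odd_path \<gamma> \<and> hd \<gamma> = s \<and> last \<gamma> = s"
  by (simp add: odd_loops_def edge_loops_def)

lemma centralizer_decomposition:
  assumes "s \<in> S" "g \<in> carrier G" "s \<otimes> g = g \<otimes> s" "s \<notin> N g"
  shows "\<exists>\<gamma>\<in>odd_loops s. \<exists>x\<in>generate G (R_set s). g = x \<otimes> p_elt G \<gamma>"
proof -
  note g = assms(2) S_T[OF assms(1)] S_T[OF assms(1)] assms(3)
  have "s \<otimes> inv g = inv g \<otimes> s" by (rule conj_intertwine(3)[OF g])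
  moreover have "s \<notin> N (inv g)" using N_inv_intertwine(1)[OF g] assms(4) by simp
  ultimately obtain \<gamma> x where "odd_path \<gamma>" "hd \<gamma> = s" "last \<gamma> = s" "x \<in> generate G (R_set s)"
    "inv (inv g) = x \<otimes> p_elt G \<gamma>"
    using path_decomposition[of "inv g" s s] assms(1,2) by blast
  then show ?thesis using assms(2) unfolding odd_loops_def edge_loops_def by auto
qed

lemma R_set_generate_sub:
  "generate G (R_set s) \<subseteq> generate G (commuting s)"
  using R_set_canonical by (intro mono_generate) (auto simp: canonical_def)

lemma N_mult_commuting:
  assumes "s \<in> S" "g \<in> carrier G" "h \<in> carrier G" "s \<otimes> g = g \<otimes> s" "N h \<inter> commuting s = {}"
  shows "N (g \<otimes> h) \<inter> commuting s = N g \<inter> commuting s"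
proof -
  have "x \<in> N (g \<otimes> h) \<longleftrightarrow> x \<in> N g" if x: "x \<in> commuting s" for x
  proof -
    have "inv g \<otimes> x \<otimes> g \<in> commuting s" using commuting_conj[OF assms(2) _ _ assms(4) x] assms(1) by simp
    then have "inv g \<otimes> x \<otimes> g \<notin> N h" using assms(5) by blast
    then show ?thesis using N_mult[OF assms(2,3), of x] commutingD[OF x] by simp
  qed
  then show ?thesis by blast
qed

text \<open>In the decomposition \<open>r = x \<otimes> p_elt G \<gamma>\<close>, the last factor
  equals \<open>inv x \<otimes> r\<close> and so lies in the group generated by
  \<open>commuting s\<close>. It has no inversions there, hence it is trivial.\<close>

lemma commuting_generated_by_R:
  assumes s: "s \<in> S" and r: "r \<in> commuting s"
  shows "r \<in> generate G (R_set s)"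
proof -
  have rT: "r \<in> T" and rs: "s \<otimes> r = r \<otimes> s" using commutingD[OF r] by auto
  obtain \<gamma> x where \<gamma>: "\<gamma> \<in> odd_loops s" and x: "x \<in> generate G (R_set s)" and e: "r = x \<otimes> p_elt G \<gamma>"
    using centralizer_decomposition[OF s _ rs simple_not_inversion_of_commuting[OF s r]] T_closed[OF rT] by blast
  have xW: "x \<in> generate G (commuting s)" using x R_set_generate_sub by blast
  then have xc: "x \<in> carrier G" by (rule generate_in_carrier[OF commuting_sub(2)])
  have \<gamma>': "odd_path \<gamma>" "hd \<gamma> = s" using odd_loopsD[OF \<gamma>] by auto
  have "p_elt G \<gamma> = inv x \<otimes> r" using e xc \<gamma>' by simp
  moreover have "inv x \<otimes> r \<in> generate G (commuting s)"
    using generate_m_inv_closed[OF commuting_sub(2) xW] r by (intro generate.eng) (auto intro: generate.incl)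
  ultimately have "p_elt G \<gamma> = \<one>" using generate_commuting_one[OF s, of "p_elt G \<gamma>"] N_p_elt[OF \<gamma>'(1)] \<gamma>' by simp
  then show ?thesis using e x xc by simp
qed

text \<open>A canonical generator is a word in \<open>R_set s\<close>, all of whose letters are
  canonical generators. By \<open>simple_val_in\<close> in the subsystem it is one of these
  letters.\<close>

lemma canonical_commuting:
  assumes s: "s \<in> S"
  shows "canonical (commuting s) = R_set s"
proof (intro equalityI R_set_canonical subsetI)
  fix r assume r: "r \<in> canonical (commuting s)"
  have Rc: "R_set s \<subseteq> carrier G" using R_set_canonical canonical_carrier by blast
  have RT: "inv x = x" if "x \<in> R_set s" for x
  proof (rule T_inv)
    have "x \<in> commuting s" using that R_set_canonical[of s] unfolding canonical_def by blast
    then show "x \<in> T" using commutingD by blast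
  qed
  have "r \<in> commuting s" using r by (simp add: canonical_def)
  then have "r \<in> generate G (R_set s)" by (rule commuting_generated_by_R[OF s])
  then obtain ws where ws: "set ws \<subseteq> R_set s" "val ws = r"
    using generate_words[OF Rc RT] by blast
  interpret Sub: reflection_system "G\<lparr>carrier := generate G (commuting s)\<rparr>"
    "canonical (commuting s)" "commuting s" "\<lambda>g. N g \<inter> commuting s"
    by (rule commuting_subsystem[OF s])
  have "Sub.val ws = r" unfolding ws(2)[symmetric] Sub.val_def val_def by simp
  moreover have "set ws \<subseteq> canonical (commuting s)" using ws(1) R_set_canonical by (rule order_trans)
  ultimately show "r \<in> R_set s" using Sub.simple_val_in[of ws] r ws(1) by (metis subsetD)
qed

theorem coxeter_system_commuting:
  assumes s: "s \<in> S"
  shows "coxeter_system (G\<lparr>carrier := generate G (commuting s)\<rparr>) (R_set s)"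
proof -
  interpret Sub: reflection_system "G\<lparr>carrier := generate G (commuting s)\<rparr>"
    "canonical (commuting s)" "commuting s" "\<lambda>g. N g \<inter> commuting s"
    using commuting_subsystem s .
  show ?thesis using Sub.coxeter_system unfolding canonical_commuting[OF s] .
qed

definition Gamma :: "'a \<Rightarrow> 'a set" where
  "Gamma s = {g \<in> carrier G. s \<otimes> g = g \<otimes> s \<and> s \<notin> N g \<and> N g \<inter> commuting s = {}}"

lemma Gamma_eq_loops:
  assumes s: "s \<in> S"
  shows "Gamma s = p_elt G ` odd_loops s"
proof
  show "p_elt G ` odd_loops s \<subseteq> Gamma s"
  proof
    fix g assume "g \<in> p_elt G ` odd_loops s"
    then obtain \<gamma> where \<gamma>: "odd_path \<gamma>" "hd \<gamma> = s" "last \<gamma> = s" "g = p_elt G \<gamma>" using odd_loopsD by blast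
    then show "g \<in> Gamma s" using p_elt_conj[OF \<gamma>(1)] N_p_elt[OF \<gamma>(1)] by (simp add: Gamma_def)
  qed
  show "Gamma s \<subseteq> p_elt G ` odd_loops s"
  proof
    fix g assume g: "g \<in> Gamma s"
    then obtain \<gamma> x where \<gamma>: "\<gamma> \<in> odd_loops s" and x: "x \<in> generate G (R_set s)" and e: "g = x \<otimes> p_elt G \<gamma>"
      using centralizer_decomposition[OF s, of g] unfolding Gamma_def by blast
    have xW: "x \<in> generate G (commuting s)" using x R_set_generate_sub by blast
    then have xc: "x \<in> carrier G" by (rule generate_in_carrier[OF commuting_sub(2)])
    have \<gamma>': "odd_path \<gamma>" "hd \<gamma> = s" using odd_loopsD[OF \<gamma>] by auto
    \<comment> \<open>The path contributes no inversion commuting with \<open>s\<close>. Since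
      \<open>g\<close> has none either, neither does \<open>x\<close>, which makes \<open>x\<close>
      trivial.\<close>
    have "N (x \<otimes> p_elt G \<gamma>) \<inter> commuting s = N x \<inter> commuting s"
      using N_mult_commuting[OF s xc p_elt_closed[OF \<gamma>'(1)] generate_commuting_commutes[OF s xW]]
        N_p_elt[OF \<gamma>'(1)] \<gamma>' by simp
    then have "x = \<one>" using generate_commuting_one[OF s xW] g e by (simp add: Gamma_def)
    then show "g \<in> p_elt G ` odd_loops s" using e \<gamma> \<gamma>' by simp
  qed
qed

subsection \<open>Injectivity on the fundamental group\<close>

text \<open>
  If no label is \<open>2\<close>, the words \<open>abcabc\<dots>\<close> admit no braid move, so they are reduced; in particular
  \<open>a\<close>, \<open>b\<close>, \<open>c\<close> generate an infinite group.
\<close>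

lemma cyc_descents:
  assumes "{a, b, c} \<subseteq> S" "distinct [a, b, c]" "\<And>x y. x \<in> {a, b, c} \<Longrightarrow> y \<in> {a, b, c} \<Longrightarrow> ord (x \<otimes> y) \<noteq> 2"
  shows "len (val (cyc a b c n)) = n \<and> b \<notin> N (val (cyc a b c n)) \<and> c \<notin> N (val (cyc a b c n))"
  using assms
proof (induction n arbitrary: a b c rule: less_induct)
  case (less n)
  have S: "a \<in> S" "b \<in> S" "c \<in> S" and ne: "a \<noteq> b" "b \<noteq> c" "a \<noteq> c" using less.prems by auto
  have o2: "ord (a \<otimes> b) \<noteq> 2" "ord (a \<otimes> c) \<noteq> 2" using less.prems(3) by auto
  have cl: "val (cyc x y z k) \<in> carrier G" if "x \<in> S" "y \<in> S" "z \<in> S" for x y z k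
    using set_cyc[of x y z k] that by (intro val_closed words_closed) auto
  show ?case
  proof (cases n)
    case 0
    then show ?thesis by simp
  next
    case (Suc n')
    define h where "h = val (cyc b c a n')"
    define g where "g = val (cyc a b c n)"
    have g: "g = a \<otimes> h" "h \<in> carrier G" "g \<in> carrier G" using cl S by (auto simp: g_def h_def Suc)
    have perm: "{b, c, a} = {a, b, c}" "{c, a, b} = {a, b, c}" by auto
    have IH: "len h = n'" "c \<notin> N h" "a \<notin> N h"
      using less.IH[of n' b c a, unfolded perm, OF _ less.prems(1) _ less.prems(3)] ne Suc unfolding h_def by simp_all
    have lg: "len g = n" "a \<in> N g"
      using len_simple_up[OF S(1) g(2)] N_simple_mult[of a h a] IH g S Suc by auto
    have hg: "a \<otimes> g = h" using g S by simp
    \<comment> \<open>If \<open>b\<close> were a descent besides \<open>a\<close>, then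
      \<open>b\<close> would be a descent of \<open>h\<close> and \<open>a\<close> one of
      \<open>b \<otimes> h\<close>. But \<open>b \<otimes> h\<close> is the word cabcab..., which by
      induction does not have the descent \<open>a\<close>.\<close>
    have "b \<notin> N g"
    proof
      assume b: "b \<in> N g"
      note d = dihedral_descents[OF g(3) S(1,2) ne(1) lg(2) b, unfolded hg]
      show False
      proof (cases n')
        case 0
        then show ?thesis using d(1) by (simp add: h_def)
      next
        case (Suc n'')
        then have "b \<otimes> h = val (cyc c a b n'')" using cl[of c a b n''] S by (simp add: h_def)
        then show ?thesis
          using d(2)[OF o2(1)] less.IH[of n'' c a b, unfolded perm, OF _ less.prems(1) _ less.prems(3)] ne Suc \<open>n = Suc n'\<close> by simp
      qed
    qed
    moreover have "c \<notin> N g"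
      using dihedral_descents(1)[OF g(3) S(1,3) ne(3) lg(2)] IH(2) unfolding hg by blast
    ultimately show ?thesis using lg g_def by simp
  qed
qed

text \<open>Otherwise the words \<open>cyc a b c n\<close> are reduced for every \<open>n\<close>,
  and the one of length \<open>Suc (len y)\<close> would be a prefix of \<open>y\<close>.\<close>

lemma three_descents:
  assumes "{a, b, c} \<subseteq> S" "distinct [a, b, c]" "y \<in> carrier G" "{a, b, c} \<subseteq> N y"
  shows "\<exists>x\<in>{a, b, c}. \<exists>z\<in>{a, b, c}. ord (x \<otimes> z) = 2"
proof (rule ccontr)
  assume "\<not> ?thesis"
  then have "len (val (cyc a b c (Suc (len y)))) = Suc (len y)"
    using cyc_descents[OF assms(1,2)] by blast
  then have "len (inv (val (cyc a b c (Suc (len y)))) \<otimes> y) + length (cyc a b c (Suc (len y))) = len y"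
    using assms set_cyc[of a b c "Suc (len y)"]
    by (intro descents_reduced_prefix) (auto simp del: cyc.simps)
  then show False by simp
qed

lemma ord_2_commute:
  assumes "x \<in> T" "z \<in> T" "ord (x \<otimes> z) = 2"
  shows "x \<otimes> z = z \<otimes> x"
proof -
  have "(x \<otimes> z) [^] (2::nat) = \<one>" using assms pow_ord_eq_1[of "x \<otimes> z"] by simp
  then have "(x \<otimes> z) \<otimes> (x \<otimes> z) = \<one>" using assms(1,2) by (simp add: numeral_2_eq_2)
  then have "inv (x \<otimes> z) = x \<otimes> z" using assms(1,2) by (intro inv_equality) auto
  then show ?thesis using assms(1,2) by (simp add: inv_mult_group)
qed

text \<open>
  Two such neighbours would be descents of \<open>v g\<close> together with \<open>v\<close>, so they commute with each other
  by \<open>three_descents\<close>; conjugating \<open>x\<close> by the odd edge from \<open>v\<close> to \<open>t\<close> then gives an inversion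
  of \<open>g\<close> commuting with \<open>v\<close>.
\<close>

lemma odd_descent_unique:
  assumes "g \<in> carrier G" "s \<in> S" "v \<in> S" "v \<otimes> g = g \<otimes> s" "v \<notin> N g" "N g \<inter> commuting v = {}"
    "oddly_joined G S v t" "oddly_joined G S v x" "t \<in> N g" "x \<in> N g"
  shows "t = x"
proof (rule ccontr)
  assume tx: "t \<noteq> x"
  have t: "t \<in> S" "v \<noteq> t" "odd (ord (v \<otimes> t))" and x: "x \<in> S" "v \<noteq> x" "odd (ord (v \<otimes> x))"
    using oddly_joinedD[OF assms(7)] oddly_joinedD[OF assms(8)] by auto
  note c = assms(1-3)
  define y where "y = v \<otimes> g"
  have y: "y \<in> carrier G" using c by (simp add: y_def)
  have vy: "v \<in> N y" using N_simple_mult[of v g v] c assms(5) by (simp add: y_def)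
  have Ny: "{v, t, x} \<subseteq> N y"
    using descent_persists[OF assms(1-5) t(1) assms(9)] descent_persists[OF assms(1-5) x(1) assms(10)] vy
    by (simp add: y_def)
  obtain a b where ab: "a \<in> {v, t, x}" "b \<in> {v, t, x}" "ord (a \<otimes> b) = 2"
    using three_descents[of v t x y] c t x tx y Ny by auto
  \<comment> \<open>The labels at \<open>v\<close> are odd and a repeated letter gives order 1, so
    \<open>t\<close> and \<open>x\<close> are the only candidates.\<close>
  have "ord (t \<otimes> x) = 2"
  proof -
    have "ord (q \<otimes> q) \<noteq> 2" if "q \<in> S" for q using that by simp
    moreover have "ord (v \<otimes> t) \<noteq> 2" "ord (v \<otimes> x) \<noteq> 2" using t(3) x(3) by auto
    moreover have "ord (t \<otimes> v) = ord (v \<otimes> t)" "ord (x \<otimes> v) = ord (v \<otimes> x)" "ord (x \<otimes> t) = ord (t \<otimes> x)"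
      using ord_swap c t(1) x(1) by simp_all
    ultimately show ?thesis using ab c(3) t(1) x(1) by auto
  qed
  then have "t \<otimes> x = x \<otimes> t" using ord_2_commute[of t x] t x by simp
  then have xc: "x \<in> commuting t" using x t tx by (simp add: commuting_def)
  define m where "m = ord (v \<otimes> t)"
  define n where "n = nu v t"
  have m0: "m > 0" using odd_pos t by (simp add: m_def)
  have n: "n \<in> carrier G" "v \<otimes> n = n \<otimes> t" "len n = m - 1" "N n \<inter> commuting v = {}"
    using nu_conj[OF c(3) t(1)] N_nu(2)[OF c(3) t(1)] N_nu_commuting[OF c(3) t(1,2)] m0 t c
    by (auto simp: n_def m_def)
  define \<beta> where "\<beta> = n \<otimes> x \<otimes> inv n"
  have \<beta>: "\<beta> \<in> commuting v" unfolding \<beta>_def using commuting_conj'[OF n(1) _ _ n(2) xc] c t by simp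
  have \<beta>T: "\<beta> \<in> T" "\<beta> \<noteq> v" "v \<otimes> \<beta> \<otimes> v = \<beta>"
  proof -
    show 1: "\<beta> \<in> T" "\<beta> \<noteq> v" using commutingD[OF \<beta>] by auto
    have "v \<otimes> \<beta> \<otimes> v = v \<otimes> (v \<otimes> \<beta>)" using commutingD[OF \<beta>] 1 c by (simp add: m_assoc)
    then show "v \<otimes> \<beta> \<otimes> v = \<beta>" using 1 c by simp
  qed
  have \<beta>n: "\<beta> \<notin> N n" using \<beta> n(4) by blast
  have conj: "inv n \<otimes> \<beta> \<otimes> n = x" unfolding \<beta>_def using n x by (simp add: m_assoc)
  \<comment> \<open>\<open>w\<close> spells \<open>n \<otimes> x\<close> with letters that are
    descents of \<open>y\<close>. It is reduced, since \<open>x\<close> would otherwise be an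
    inversion of \<open>inv n\<close>, and so \<open>\<beta>\<close> one of \<open>n\<close>. Thus
    it is a prefix of \<open>y\<close>, and \<open>y\<close> inherits its inversion
    \<open>\<beta>\<close>.\<close>
  define w where "w = alt t v (m - 1) @ [x]"
  have wS: "set w \<subseteq> {v, t, x}" using set_alt[of t v "m - 1"] by (auto simp: w_def)
  have wv: "val w = n \<otimes> x" using t x c by (simp add: w_def n_def nu_def m_def val_append)
  have "x \<notin> N (inv n)" using N_inv[of n x] n x \<beta>n by (simp add: \<beta>_def)
  then have "len (x \<otimes> inv n) = m" using len_simple_up[of x "inv n"] len_inv[of n] n x m0 by simp
  moreover have "inv (n \<otimes> x) = x \<otimes> inv n" using n x by (simp add: inv_mult_group)
  ultimately have lw: "len (val w) = length w" using len_inv[of "n \<otimes> x"] n x m0 wv by (simp add: w_def)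
  have "\<beta> \<in> N (val w)" unfolding wv using N_mult[of n x \<beta>] n x \<beta>T \<beta>n conj N_simple[of x] by simp
  moreover have "len (inv (val w) \<otimes> y) + length w = len y"
    using wS Ny c t x lw y by (intro descents_reduced_prefix) auto
  moreover have "val w \<in> carrier G" "val w \<otimes> (inv (val w) \<otimes> y) = y" using wv n x y by auto
  ultimately have "\<beta> \<in> N y" using N_mono_reduced[of "val w" "inv (val w) \<otimes> y" \<beta>] lw y by simp
  then have "\<beta> \<in> N g" using N_simple_mult[of v g \<beta>] \<beta>T c by (simp add: y_def)
  then show False using assms(6) \<beta> by blast
qed

lemma odd_join_swap: "oddly_joined G S t u \<Longrightarrow> oddly_joined G S u t"
  using ord_swap[of t u] by (auto simp: oddly_joined_def)

text \<open>For a path ending in \<open>r, t, u\<close>, the inverse is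
  \<open>nu u t \<otimes> g\<close>, where \<open>g\<close> belongs to the path up to
  \<open>t\<close>. The descent \<open>t\<close> of \<open>nu u t\<close> can only be lost if
  \<open>t \<otimes> u \<otimes> t\<close> is an inversion of \<open>g\<close>. Then
  \<open>t\<close> and \<open>u\<close> would both be descents of \<open>t \<otimes> g\<close>,
  making \<open>u\<close> a descent of \<open>g\<close>. By induction \<open>r\<close> is one too,
  so \<open>u = r\<close> by \<open>odd_descent_unique\<close>, a backtracking.\<close>

lemma p_elt_last_descent:
  assumes "odd_path (\<gamma> @ [t, u])" "backtrack_free (\<gamma> @ [t, u])"
  shows "t \<in> N (inv (p_elt G (\<gamma> @ [t, u])))"
    and "\<And>x. oddly_joined G S u x \<Longrightarrow> x \<in> N (inv (p_elt G (\<gamma> @ [t, u]))) \<Longrightarrow> x = t"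
proof -
  have inv_facts: "last \<delta> \<otimes> inv (p_elt G \<delta>) = inv (p_elt G \<delta>) \<otimes> hd \<delta> \<and> last \<delta> \<notin> N (inv (p_elt G \<delta>))
      \<and> N (inv (p_elt G \<delta>)) \<inter> commuting (last \<delta>) = {}" if d: "odd_path \<delta>" for \<delta>
  proof -
    define p a b where "p = p_elt G \<delta>" "a = hd \<delta>" "b = last \<delta>"
    have S: "p \<in> carrier G" "a \<in> S" "b \<in> S" "a \<otimes> p = p \<otimes> b" "a \<notin> N p" "N p \<inter> commuting a = {}"
      using odd_path_ends[OF d] p_elt_conj[OF d] N_p_elt[OF d] d unfolding p_a_b_def by auto
    note g = S(1) S_T[OF S(2)] S_T[OF S(3)] S(4)
    show ?thesis
      using conj_intertwine(3)[OF g] N_inv_intertwine[OF g] S(5,6) unfolding p_a_b_def by blast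
  qed
  have unique: "x = y" if d: "odd_path \<delta>" and "oddly_joined G S (last \<delta>) x" "oddly_joined G S (last \<delta>) y"
      "x \<in> N (inv (p_elt G \<delta>))" "y \<in> N (inv (p_elt G \<delta>))" for \<delta> x y
    using odd_descent_unique[of "inv (p_elt G \<delta>)" "hd \<delta>" "last \<delta>" x y] inv_facts[OF d] that odd_path_ends[OF d] by simp
  show main: "t \<in> N (inv (p_elt G (\<gamma> @ [t, u])))"
    using assms
  proof (induction \<gamma> arbitrary: t u rule: rev_induct)
    case Nil
    then have tu: "t \<in> S" "u \<in> S" "t \<noteq> u" "odd (ord (t \<otimes> u))" and j: "odd_path [t, u]"
      by (auto simp: odd_path_Cons dest: oddly_joinedD)
    have "ord (u \<otimes> t) - 1 > 0" using tu ord_ne_1[of t u] ord_swap[of t u] odd_pos[OF tu(4)] by simp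
    then have "t \<in> N (nu u t)" using N_nu(1)[OF tu(2,1)] tu ord_swap[of t u] by (force intro!: image_eqI[where x = 0])
    moreover have "inv (p_elt G [t, u]) = nu u t" using p_elt_Cons[OF j] nu_inv_odd[of t u] tu by simp
    ultimately show ?case by simp
  next
    case (snoc r \<gamma>)
    have eq: "(\<gamma> @ [r]) @ [t, u] = (\<gamma> @ [r, t]) @ [u]" by simp
    have op: "odd_path (\<gamma> @ [r, t])" "oddly_joined G S t u"
      using snoc.prems(1) odd_path_snoc[of "\<gamma> @ [r, t]" u] unfolding eq by auto
    have rt: "oddly_joined G S r t"
      using op(1) odd_path_snoc[of "\<gamma> @ [r]" t] by simp
    have bf: "backtrack_free (\<gamma> @ [r, t])" "r \<noteq> u"
      using snoc.prems(2) backtrack_free_appendD[of "\<gamma> @ [r, t]" "[u]"] backtrack_free_snocD[of \<gamma> r t u] by auto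
    define g where "g = inv (p_elt G (\<gamma> @ [r, t]))"
    have r: "r \<in> N g" using snoc.IH[OF op(1) bf(1)] by (simp add: g_def)
    have gc: "g \<in> carrier G" using op by (simp add: g_def)
    have tu: "t \<in> S" "u \<in> S" "t \<noteq> u" "odd (ord (t \<otimes> u))" using oddly_joinedD[OF op(2)] by auto
    have tN: "t \<notin> N g" using inv_facts[OF op(1)] by (simp add: g_def)
    have uN: "u \<notin> N g"
    proof
      assume "u \<in> N g"
      then have "u = r" using unique[OF op(1), of u r] op(2) odd_join_swap[OF rt] r by (simp add: g_def)
      then show False using bf by simp
    qed
    have inv_eq: "inv (p_elt G ((\<gamma> @ [r]) @ [t, u])) = nu u t \<otimes> g"
      using p_elt_snoc[OF op(1), of u] op tu nu_inv_odd[of t u] unfolding eq by (simp add: inv_mult_group g_def)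
    define n where "n = nu u t"
    define m where "m = ord (u \<otimes> t)"
    have m: "odd m" "m > 0" "m \<noteq> 1" using tu ord_ne_1[of t u] ord_swap[of t u] odd_pos[OF tu(4)] by (auto simp: m_def)
    have n: "n \<in> carrier G" "t \<in> N n" "n = (t \<otimes> u) [^] (m div 2)"
    proof -
      have "0 < m - 1" using m by simp
      then show "t \<in> N n" using N_nu(1)[OF tu(2,1)] tu by (force simp: m_def n_def intro!: image_eqI[where x = 0])
      show "n = (t \<otimes> u) [^] (m div 2)" using nu_odd[OF tu(2,1)] m by (simp add: m_def n_def)
      show "n \<in> carrier G" using tu by (simp add: n_def)
    qed
    \<comment> \<open>\<open>n\<close> is the power of \<open>t \<otimes> u\<close> with exponent
      \<open>m div 2\<close>, where \<open>m\<close> is the odd order, so its square is the inverse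
      of \<open>t \<otimes> u\<close>.\<close>
    have nn: "n \<otimes> n = u \<otimes> t"
    proof -
      have "n \<otimes> n \<otimes> (t \<otimes> u) = (t \<otimes> u) [^] (m div 2 + m div 2 + 1)"
        using tu(1,2) nat_pow_mult[of "t \<otimes> u" "m div 2" "m div 2"] by (simp add: n(3))
      also have "m div 2 + m div 2 + 1 = m" using m(1) by presburger
      finally have "n \<otimes> n \<otimes> (t \<otimes> u) = \<one>" using ord_swap[of t u] tu(1,2) by (simp add: m_def)
      then have "n \<otimes> n = inv (t \<otimes> u)" using n(1) tu(1,2) by (metis inv_equality inv_inv inv_closed m_closed S_T T_closed)
      then show ?thesis using tu(1,2) by (simp add: inv_mult_group)
    qed
    have ut: "u \<otimes> n = n \<otimes> t" using nu_conj[OF tu(2,1)] m by (simp add: n_def m_def)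
    \<comment> \<open>As \<open>n \<otimes> t = u \<otimes> n\<close>, this conjugate of
      \<open>t\<close> is the conjugate of \<open>u\<close> by the square of
      \<open>n\<close>.\<close>
    have conj: "inv n \<otimes> t \<otimes> n = t \<otimes> u \<otimes> t"
    proof -
      have "inv n \<otimes> t \<otimes> n = inv (n \<otimes> n) \<otimes> (n \<otimes> t) \<otimes> n" using n(1) tu(1,2) by (simp add: inv_mult_group m_assoc)
      also have "\<dots> = inv (n \<otimes> n) \<otimes> u \<otimes> (n \<otimes> n)" unfolding ut[symmetric] using n(1) tu(1,2) by (simp add: m_assoc)
      also have "\<dots> = t \<otimes> u \<otimes> t" unfolding nn using tu(1,2) by (simp add: inv_mult_group m_assoc)
      finally show ?thesis .
    qed
    have "t \<otimes> u \<otimes> t \<notin> N g"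
    proof
      assume a: "t \<otimes> u \<otimes> t \<in> N g"
      then have uN': "u \<in> N (t \<otimes> g)" using N_simple_mult[of t g u] tu gc by simp
      have "t \<in> N (t \<otimes> g)" using N_simple_mult[of t g t] tu(1) gc tN by simp
      from dihedral_descents(1)[OF _ tu(1-3) this uN'] have "u \<in> N g" using tu(1) gc by simp
      then show False using uN by blast
    qed
    then show ?case unfolding inv_eq n_def[symmetric] using N_mult[of n g t] n(1,2) gc tu(1) conj by simp
  qed
  fix x assume "oddly_joined G S u x" "x \<in> N (inv (p_elt G (\<gamma> @ [t, u])))"
  moreover have "oddly_joined G S u t"
    using assms(1) odd_path_snoc[of "\<gamma> @ [t]" u] odd_join_swap by simp
  ultimately show "x = t" using unique[OF assms(1), of x t] main by simp
qed

lemma backtrack_free_unique: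
  assumes "odd_path \<gamma>" "odd_path \<delta>" "backtrack_free \<gamma>" "backtrack_free \<delta>"
    "hd \<gamma> = hd \<delta>" "last \<gamma> = last \<delta>" "p_elt G \<gamma> = p_elt G \<delta>"
  shows "\<gamma> = \<delta>"
  using assms
proof (induction \<gamma> arbitrary: \<delta> rule: rev_induct)
  case (snoc t \<gamma>)
  \<comment> \<open>A path with an edge has a nontrivial value, because its inverse has a descent.
    So a one-vertex path can only be matched with a one-vertex path.\<close>
  have two: "p_elt G \<epsilon> \<noteq> \<one>" if "odd_path \<epsilon>" "backtrack_free \<epsilon>" "\<epsilon> = \<epsilon>' @ [a, b]" for \<epsilon> \<epsilon>' a b
    using p_elt_last_descent(1)[of \<epsilon>' a b] that by auto
  have shape: "(\<exists>a. \<epsilon> = [a]) \<or> (\<exists>\<epsilon>' a b. \<epsilon> = \<epsilon>' @ [a, b])" if "odd_path \<epsilon>" for \<epsilon>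
  proof -
    have "\<epsilon> \<noteq> []" using that by (simp add: edge_path_def)
    then show ?thesis by (metis append.assoc append_Cons append_Nil rev_exhaust)
  qed
  consider a where "\<gamma> @ [t] = [a]" | \<gamma>' r where "\<gamma> = \<gamma>' @ [r]" by (metis append_Nil rev_exhaust)
  then show ?case
  proof cases
    case 1
    then have "p_elt G \<delta> = \<one>" using snoc.prems(7) by simp
    then obtain b where "\<delta> = [b]" using shape[OF snoc.prems(2)] two[OF snoc.prems(2,4)] by blast
    then show ?thesis using 1 snoc.prems(5) by simp
  next
    case 2
    have e1: "\<gamma> @ [t] = \<gamma>' @ [r, t]" using 2 by simp
    have "p_elt G \<delta> \<noteq> \<one>" using two[OF snoc.prems(1,3) e1] snoc.prems(7) by simp
    then obtain \<delta>' q b where e2': "\<delta> = \<delta>' @ [q, b]" using shape[OF snoc.prems(2)] by auto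
    have "b = t" using snoc.prems(6) e2' by simp
    then have e2: "\<delta> = \<delta>' @ [q, t]" using e2' by simp
    have o1: "odd_path \<gamma>" "oddly_joined G S r t"
      using snoc.prems(1) odd_path_snoc[of \<gamma> t] 2 by auto
    have o2: "odd_path (\<delta>' @ [q])" "oddly_joined G S q t"
      using snoc.prems(2) odd_path_snoc[of "\<delta>' @ [q]" t] e2 by auto
    have "q \<in> N (inv (p_elt G (\<gamma> @ [t])))"
      using p_elt_last_descent(1)[of \<delta>' q t] snoc.prems(2,4,7) e2 by simp
    then have qr: "q = r"
      using p_elt_last_descent(2)[of \<gamma>' r t q] odd_join_swap[OF o2(2)] snoc.prems(1,3) e1 by simp
    have S: "r \<in> S" "t \<in> S" using oddly_joinedD[OF o1(2)] by auto
    have "p_elt G \<gamma> \<otimes> nu r t = p_elt G (\<delta>' @ [q]) \<otimes> nu r t"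
      using p_elt_snoc[OF o1(1), of t] p_elt_snoc[OF o2(1), of t] o1 o2 2 e2 qr snoc.prems(7) by simp
    then have "p_elt G \<gamma> = p_elt G (\<delta>' @ [q])" using S o1(1) o2(1) by simp
    moreover have "hd \<gamma> = hd (\<delta>' @ [q])"
      using snoc.prems(5) 2 e2 by (cases \<gamma>'; cases \<delta>') auto
    moreover have "backtrack_free \<gamma>" "backtrack_free (\<delta>' @ [q])"
      using snoc.prems(3,4) backtrack_free_appendD[of \<gamma> "[t]"] backtrack_free_appendD[of "\<delta>' @ [q]" "[t]"] e2 by auto
    ultimately have "\<gamma> = \<delta>' @ [q]" using snoc.IH[of "\<delta>' @ [q]"] o1 o2 2 qr by simp
    then show ?thesis using e2 by simp
  qed
qed (simp add: edge_path_def)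

lemma p_elt_backtrack:
  assumes "backtrack S (oddly_joined G S) x y"
  shows "p_elt G x = p_elt G y"
  using assms
proof cases
  case (1 p a b q)
  have op: "odd_path (p @ a # b # a # q)" using 1 by simp
  have o: "odd_path (p @ [a])" "odd_path (a # b # a # q)" "odd_path (b # a # q)" "odd_path (a # q)" "oddly_joined G S a b"
    using op by (auto simp: edge_path_def successively_append_iff successively_Cons)
  have S: "a \<in> S" "b \<in> S" "odd (ord (a \<otimes> b))" using oddly_joinedD[OF o(5)] by auto
  have "p_elt G (a # b # a # q) = nu a b \<otimes> (nu b a \<otimes> p_elt G (a # q))"
    unfolding p_elt_Cons[OF o(2)] p_elt_Cons[OF o(3)] ..
  also have "\<dots> = p_elt G (a # q)"
    unfolding nu_inv_odd[OF S, symmetric] using S o(4) by simp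
  finally show ?thesis using p_elt_append[OF o(1,2)] p_elt_append[OF o(1,4)] 1 by simp
qed

lemma p_elt_equiv:
  assumes "equivclp (backtrack S (oddly_joined G S)) x y"
  shows "p_elt G x = p_elt G y"
  using assms
proof (induction rule: equivclp_induct)
  case (step y z)
  then show ?case using p_elt_backtrack[of y z] p_elt_backtrack[of z y] by auto
qed simp

theorem pi1_iso:
  assumes s: "s \<in> S"
  shows "\<exists>\<phi> \<in> iso (graph_pi1 S (oddly_joined G S) s) (G\<lparr>carrier := Gamma s\<rparr>).
      \<forall>\<gamma> \<in> edge_loops S (oddly_joined G S) s. \<phi> (path_class S (oddly_joined G S) \<gamma>) = p_elt G \<gamma>"
proof -
  define E where "E = oddly_joined G S"
  let ?P = "graph_pi1 S E s" and ?H = "G\<lparr>carrier := Gamma s\<rparr>" and ?c = "path_class S E"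
  define \<phi> where "\<phi> = (\<lambda>A. p_elt G (SOME p. p \<in> A))"
  have \<phi>: "\<phi> (?c \<gamma>) = p_elt G \<gamma>" for \<gamma>
  proof -
    have "\<gamma> \<in> ?c \<gamma>" by (simp add: path_class_def)
    then have "(SOME p. p \<in> ?c \<gamma>) \<in> ?c \<gamma>" by (rule someI)
    then show ?thesis using p_elt_equiv unfolding \<phi>_def path_class_def E_def by (metis mem_Collect_eq)
  qed
  \<comment> \<open>The product in \<open>graph_pi1\<close> is a union over all representatives.
    Concatenation respects homotopy, so all the classes in this union coincide.\<close>
  have join: "?c \<gamma> \<otimes>\<^bsub>?P\<^esub> ?c \<delta> = ?c (\<gamma> @ tl \<delta>)"
    and join_p: "p_elt G (\<gamma> @ tl \<delta>) = p_elt G \<gamma> \<otimes> p_elt G \<delta>"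
    if "\<gamma> \<in> odd_loops s" "\<delta> \<in> odd_loops s" for \<gamma> \<delta>
  proof -
    note l = odd_loopsD[OF that(1)] odd_loopsD[OF that(2)]
    have *: "?c (p @ tl q) = ?c (\<gamma> @ tl \<delta>)"
      if "p \<in> ?c \<gamma>" "q \<in> ?c \<delta>" for p q
    proof -
      have "equivclp (backtrack S E) \<gamma> p" "equivclp (backtrack S E) \<delta> q" using that by (simp_all add: path_class_def)
      from equiv_join[OF this] have "equivclp (backtrack S E) (\<gamma> @ tl \<delta>) (p @ tl q)" using l unfolding E_def by simp
      then show ?thesis unfolding path_class_eq by (rule equivclp_sym)
    qed
    have mem: "\<gamma> \<in> ?c \<gamma>" "\<delta> \<in> ?c \<delta>" by (simp_all add: path_class_def)
    have "(\<Union>p\<in>?c \<gamma>. \<Union>q\<in>?c \<delta>. ?c (p @ tl q)) = ?c (\<gamma> @ tl \<delta>)"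
    proof (intro equalityI UN_least)
      fix p q assume "p \<in> ?c \<gamma>" "q \<in> ?c \<delta>"
      then show "?c (p @ tl q) \<subseteq> ?c (\<gamma> @ tl \<delta>)" using * by blast
    qed (use mem in blast)
    then show "?c \<gamma> \<otimes>\<^bsub>?P\<^esub> ?c \<delta> = ?c (\<gamma> @ tl \<delta>)"
      unfolding graph_pi1_def by simp
    have ne: "\<gamma> \<noteq> []" "\<delta> \<noteq> []" using l by (auto simp: edge_path_def)
    have \<gamma>: "butlast \<gamma> @ [s] = \<gamma>" using ne l append_butlast_last_id by metis
    have \<delta>: "s # tl \<delta> = \<delta>" using ne l list.collapse by metis
    have "\<gamma> @ tl \<delta> = butlast \<gamma> @ s # tl \<delta>" using \<gamma> by (metis append.assoc append_Cons append_Nil)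
    then show "p_elt G (\<gamma> @ tl \<delta>) = p_elt G \<gamma> \<otimes> p_elt G \<delta>"
      using p_elt_append[of "butlast \<gamma>" s "tl \<delta>"] l unfolding \<gamma> \<delta> by simp
  qed
  have car: "carrier (?P) = ?c ` odd_loops s"
    by (simp add: graph_pi1_def odd_loops_def E_def)
  have inj: "?c \<gamma> = ?c \<delta>"
    if "\<gamma> \<in> odd_loops s" "\<delta> \<in> odd_loops s" and eq: "p_elt G \<gamma> = p_elt G \<delta>" for \<gamma> \<delta>
  proof -
    note l = odd_loopsD[OF that(1)] odd_loopsD[OF that(2)]
    obtain \<gamma>' where \<gamma>': "backtrack_free \<gamma>'" "equivclp (backtrack S E) \<gamma> \<gamma>'"
      using backtrack_free_equiv[of S E \<gamma>] l by (auto simp: E_def)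
    obtain \<delta>' where \<delta>': "backtrack_free \<delta>'" "equivclp (backtrack S E) \<delta> \<delta>'"
      using backtrack_free_equiv[of S E \<delta>] l by (auto simp: E_def)
    have "edge_path S E \<gamma>' \<and> hd \<gamma> = hd \<gamma>' \<and> last \<gamma> = last \<gamma>'" "edge_path S E \<delta>' \<and> hd \<delta> = hd \<delta>' \<and> last \<delta> = last \<delta>'"
      using l unfolding E_def
      by (intro backtrack_equiv_edge_path[OF \<gamma>'(2)[unfolded E_def]]
          backtrack_equiv_edge_path[OF \<delta>'(2)[unfolded E_def]]; simp)+
    moreover have "p_elt G \<gamma>' = p_elt G \<delta>'"
      using p_elt_equiv[of \<gamma> \<gamma>'] p_elt_equiv[of \<delta> \<delta>'] \<gamma>' \<delta>' eq by (simp add: E_def)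
    ultimately have "\<gamma>' = \<delta>'" using backtrack_free_unique[of \<gamma>' \<delta>'] l \<gamma>'(1) \<delta>'(1) unfolding E_def by metis
    then show ?thesis using \<gamma>'(2) \<delta>'(2) unfolding path_class_eq by (metis equivclp_sym equivclp_trans)
  qed
  have "\<phi> \<in> iso (?P) ?H"
  proof (rule isoI)
    show "\<phi> \<in> hom (?P) ?H"
    proof (rule homI)
      fix A assume "A \<in> carrier (?P)"
      then obtain \<gamma> where "A = ?c \<gamma>" "\<gamma> \<in> odd_loops s" unfolding car by blast
      then show "\<phi> A \<in> carrier ?H" using \<phi>[of \<gamma>] Gamma_eq_loops[OF s] by simp
    next
      fix A B assume "A \<in> carrier (?P)" "B \<in> carrier (?P)"
      then obtain \<gamma> \<delta> where AB: "A = ?c \<gamma>" "\<gamma> \<in> odd_loops s" "B = ?c \<delta>" "\<delta> \<in> odd_loops s"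
        unfolding car by blast
      have "\<phi> (A \<otimes>\<^bsub>?P\<^esub> B) = p_elt G \<gamma> \<otimes> p_elt G \<delta>"
        unfolding AB(1,3) join[OF AB(2,4)] \<phi> by (rule join_p[OF AB(2,4)])
      then show "\<phi> (A \<otimes>\<^bsub>?P\<^esub> B) = \<phi> A \<otimes>\<^bsub>?H\<^esub> \<phi> B"
        unfolding AB(1,3) \<phi> by simp
    qed
    show "bij_betw \<phi> (carrier (?P)) (carrier ?H)"
      unfolding bij_betw_def
    proof
      show "inj_on \<phi> (carrier (?P))"
      proof (rule inj_onI)
        fix A B assume "A \<in> carrier (?P)" "B \<in> carrier (?P)" and e: "\<phi> A = \<phi> B"
        then obtain \<gamma> \<delta> where AB: "A = ?c \<gamma>" "\<gamma> \<in> odd_loops s" "B = ?c \<delta>" "\<delta> \<in> odd_loops s"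
          unfolding car by blast
        show "A = B" unfolding AB(1,3) by (rule inj[OF AB(2,4)]) (use e in \<open>simp add: AB(1,3) \<phi>\<close>)
      qed
      show "\<phi> ` carrier (?P) = carrier ?H"
        unfolding car Gamma_eq_loops[OF s] by (simp add: image_image \<phi>)
    qed
  qed
  then show ?thesis using \<phi> unfolding E_def by blast
qed

end

section \<open>Vinberg chambers\<close>

lemma reflection_on_formula:
  fixes r :: "'v::euclidean_space \<Rightarrow> 'v"
  assumes "reflection_on UNIV r"
  shows "\<exists>a w. a \<bullet> w = 2 \<and> r = (\<lambda>x. x - (a \<bullet> x) *\<^sub>R w)"
proof -
  obtain H v where H: "linear r" "subspace H" "dim H + 1 = dim (UNIV :: 'v set)" "\<forall>x\<in>H. r x = x" "v \<notin> H" "r v = - v"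
    using assms unfolding reflection_on_def by blast
  have "dim H < DIM('v)" using H(3) by simp
  then obtain a where a: "a \<noteq> 0" "span H \<subseteq> {x. a \<bullet> x = 0}" using lowdim_subset_hyperplane by blast
  have "H = {x. a \<bullet> x = 0}"
  proof (rule subspace_dim_equal)
    show "H \<subseteq> {x. a \<bullet> x = 0}" using a(2) span_superset by blast
    show "dim H \<ge> dim {x. a \<bullet> x = 0}" using dim_hyperplane[OF a(1)] H(3) by simp
  qed (rule H(2), rule subspace_hyperplane)
  then have av: "a \<bullet> v \<noteq> 0" and Hr: "\<And>x. a \<bullet> x = 0 \<Longrightarrow> r x = x" using H(4,5) by auto
  \<comment> \<open>The factor makes the functional take the value 2 at \<open>v\<close>, so that
    \<open>v\<close> is sent to its negative.\<close>
  define b where "b = (2 / (a \<bullet> v)) *\<^sub>R a"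
  have "r x = x - (b \<bullet> x) *\<^sub>R v" for x
  proof -
    define c where "c = (a \<bullet> x) / (a \<bullet> v)"
    have "r (x - c *\<^sub>R v) = x - c *\<^sub>R v" using av by (intro Hr) (simp add: c_def inner_diff_right)
    moreover have "r (x - c *\<^sub>R v) = r x + c *\<^sub>R v" using H(1,6) by (simp add: linear_diff linear_scale)
    ultimately have "r x + c *\<^sub>R v = x - c *\<^sub>R v" by simp
    then have "r x = x - c *\<^sub>R v - c *\<^sub>R v" by (metis add_diff_cancel_right')
    also have "\<dots> = x - (2 * c) *\<^sub>R v" by (simp only: mult_2 scaleR_add_left diff_diff_eq)
    finally have "r x = x - (2 * c) *\<^sub>R v" .
    then show ?thesis by (simp add: b_def c_def)
  qed
  moreover have "b \<bullet> v = 2" using av by (simp add: b_def)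
  ultimately show ?thesis by blast
qed

lemma formula_reflection_on:
  fixes a w :: "'v::euclidean_space"
  assumes "a \<bullet> w = 2"
  shows "reflection_on UNIV (\<lambda>x. x - (a \<bullet> x) *\<^sub>R w)"
proof -
  have a: "a \<noteq> 0" using assms by auto
  have "linear (\<lambda>x. x - (a \<bullet> x) *\<^sub>R w)"
    by (rule linearI) (simp_all add: inner_add_right algebra_simps)
  moreover have "dim {x. a \<bullet> x = 0} + 1 = dim (UNIV :: 'v set)" using dim_hyperplane[OF a] by simp
  moreover have "subspace {x. a \<bullet> x = 0}" by (rule subspace_hyperplane)
  moreover have "w - (a \<bullet> w) *\<^sub>R w = - w" using assms by (simp add: scaleR_2)
  ultimately show ?thesis using assms unfolding reflection_on_def
    by (intro conjI exI[of _ "{x. a \<bullet> x = 0}"] exI[of _ w]) auto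
qed

lemma mirror_on_formula:
  assumes "a \<bullet> w = 2"
  shows "mirror_on UNIV (\<lambda>x. x - (a \<bullet> x) *\<^sub>R w) = {x. a \<bullet> x = 0}"
  using assms by (auto simp: mirror_on_def)

lemma segment_meets_hyperplane:
  fixes a :: "'v::euclidean_space"
  assumes "a \<bullet> p \<noteq> 0" "a \<bullet> q \<noteq> 0"
  shows "closed_segment p q \<inter> {x. a \<bullet> x = 0} \<noteq> {} \<longleftrightarrow> (a \<bullet> p < 0) \<noteq> (a \<bullet> q < 0)"
proof
  assume "closed_segment p q \<inter> {x. a \<bullet> x = 0} \<noteq> {}"
  then obtain x where x: "x \<in> closed_segment p q" "a \<bullet> x = 0" by blast
  have lt: "closed_segment p q \<subseteq> {x. a \<bullet> x < 0}" if "a \<bullet> p < 0" "a \<bullet> q < 0"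
    using that by (intro closed_segment_subset convex_halfspace_lt) auto
  have gt: "closed_segment p q \<subseteq> {x. a \<bullet> x > 0}" if "a \<bullet> p > 0" "a \<bullet> q > 0"
    using that by (intro closed_segment_subset convex_halfspace_gt) auto
  have "\<not> (a \<bullet> p < 0 \<and> a \<bullet> q < 0)" "\<not> (a \<bullet> p > 0 \<and> a \<bullet> q > 0)"
    using lt gt x by force+
  then show "(a \<bullet> p < 0) \<noteq> (a \<bullet> q < 0)" using assms by linarith
next
  assume d: "(a \<bullet> p < 0) \<noteq> (a \<bullet> q < 0)"
  have c: "connected (closed_segment p q)" by (simp add: connected_segment)
  have "\<exists>z\<in>closed_segment p q. a \<bullet> z = 0"
  proof (cases "a \<bullet> p < 0")
    case True
    then show ?thesis using connected_ivt_hyperplane[OF c, of p q a 0] d by simp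
  next
    case False
    then show ?thesis using connected_ivt_hyperplane[OF c, of q p a 0] d by simp
  qed
  then show "closed_segment p q \<inter> {x. a \<bullet> x = 0} \<noteq> {}" by blast
qed

section \<open>Reflections acting on an open convex set, and their inversion sets\<close>

locale vinberg_chamber = group W for W (structure) +
  fixes S :: "'a set" and \<rho> :: "'a \<Rightarrow> 'v::euclidean_space \<Rightarrow> 'v" and U K C :: "'v set"
  assumes rep: "vinberg_rep W \<rho> U"
    and comp: "C \<in> components (U - \<Union>{mirror_on UNIV r | r. r \<in> \<rho> ` carrier W \<and> reflection_on UNIV r})"
    and K_eq: "K = U \<inter> closure C"
    and S_eq: "S = {g \<in> carrier W. reflection_on UNIV (\<rho> g) \<and> (\<exists>F. F facet_of K \<and> F \<subseteq> mirror_on UNIV (\<rho> g))}"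
    and gen: "generate W S = carrier W"
begin

definition refl :: "'a set" where
  "refl = {g \<in> carrier W. reflection_on UNIV (\<rho> g)}"

definition mir :: "'a \<Rightarrow> 'v set" where
  "mir r = mirror_on UNIV (\<rho> r)"

text \<open>Separation by a mirror without choosing a functional that defines it. This reading is
  valid for end points off the mirror; an end point on it makes the condition true.\<close>

definition meets :: "'a \<Rightarrow> 'v \<Rightarrow> 'v \<Rightarrow> bool" where
  "meets r p q \<longleftrightarrow> closed_segment p q \<inter> mir r \<noteq> {}"

definition base :: 'v where
  "base = (SOME x. x \<in> C)"

definition inversions :: "'a \<Rightarrow> 'a set" where
  "inversions g = {r \<in> refl. meets r base (\<rho> g base)}"

lemma open_U: "open U" and convex_U: "convex U"
  and U_inv: "g \<in> carrier W \<Longrightarrow> \<rho> g ` U = U"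
  and proper: "compact D \<Longrightarrow> D \<subseteq> U \<Longrightarrow> finite {g \<in> carrier W. \<rho> g ` D \<inter> D \<noteq> {}}"
  using rep unfolding vinberg_rep_def by auto

lemma refl_closed: "r \<in> refl \<Longrightarrow> r \<in> carrier W" by (simp add: refl_def)

lemma act_linear: "g \<in> carrier W \<Longrightarrow> linear (\<rho> g)"
  and act_bij: "g \<in> carrier W \<Longrightarrow> bij (\<rho> g)"
  and act_mult: "g \<in> carrier W \<Longrightarrow> h \<in> carrier W \<Longrightarrow> \<rho> (g \<otimes> h) x = \<rho> g (\<rho> h x)"
  and act_inj: "g \<in> carrier W \<Longrightarrow> h \<in> carrier W \<Longrightarrow> \<rho> g = \<rho> h \<Longrightarrow> g = h"
proof -
  have m: "\<rho> \<in> hom W GL" "inj_on \<rho> (carrier W)" using rep unfolding vinberg_rep_def mon_def by auto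
  show "g \<in> carrier W \<Longrightarrow> linear (\<rho> g)" "g \<in> carrier W \<Longrightarrow> bij (\<rho> g)"
    using hom_in_carrier[OF m(1)] by (auto simp: GL_def)
  show "g \<in> carrier W \<Longrightarrow> h \<in> carrier W \<Longrightarrow> \<rho> (g \<otimes> h) x = \<rho> g (\<rho> h x)"
    using hom_mult[OF m(1), of g h] by (simp add: GL_def)
  show "g \<in> carrier W \<Longrightarrow> h \<in> carrier W \<Longrightarrow> \<rho> g = \<rho> h \<Longrightarrow> g = h"
    using m(2) by (simp add: inj_on_def)
qed

lemma act_one [simp]: "\<rho> \<one> x = x"
proof -
  have "\<rho> \<one> (\<rho> \<one> x) = \<rho> \<one> x" using act_mult[of \<one> \<one> x] by simp
  then show ?thesis using bij_is_inj[OF act_bij[OF one_closed]] by (simp add: inj_eq)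
qed

lemma act_inv [simp]:
  assumes "g \<in> carrier W"
  shows "\<rho> (inv g) (\<rho> g x) = x" "\<rho> g (\<rho> (inv g) x) = x"
  using act_mult[of "inv g" g x] act_mult[of g "inv g" x] assms by simp_all

lemma act_U: "g \<in> carrier W \<Longrightarrow> x \<in> U \<Longrightarrow> \<rho> g x \<in> U"
  using U_inv by blast

lemma refl_formula:
  assumes "r \<in> refl"
  obtains a w where "a \<bullet> w = 2" "\<rho> r = (\<lambda>x. x - (a \<bullet> x) *\<^sub>R w)" "mir r = {x. a \<bullet> x = 0}"
proof -
  have "reflection_on UNIV (\<rho> r)" using assms by (simp add: refl_def)
  from reflection_on_formula[OF this] obtain a w where aw: "a \<bullet> w = 2" "\<rho> r = (\<lambda>x. x - (a \<bullet> x) *\<^sub>R w)" by blast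
  then show thesis using that mirror_on_formula[OF aw(1)] by (simp add: mir_def)
qed

lemma mem_mir: "x \<in> mir r \<longleftrightarrow> \<rho> r x = x"
  by (simp add: mir_def mirror_on_def)

lemma refl_conj:
  assumes "g \<in> carrier W" "r \<in> refl"
  shows "g \<otimes> r \<otimes> inv g \<in> refl"
proof -
  have r: "r \<in> carrier W" using assms refl_closed by simp
  obtain a w where aw: "a \<bullet> w = 2" "\<rho> r = (\<lambda>x. x - (a \<bullet> x) *\<^sub>R w)" using refl_formula[OF assms(2)] by blast
  \<comment> \<open>The vector representing the functional that first applies \<open>inv g\<close>
    and then pairs with \<open>a\<close>; its kernel is the image of the mirror under
    \<open>g\<close>.\<close>
  define b where "b = adjoint (\<rho> (inv g)) a"
  have li: "linear (\<rho> (inv g))" "linear (\<rho> g)" using act_linear assms by simp_all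
  have b: "b \<bullet> x = a \<bullet> \<rho> (inv g) x" for x
    using adjoint_works[OF li(1), of x a] by (simp add: b_def inner_commute)
  have "\<rho> (g \<otimes> r \<otimes> inv g) = (\<lambda>x. x - (b \<bullet> x) *\<^sub>R \<rho> g w)"
    using assms r li by (simp add: fun_eq_iff act_mult b aw(2) linear_diff linear_scale)
  moreover have "b \<bullet> \<rho> g w = 2" using b aw assms by simp
  ultimately show ?thesis using formula_reflection_on[of b "\<rho> g w"] assms r by (simp add: refl_def)
qed

lemma mir_conj:
  assumes "g \<in> carrier W" "r \<in> carrier W"
  shows "x \<in> mir (inv g \<otimes> r \<otimes> g) \<longleftrightarrow> \<rho> g x \<in> mir r"
proof -
  have "\<rho> (inv g \<otimes> r \<otimes> g) x = \<rho> (inv g) (\<rho> r (\<rho> g x))" using assms by (simp add: act_mult)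
  then show ?thesis unfolding mem_mir using assms by (metis act_inv)
qed

lemma refl_conj': "g \<in> carrier W \<Longrightarrow> r \<in> refl \<Longrightarrow> inv g \<otimes> r \<otimes> g \<in> refl"
  using refl_conj[of "inv g" r] by simp

lemma refl_sq: "r \<in> refl \<Longrightarrow> r \<otimes> r = \<one>"
proof -
  assume r: "r \<in> refl"
  then obtain a w where aw: "a \<bullet> w = 2" "\<rho> r = (\<lambda>x. x - (a \<bullet> x) *\<^sub>R w)" using refl_formula by blast
  have "\<rho> (r \<otimes> r) x = \<rho> \<one> x" for x
    using refl_closed[OF r] by (simp add: act_mult) (simp add: aw inner_diff_right algebra_simps)
  then have "\<rho> (r \<otimes> r) = \<rho> \<one>" by (rule ext)
  then show ?thesis using act_inj[of "r \<otimes> r" \<one>] refl_closed[OF r] by simp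
qed

lemma meets_conj:
  assumes "g \<in> carrier W" "r \<in> carrier W"
  shows "meets r (\<rho> g p) (\<rho> g q) \<longleftrightarrow> meets (inv g \<otimes> r \<otimes> g) p q"
  unfolding meets_def closed_segment_linear_image[OF act_linear[OF assms(1)]]
  using mir_conj[OF assms] by blast

lemma meets_iff_signs:
  assumes "mir r = {x. a \<bullet> x = 0}" "p \<notin> mir r" "q \<notin> mir r"
  shows "meets r p q \<longleftrightarrow> (a \<bullet> p < 0) \<noteq> (a \<bullet> q < 0)"
  using segment_meets_hyperplane[of a p q] assms by (simp add: meets_def)

text \<open>Three points have only two possible signs. This parity rule is the origin of
  \<open>N_mult\<close> for the inversion sets.\<close>

lemma meets_trans:
  assumes "r \<in> refl" "p \<notin> mir r" "q \<notin> mir r" "x \<notin> mir r"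
  shows "meets r p x \<longleftrightarrow> (meets r p q \<noteq> meets r q x)"
proof -
  obtain a w where "mir r = {x. a \<bullet> x = 0}" using refl_formula[OF assms(1)] by blast
  then show ?thesis using meets_iff_signs[of r a] assms by auto
qed

lemma meets_commute: "meets r p q \<longleftrightarrow> meets r q p"
  by (simp add: meets_def closed_segment_commute)

lemma base_C: "base \<in> C"
  using in_components_nonempty[OF comp] by (simp add: base_def some_in_eq)

lemma C_sub: "C \<subseteq> U" "r \<in> refl \<Longrightarrow> C \<inter> mir r = {}"
  using in_components_subset[OF comp] by (auto simp: refl_def mir_def)

lemma base_U: "base \<in> U" using base_C C_sub by blast

lemma base_orbit:
  assumes "g \<in> carrier W" "r \<in> refl"
  shows "\<rho> g base \<notin> mir r"
  using mir_conj[of g r base] refl_conj'[OF assms] refl_closed assms base_C C_sub(2) by blast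

lemma fixes_point_in:
  assumes "r \<in> refl" "x \<in> mir r" "x \<in> D"
  shows "r \<in> {g \<in> carrier W. \<rho> g ` D \<inter> D \<noteq> {}}"
proof -
  have "\<rho> r x = x" using assms(2) by (simp add: mem_mir)
  then have "x \<in> \<rho> r ` D" using assms(3) by (metis imageI)
  then show ?thesis using assms(3) refl_closed[OF assms(1)] by blast
qed

text \<open>A reflection whose mirror meets the segment fixes a point of it, and a segment in
  \<open>U\<close> is compact, so proper discontinuity applies.\<close>

lemma segment_refls_finite:
  assumes "p \<in> U" "q \<in> U"
  shows "finite {r \<in> refl. meets r p q}"
proof -
  have "closed_segment p q \<subseteq> U" using closed_segment_subset[OF assms convex_U] .
  from proper[OF compact_segment this] have f: "finite {g \<in> carrier W. \<rho> g ` closed_segment p q \<inter> closed_segment p q \<noteq> {}}" .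
  have "r \<in> {g \<in> carrier W. \<rho> g ` closed_segment p q \<inter> closed_segment p q \<noteq> {}}"
    if r: "r \<in> refl" "meets r p q" for r
  proof -
    obtain x where "x \<in> closed_segment p q" "x \<in> mir r" using r(2) unfolding meets_def by blast
    then show ?thesis using fixes_point_in[OF r(1)] by blast
  qed
  then have "{r \<in> refl. meets r p q} \<subseteq> {g \<in> carrier W. \<rho> g ` closed_segment p q \<inter> closed_segment p q \<noteq> {}}"
    by blast
  then show ?thesis using f by (rule finite_subset)
qed

lemma refl_segment_meets:
  assumes "r \<in> refl" "p \<notin> mir r"
  shows "meets r p (\<rho> r p)"
proof -
  obtain a w where aw: "a \<bullet> w = 2" "\<rho> r = (\<lambda>x. x - (a \<bullet> x) *\<^sub>R w)" "mir r = {x. a \<bullet> x = 0}"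
    using refl_formula[OF assms(1)] by blast
  have e: "a \<bullet> \<rho> r p = - (a \<bullet> p)" unfolding aw(2) using aw(1) by (simp add: inner_diff_right)
  have p: "a \<bullet> p \<noteq> 0" using assms(2) unfolding aw(3) by simp
  then have "\<rho> r p \<notin> mir r" unfolding aw(3) using e by simp
  from meets_iff_signs[OF aw(3) assms(2) this] show ?thesis unfolding e using p by (cases "a \<bullet> p < 0") auto
qed

lemma mir_meets_U:
  assumes "r \<in> refl"
  shows "\<exists>y\<in>U. y \<in> mir r"
proof -
  have "base \<notin> mir r" using base_orbit[OF one_closed assms] by simp
  then have "meets r base (\<rho> r base)" by (rule refl_segment_meets[OF assms])
  moreover have "closed_segment base (\<rho> r base) \<subseteq> U"
    using base_U act_U refl_closed assms by (intro closed_segment_subset convex_U) auto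
  ultimately show ?thesis unfolding meets_def by blast
qed

text \<open>The product of two reflections with the same mirror is a transvection, of infinite order unless trivial, that fixes a point of \<open>U\<close>.\<close>

lemma mir_inj:
  assumes "r \<in> refl" "q \<in> refl" "mir r = mir q"
  shows "r = q"
proof -
  have c: "r \<in> carrier W" "q \<in> carrier W" using assms refl_closed by auto
  obtain a w where aw: "a \<bullet> w = 2" "\<rho> r = (\<lambda>x. x - (a \<bullet> x) *\<^sub>R w)" "mir r = {x. a \<bullet> x = 0}"
    using refl_formula[OF assms(1)] by blast
  obtain b v where bv: "b \<bullet> v = 2" "\<rho> q = (\<lambda>x. x - (b \<bullet> x) *\<^sub>R v)" "mir q = {x. b \<bullet> x = 0}"
    using refl_formula[OF assms(2)] by blast
  have ab: "a \<bullet> x = 0 \<longleftrightarrow> b \<bullet> x = 0" for x using assms(3) aw(3) bv(3) by auto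
  \<comment> \<open>Both reflections negate a line. \<open>d\<close> is the difference of spanning
    vectors of the two lines, scaled to have value 2 under \<open>b\<close>; the transvection moves
    \<open>x\<close> by \<open>(b \<bullet> x) *\<^sub>R d\<close>.\<close>
  define d where "d = (2 / (b \<bullet> w)) *\<^sub>R w - v"
  have bw: "b \<bullet> w \<noteq> 0" using ab[of w] aw by auto
  have bx: "(b \<bullet> x) * (a \<bullet> w) = (a \<bullet> x) * (b \<bullet> w)" for x
  proof -
    have "a \<bullet> (x - ((a \<bullet> x) / 2) *\<^sub>R w) = 0" using aw by (simp add: inner_diff_right)
    then have "b \<bullet> (x - ((a \<bullet> x) / 2) *\<^sub>R w) = 0" using ab by blast
    then show ?thesis using aw by (simp add: inner_diff_right)
  qed
  have bd: "b \<bullet> d = 0" using bv bw by (simp add: d_def inner_diff_right)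
  have rq: "\<rho> (r \<otimes> q) x = x + (b \<bullet> x) *\<^sub>R d" for x
  proof -
    have ax: "a \<bullet> y = 2 * (b \<bullet> y) / (b \<bullet> w)" for y using bx[of y] aw bw by (simp add: field_simps)
    have "\<rho> (r \<otimes> q) x = x - (b \<bullet> x) *\<^sub>R v - (2 * (b \<bullet> (x - (b \<bullet> x) *\<^sub>R v)) / (b \<bullet> w)) *\<^sub>R w"
      using c by (simp add: act_mult aw(2) bv(2) ax)
    also have "b \<bullet> (x - (b \<bullet> x) *\<^sub>R v) = - (b \<bullet> x)" using bv by (simp add: inner_diff_right)
    finally show ?thesis by (simp add: d_def algebra_simps)
  qed
  have pow: "\<rho> ((r \<otimes> q) [^] n) x = x + (real n * (b \<bullet> x)) *\<^sub>R d" for n :: nat and x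
  proof (induction n arbitrary: x)
    case (Suc n)
    have "\<rho> ((r \<otimes> q) [^] Suc n) x = \<rho> ((r \<otimes> q) [^] n) (x + (b \<bullet> x) *\<^sub>R d)"
      using c rq by (simp add: act_mult)
    also have "\<dots> = x + (b \<bullet> x) *\<^sub>R d + (real n * (b \<bullet> x)) *\<^sub>R d" unfolding Suc using bd by (simp add: inner_add_right)
    finally show ?case by (simp add: algebra_simps)
  qed simp
  obtain y where y: "y \<in> U" "y \<in> mir r" using mir_meets_U assms by blast
  have by0: "b \<bullet> y = 0" using y ab aw(3) by auto
  have fin: "finite {g \<in> carrier W. \<rho> g ` {y} \<inter> {y} \<noteq> {}}" using y by (intro proper) auto
  have "range (\<lambda>n::nat. (r \<otimes> q) [^] n) \<subseteq> {g \<in> carrier W. \<rho> g ` {y} \<inter> {y} \<noteq> {}}"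
    using pow[of _ y] by0 c by auto
  then have "finite (range (\<lambda>n::nat. (r \<otimes> q) [^] n))" using fin finite_subset by blast
  then have "\<not> inj (\<lambda>n::nat. (r \<otimes> q) [^] n)" using finite_imageD by blast
  then obtain m n :: nat where mn: "m \<noteq> n" "(r \<otimes> q) [^] m = (r \<otimes> q) [^] n" by (auto simp: inj_def)
  then have "(real m * (b \<bullet> w)) *\<^sub>R d = (real n * (b \<bullet> w)) *\<^sub>R d" using pow[of m w] pow[of n w] by (simp only:) simp
  then have "d = 0" using mn bw by simp
  then have "\<rho> (r \<otimes> q) = \<rho> \<one>" using rq by (simp add: fun_eq_iff)
  then have "r \<otimes> q = \<one>" using act_inj c by simp
  then have "r = inv q" using c by (simp add: inv_equality)
  moreover have "inv q = q" using refl_sq[OF assms(2)] c by (intro inv_equality) auto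
  ultimately show ?thesis by simp
qed

section \<open>Signs, convexity and facets of the chamber\<close>

lemma wall_sign:
  assumes "r \<in> refl"
  shows "\<exists>a. mir r = {x. a \<bullet> x = 0} \<and> (\<forall>x\<in>C. a \<bullet> x > 0) \<and> (\<forall>x\<in>K. a \<bullet> x \<ge> 0)"
proof -
  obtain b v where bv: "b \<bullet> v = 2" "\<rho> r = (\<lambda>x. x - (b \<bullet> x) *\<^sub>R v)" "mir r = {x. b \<bullet> x = 0}"
    by (rule refl_formula[OF assms])
  define a where "a = (if b \<bullet> base > 0 then b else - b)"
  have a: "mir r = {x. a \<bullet> x = 0}" unfolding bv(3) a_def by simp
  have C0: "a \<bullet> x \<noteq> 0" if "x \<in> C" for x using that C_sub(2)[OF assms] unfolding a by blast
  have "a \<bullet> base > 0" using C0[OF base_C] unfolding a_def by (auto split: if_splits)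
  \<comment> \<open>\<open>C\<close> is connected and avoids the mirror, so by the intermediate
    value theorem the sign at \<open>base\<close> holds on all of \<open>C\<close>.\<close>
  then have pos: "a \<bullet> x > 0" if x: "x \<in> C" for x
    using connected_ivt_hyperplane[OF in_components_connected[OF comp] x base_C, of a 0] C0 by force
  have "closure C \<subseteq> {x. a \<bullet> x \<ge> 0}"
    using pos by (intro closure_minimal closed_halfspace_ge) (auto intro: less_imp_le)
  then have "\<forall>x\<in>K. a \<bullet> x \<ge> 0" unfolding K_eq by blast
  then show ?thesis using a pos by blast
qed

lemma mirrors_eq:
  "\<Union>{mirror_on UNIV r | r. r \<in> \<rho> ` carrier W \<and> reflection_on UNIV r} = \<Union>(mir ` refl)"
  by (auto simp: refl_def mir_def)

lemma comp': "C \<in> components (U - \<Union>(mir ` refl))"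
  using comp unfolding mirrors_eq .

text \<open>Infinitely many mirrors are removed, so openness needs local finiteness: by proper
  discontinuity only finitely many mirrors meet a small closed ball.\<close>

lemma open_C: "open C"
proof (rule open_components[OF _ comp'])
  show "open (U - \<Union>(mir ` refl))"
    unfolding open_contains_ball
  proof
    fix x assume x: "x \<in> U - \<Union>(mir ` refl)"
    obtain e where e: "e > 0" "cball x e \<subseteq> U" using open_U x by (meson DiffD1 open_contains_cball)
    define R where "R = {r \<in> refl. mir r \<inter> cball x e \<noteq> {}}"
    have "R \<subseteq> {g \<in> carrier W. \<rho> g ` cball x e \<inter> cball x e \<noteq> {}}"
      unfolding R_def using fixes_point_in by blast
    then have fR: "finite R" using proper[OF compact_cball e(2)] finite_subset by blast
    have cl: "closed (mir r)" if "r \<in> refl" for r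
    proof -
      obtain a w where "mir r = {x. a \<bullet> x = 0}" using refl_formula[OF \<open>r \<in> refl\<close>] by blast
      then show ?thesis by (simp add: closed_hyperplane)
    qed
    have "open (ball x e - \<Union>(mir ` R))"
      using fR cl by (intro open_Diff closed_UN) (auto simp: R_def)
    moreover have "x \<in> ball x e - \<Union>(mir ` R)" using x e by (auto simp: R_def)
    ultimately obtain d where d: "d > 0" "ball x d \<subseteq> ball x e - \<Union>(mir ` R)" by (meson open_contains_ball)
    have "ball x d \<subseteq> U - \<Union>(mir ` refl)"
    proof
      fix y assume "y \<in> ball x d"
      then have y: "y \<in> ball x e" "y \<notin> \<Union>(mir ` R)" using d by auto
      then have "y \<in> cball x e" by simp
      then show "y \<in> U - \<Union>(mir ` refl)" using y(2) e(2) unfolding R_def by blast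
    qed
    then show "\<exists>e>0. ball x e \<subseteq> U - \<Union>(mir ` refl)" using d(1) by blast
  qed
qed

lemma C_sub_K: "C \<subseteq> K" unfolding K_eq using C_sub(1) closure_subset[of C] by blast

lemma aff_dim_K: "aff_dim K = DIM('v)"
proof -
  have "C \<noteq> {}" using base_C by blast
  from aff_dim_open[OF open_C this] show ?thesis
    using aff_dim_subset[OF C_sub_K] aff_dim_le_DIM[of K] by linarith
qed

text \<open>A segment between two points of \<open>C\<close> crosses no mirror, since the signs at
  its ends agree, so it stays in the same component.\<close>

lemma convex_C: "convex C"
  unfolding convex_contains_segment
proof (intro ballI)
  fix p q assume pq: "p \<in> C" "q \<in> C"
  have "closed_segment p q \<inter> mir r = {}" if r: "r \<in> refl" for r
  proof -
    obtain a where a: "mir r = {x. a \<bullet> x = 0}" "\<forall>x\<in>C. a \<bullet> x > 0" "\<forall>x\<in>K. a \<bullet> x \<ge> 0"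
      using wall_sign[OF r] by blast
    have sg: "a \<bullet> p > 0" "a \<bullet> q > 0" using a(2) pq by auto
    then have "p \<notin> mir r" "q \<notin> mir r" unfolding a(1) by auto
    from meets_iff_signs[OF a(1) this] have "\<not> meets r p q" using sg by simp
    then show ?thesis by (simp add: meets_def)
  qed
  moreover have "closed_segment p q \<subseteq> U" using pq C_sub(1) convex_U by (intro closed_segment_subset) auto
  ultimately have sub: "closed_segment p q \<subseteq> U - \<Union>(mir ` refl)" by blast
  have "C \<inter> closed_segment p q \<noteq> {}" using pq(1) by auto
  then show "closed_segment p q \<subseteq> C"
    by (rule components_maximal[OF comp' connected_segment(1) sub])
qed

lemma convex_K: "convex K"
  unfolding K_eq by (intro convex_Int convex_U convex_closure convex_C)

lemma subspace_mir:
  assumes "r \<in> refl"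
  shows "subspace (mir r)" "dim (mir r) = DIM('v) - 1"
proof -
  obtain a w where a: "a \<bullet> w = 2" "mir r = {x. a \<bullet> x = 0}" by (rule refl_formula[OF assms])
  then have a0: "a \<noteq> 0" by auto
  show "subspace (mir r)" unfolding a(2) by (rule subspace_hyperplane)
  show "dim (mir r) = DIM('v) - 1" unfolding a(2) by (rule dim_hyperplane[OF a0])
qed

text \<open>Distinct reflections have distinct mirrors by \<open>mir_inj\<close>. These meet in
  codimension two, which is too small to contain a facet.\<close>

lemma facet_not_in_other_mirror:
  assumes "r \<in> refl" "s \<in> refl" "r \<noteq> s" "F facet_of K" "F \<subseteq> mir s"
  shows "\<not> F \<subseteq> mir r"
proof
  assume "F \<subseteq> mir r"
  then have "aff_dim F \<le> aff_dim (mir r \<inter> mir s)" using assms(5) by (intro aff_dim_subset) auto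
  also have "\<dots> = dim (mir r \<inter> mir s)"
    using subspace_mir assms by (intro aff_dim_subspace subspace_inter) auto
  also have "\<dots> < dim (mir s)"
  proof -
    have "mir r \<inter> mir s \<subseteq> mir s" by blast
    moreover have "mir r \<inter> mir s \<noteq> mir s"
    proof
      assume "mir r \<inter> mir s = mir s"
      then have "mir s \<subseteq> mir r" by blast
      then have "mir s = mir r" using subspace_mir assms by (intro subspace_dim_equal) auto
      then show False using mir_inj assms by blast
    qed
    moreover have "subspace (mir r \<inter> mir s)" "subspace (mir s)" using subspace_mir assms by (auto intro: subspace_inter)
    ultimately show ?thesis by (metis dim_psubset psubsetI span_eq_iff of_nat_less_iff)
  qed
  finally have "aff_dim F < int (DIM('v) - 1)" using subspace_mir assms by simp
  moreover have "aff_dim F = DIM('v) - 1" using assms(4) aff_dim_K by (simp add: facet_of_def)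
  ultimately show False by (simp add: of_nat_diff)
qed

lemma S_refl: "s \<in> S \<Longrightarrow> s \<in> refl" by (simp add: S_eq refl_def)

lemma S_facet:
  assumes "s \<in> S"
  obtains F where "F facet_of K" "F \<subseteq> mir s"
  using assms by (auto simp: S_eq mir_def)

text \<open>Choose \<open>y\<close> in the facet of \<open>s\<close> off the mirror of
  \<open>r\<close>. It is fixed by \<open>s\<close> and lies in \<open>K\<close>, so the mirror of
  \<open>r\<close> separates it neither from \<open>base\<close> nor from
  \<open>\<rho> s base\<close>.\<close>

lemma inversions_simple:
  assumes "s \<in> S"
  shows "inversions s = {s}"
proof -
  have s: "s \<in> refl" "s \<in> carrier W" using assms S_refl refl_closed by auto
  have "s \<in> inversions s"
    using s base_orbit[of \<one> s] refl_segment_meets by (simp add: inversions_def)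
  moreover have "r = s" if r: "r \<in> inversions s" for r
  proof (rule ccontr)
    assume ne: "r \<noteq> s"
    have rr: "r \<in> refl" "meets r base (\<rho> s base)" using r by (auto simp: inversions_def)
    obtain F where F: "F facet_of K" "F \<subseteq> mir s" using S_facet[OF assms] .
    then obtain y where y: "y \<in> F" "y \<notin> mir r" using facet_not_in_other_mirror[OF rr(1) s(1) ne F] by blast
    have yK: "y \<in> K" using F y facet_of_imp_subset by blast
    have ys: "\<rho> s y = y" using F y mem_mir by blast
    have near: "\<not> meets q base y" if qr: "q \<in> refl" "y \<notin> mir q" for q
    proof -
      obtain a where a: "mir q = {x. a \<bullet> x = 0}" "\<forall>x\<in>C. a \<bullet> x > 0" "\<forall>x\<in>K. a \<bullet> x \<ge> 0"
        using wall_sign[OF qr(1)] by blast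
      have sg: "a \<bullet> base > 0" "a \<bullet> y \<ge> 0" using a(2,3) base_C yK by auto
      have "base \<notin> mir q" unfolding a(1) using sg by simp
      from meets_iff_signs[OF a(1) this qr(2)] show ?thesis using sg by simp
    qed
    have q: "inv s \<otimes> r \<otimes> s \<in> refl" "y \<notin> mir (inv s \<otimes> r \<otimes> s)"
      using refl_conj' mir_conj[of s r y] ys y rr s refl_closed by auto
    have "\<not> meets r (\<rho> s base) (\<rho> s y)" using meets_conj[of s r base y] near[OF q] s rr refl_closed by simp
    then have "\<not> meets r base (\<rho> s base)"
      using meets_trans[of r base y "\<rho> s base"] near[OF rr(1) y(2)] ys y(2) base_orbit[of \<one> r] base_orbit[of s r] rr s meets_commute
      by simp
    then show False using rr by blast
  qed
  ultimately show ?thesis by blast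
qed

sublocale reflection_system W S refl inversions
proof unfold_locales
  show "S \<subseteq> refl" using S_refl by blast
  show "refl \<subseteq> carrier W" using refl_closed by blast
  show "t \<in> refl \<Longrightarrow> t \<otimes> t = \<one>" for t by (rule refl_sq)
  show "g \<in> carrier W \<Longrightarrow> t \<in> refl \<Longrightarrow> g \<otimes> t \<otimes> inv g \<in> refl" for g t by (rule refl_conj)
  show "inversions g \<subseteq> refl" for g by (auto simp: inversions_def)
  show "g \<in> carrier W \<Longrightarrow> finite (inversions g)" for g
    using segment_refls_finite[of base "\<rho> g base"] base_U act_U by (simp add: inversions_def)
  show "s \<in> S \<Longrightarrow> inversions s = {s}" for s by (rule inversions_simple)
  show "t \<in> refl \<Longrightarrow> t \<in> inversions t" for t
    using base_orbit[of \<one> t] refl_segment_meets by (simp add: inversions_def)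
  show "generate W S = carrier W" by (rule gen)
  fix g h t assume g: "g \<in> carrier W" and h: "h \<in> carrier W" and t: "t \<in> refl"
  have "meets t base (\<rho> (g \<otimes> h) base) \<longleftrightarrow> meets t base (\<rho> g base) \<noteq> meets t (\<rho> g base) (\<rho> (g \<otimes> h) base)"
    using base_orbit[of \<one> t] base_orbit[of g t] base_orbit[of "g \<otimes> h" t] g h t by (intro meets_trans) auto
  then show "t \<in> inversions (g \<otimes> h) \<longleftrightarrow> (t \<in> inversions g) \<noteq> (inv g \<otimes> t \<otimes> g \<in> inversions h)"
    using g h t refl_conj' refl_closed meets_conj[of g t base "\<rho> h base"] by (simp add: inversions_def act_mult)
qed

text \<open>A facet inside the mirror is a face of \<open>K \<inter> mir s\<close>. Were it a proper
  face, its dimension would be less than that of a hyperplane. This gives the uniqueness behind the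
  description in \<open>facet_in\<close>.\<close>

lemma facet_mir:
  assumes s: "s \<in> S"
  shows "(K \<inter> mir s) facet_of K" "facet_in (mir s) K = K \<inter> mir s"
proof -
  have sr: "s \<in> refl" using s S_refl by blast
  obtain a where a: "mir s = {x. a \<bullet> x = 0}" "\<forall>x\<in>K. a \<bullet> x \<ge> 0" using wall_sign[OF sr] by blast
  have face: "(K \<inter> mir s) face_of K"
    unfolding a(1) using a(2) by (intro face_of_Int_supporting_hyperplane_ge convex_K) auto
  have eq: "F = K \<inter> mir s" if F: "F facet_of K" "F \<subseteq> mir s" for F
  proof (rule ccontr)
    assume ne: "F \<noteq> K \<inter> mir s"
    have "F face_of K" using F(1) by (rule facet_of_imp_face_of)
    moreover have "F \<subseteq> K \<inter> mir s" using F facet_of_imp_subset by blast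
    ultimately have "F face_of (K \<inter> mir s)" by (rule face_of_subset) blast
    then have "aff_dim F < aff_dim (K \<inter> mir s)"
      using ne face_of_imp_convex[OF face] by (intro face_of_aff_dim_lt)
    also have "\<dots> \<le> aff_dim (mir s)" by (intro aff_dim_subset) blast
    also have "\<dots> = DIM('v) - 1" using subspace_mir[OF sr] by (simp add: aff_dim_subspace)
    also have "\<dots> = aff_dim F" using F(1) aff_dim_K by (simp add: facet_of_def of_nat_diff)
    finally show False by simp
  qed
  obtain F0 where F0: "F0 facet_of K" "F0 \<subseteq> mir s" by (rule S_facet[OF s])
  show fac: "(K \<inter> mir s) facet_of K" using F0(1) unfolding eq[OF F0] .
  show "facet_in (mir s) K = K \<inter> mir s"
    unfolding facet_in_def
  proof (rule the_equality)
    show "(K \<inter> mir s) facet_of K \<and> K \<inter> mir s \<subseteq> mir s" using fac by blast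
  qed (use eq in blast)
qed

lemma half_space_eq:
  assumes "mir s = {x. a \<bullet> x = 0}" "\<forall>x\<in>C. a \<bullet> x > 0" "\<forall>x\<in>K. a \<bullet> x \<ge> 0"
  shows "half_space_of (mir s) K = {x. a \<bullet> x \<ge> 0}"
  unfolding half_space_of_def
proof (rule the_equality)
  have ab: "a \<bullet> base > 0" using assms(2) base_C by blast
  then have "a \<noteq> 0" by auto
  then show "(\<exists>b. b \<noteq> 0 \<and> mir s = {x. b \<bullet> x = 0} \<and> {x. a \<bullet> x \<ge> 0} = {x. b \<bullet> x \<ge> 0}) \<and> K \<subseteq> {x. a \<bullet> x \<ge> 0}"
    using assms(1,3) by blast
  fix P assume "(\<exists>b. b \<noteq> 0 \<and> mir s = {x. b \<bullet> x = 0} \<and> P = {x. b \<bullet> x \<ge> 0}) \<and> K \<subseteq> P"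
  then obtain b where b: "mir s = {x. b \<bullet> x = 0}" "P = {x. b \<bullet> x \<ge> 0}" "K \<subseteq> P" by blast
  have "base \<in> K" using base_C C_sub_K by blast
  then have "b \<bullet> base \<ge> 0" using b(2,3) by blast
  moreover have "base \<notin> mir s" using ab unfolding assms(1) by simp
  ultimately have bb: "b \<bullet> base > 0" unfolding b(1) by simp
  \<comment> \<open>A functional with the same kernel is a multiple of \<open>a\<close>, and its
    value at \<open>base\<close> shows that the factor is positive.\<close>
  have bx: "b \<bullet> x = ((a \<bullet> x) / (a \<bullet> base)) * (b \<bullet> base)" for x
  proof -
    have "x - ((a \<bullet> x) / (a \<bullet> base)) *\<^sub>R base \<in> mir s"
      unfolding assms(1) using ab by (simp add: inner_diff_right)
    then show ?thesis unfolding b(1) by (simp add: inner_diff_right)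
  qed
  have "b \<bullet> x \<ge> 0 \<longleftrightarrow> a \<bullet> x \<ge> 0" for x
    unfolding bx[of x] using ab bb by (simp add: zero_le_mult_iff zero_le_divide_iff)
  then show "P = {x. a \<bullet> x \<ge> 0}" unfolding b(2) by simp
qed

section \<open>\<open>W_Omega\<close> and its action on the mirror of \<open>s\<close>\<close>

lemma group_reflection_iff: "group_reflection W S r \<longleftrightarrow> r \<in> refl"
proof
  assume "group_reflection W S r"
  then obtain s g where "s \<in> S" "g \<in> carrier W" "r = g \<otimes> s \<otimes> inv g" unfolding group_reflection_def by blast
  then show "r \<in> refl" using refl_conj[of g s] S_refl by blast
next
  assume "r \<in> refl"
  then show "group_reflection W S r" unfolding group_reflection_def by (rule T_eq_conj_S)
qed

lemma W_Omega_eq: "W_Omega W S s = generate W (commuting s)"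
  unfolding W_Omega_def commuting_def group_reflection_iff ..

text \<open>Let \<open>w\<close> span the line negated by \<open>r\<close>. As \<open>r\<close> and
  \<open>s\<close> commute, \<open>\<rho> s w\<close> lies in this line. If \<open>w\<close> were
  outside the mirror of \<open>s\<close>, the two reflections would negate the same line, and
  commuting would force equal mirrors, hence \<open>r = s\<close>. So \<open>w\<close> lies in the
  mirror of \<open>s\<close>, where \<open>r\<close> restricts to a reflection.\<close>

lemma commuting_reflection_on:
  assumes s: "s \<in> S" and r: "r \<in> commuting s"
  shows "reflection_on (mir s) (\<rho> r)"
proof -
  have sr: "s \<in> refl" "s \<in> carrier W" using s S_refl refl_closed by blast+
  have rr: "r \<in> refl" "r \<otimes> s = s \<otimes> r" "r \<noteq> s" using commutingD[OF r] by blast+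
  have rc: "r \<in> carrier W" using rr refl_closed by blast
  obtain a w where aw: "a \<bullet> w = 2" "\<rho> r = (\<lambda>x. x - (a \<bullet> x) *\<^sub>R w)" "mir r = {x. a \<bullet> x = 0}"
    by (rule refl_formula[OF rr(1)])
  obtain b v where bv: "b \<bullet> v = 2" "\<rho> s = (\<lambda>x. x - (b \<bullet> x) *\<^sub>R v)" "mir s = {x. b \<bullet> x = 0}"
    by (rule refl_formula[OF sr(1)])
  have comm: "\<rho> r (\<rho> s x) = \<rho> s (\<rho> r x)" for x
    using act_mult[OF rc sr(2), of x] act_mult[OF sr(2) rc, of x] rr(2) by simp
  have v0: "v \<noteq> 0" using bv(1) by auto
  have "b \<bullet> w = 0"
  proof (rule ccontr)
    assume bw: "b \<bullet> w \<noteq> 0"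
    have rw: "\<rho> r w = - w" unfolding aw(2) using aw(1) by (simp add: scaleR_2)
    define y where "y = \<rho> s w"
    have "\<rho> r y = - y" using comm[of w] linear_neg[OF act_linear[OF sr(2)], of w] by (simp add: y_def rw)
    then have ry: "y - (a \<bullet> y) *\<^sub>R w = - y" unfolding aw(2) .
    have "(a \<bullet> y) *\<^sub>R w = y - (y - (a \<bullet> y) *\<^sub>R w)" by simp
    also have "\<dots> = 2 *\<^sub>R y" unfolding ry by (simp add: scaleR_2)
    finally have "y = (1 / 2) *\<^sub>R ((a \<bullet> y) *\<^sub>R w)" by simp
    then have y1: "y = ((a \<bullet> y) / 2) *\<^sub>R w" by simp
    have "y = w - (b \<bullet> w) *\<^sub>R v" unfolding y_def bv(2) ..
    then have "(b \<bullet> w) *\<^sub>R v = w - y" by simp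
    also have "\<dots> = w - ((a \<bullet> y) / 2) *\<^sub>R w" using y1 by simp
    also have "\<dots> = (1 - (a \<bullet> y) / 2) *\<^sub>R w" by (simp add: scaleR_left_diff_distrib)
    finally have "inverse (b \<bullet> w) *\<^sub>R ((b \<bullet> w) *\<^sub>R v) = inverse (b \<bullet> w) *\<^sub>R ((1 - (a \<bullet> y) / 2) *\<^sub>R w)" by (rule arg_cong)
    then have "v = (inverse (b \<bullet> w) * (1 - (a \<bullet> y) / 2)) *\<^sub>R w" using bw by simp
    then obtain k where k: "v = k *\<^sub>R w" by blast
    then have k0: "k \<noteq> 0" using v0 by auto
    have "mir r \<subseteq> mir s"
    proof
      fix x assume x: "x \<in> mir r"
      then have "\<rho> r x = x" by (simp add: mem_mir)
      then have "\<rho> r (\<rho> s x) = \<rho> s x" using comm by metis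
      then have "a \<bullet> \<rho> s x = 0" using mem_mir aw(3) by blast
      moreover have "a \<bullet> x = 0" using x aw(3) by blast
      ultimately have "(b \<bullet> x) * k * 2 = 0" unfolding bv(2) k using aw(1) by (simp add: inner_diff_right)
      then show "x \<in> mir s" unfolding bv(3) using k0 by simp
    qed
    then have "mir r = mir s" using subspace_mir[OF rr(1)] subspace_mir[OF sr(1)] by (intro subspace_dim_equal) auto
    then show False using mir_inj rr sr by blast
  qed
  then have wV: "w \<in> mir s" unfolding bv(3) by simp
  define H where "H = mir r \<inter> mir s"
  have subs: "subspace (mir r)" "subspace (mir s)" "subspace H"
    using subspace_mir rr sr unfolding H_def by (auto intro: subspace_inter)
  have wH: "w \<notin> H" unfolding H_def aw(3) using aw(1) by simp
  have "span (insert w H) = mir s"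
  proof
    show "span (insert w H) \<subseteq> mir s" using wV subs by (intro span_minimal) (auto simp: H_def)
    show "mir s \<subseteq> span (insert w H)"
    proof
      fix x assume x: "x \<in> mir s"
      define c where "c = (a \<bullet> x) / 2"
      have "x - c *\<^sub>R w \<in> mir s" using x wV subs(2) by (intro subspace_diff subspace_scale)
      moreover have "x - c *\<^sub>R w \<in> mir r" unfolding aw(3) c_def using aw(1) by (simp add: inner_diff_right)
      ultimately have "x - c *\<^sub>R w \<in> span (insert w H)" unfolding H_def by (intro span_base) blast
      moreover have "c *\<^sub>R w \<in> span (insert w H)" by (intro span_scale span_base) blast
      ultimately have "(x - c *\<^sub>R w) + c *\<^sub>R w \<in> span (insert w H)" by (rule span_add)
      then show "x \<in> span (insert w H)" by simp
    qed
  qed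
  then have "dim (mir s) = dim (insert w H)" by (metis dim_span)
  also have "\<dots> = dim H + 1"
  proof -
    have "w \<notin> span H" using wH unfolding iffD2[OF span_eq_iff subs(3)] .
    then show ?thesis unfolding dim_insert by simp
  qed
  finally have dimH: "dim H + 1 = dim (mir s)" by simp
  have "\<rho> r ` mir s \<subseteq> mir s"
  proof
    fix y assume "y \<in> \<rho> r ` mir s"
    then obtain x where x: "\<rho> s x = x" "y = \<rho> r x" by (auto simp: mem_mir)
    then show "y \<in> mir s" using comm[of x] by (simp add: mem_mir)
  qed
  moreover have "\<rho> r w = - w" unfolding aw(2) using aw(1) by (simp add: scaleR_2)
  moreover have "\<forall>x\<in>H. \<rho> r x = x" unfolding H_def by (simp add: mem_mir)
  moreover have "H \<subseteq> mir s" unfolding H_def by blast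
  ultimately show ?thesis
    unfolding reflection_on_def using act_linear[OF rc] subs(3) dimH wV wH by blast
qed

lemma mir_commute:
  assumes "g \<in> carrier W" "s \<in> refl" "s \<otimes> g = g \<otimes> s"
  shows "\<rho> g x \<in> mir s \<longleftrightarrow> x \<in> mir s"
  using mir_conj[OF assms(1) refl_closed[OF assms(2)], of x] conj_intertwine(1)[OF assms(1,2,2,3)] by simp

lemma chamber_same_side:
  assumes "r \<in> refl" "x \<in> K" "y \<in> K" "x \<notin> mir r" "y \<notin> mir r"
  shows "\<not> meets r x y"
proof -
  obtain a where a: "mir r = {x. a \<bullet> x = 0}" "\<forall>x\<in>K. a \<bullet> x \<ge> 0" using wall_sign[OF assms(1)] by blast
  have "a \<bullet> x \<ge> 0" "a \<bullet> y \<ge> 0" using a(2) assms(2,3) by blast+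
  then show ?thesis using meets_iff_signs[OF a(1) assms(4,5)] by simp
qed

text \<open>A mirror cuts \<open>K\<close> in a face. A face that contains a relative interior point
  of the facet contains the whole facet, which \<open>facet_not_in_other_mirror\<close>
  excludes.\<close>

lemma rel_interior_facet:
  assumes s: "s \<in> S"
  shows "rel_interior (K \<inter> mir s) \<noteq> {}"
    and "y \<in> rel_interior (K \<inter> mir s) \<Longrightarrow> r \<in> refl \<Longrightarrow> r \<noteq> s \<Longrightarrow> y \<notin> mir r"
proof -
  note F = facet_mir(1)[OF s]
  have conv: "convex (K \<inter> mir s)" using face_of_imp_convex[OF facet_of_imp_face_of[OF F]] .
  have "K \<inter> mir s \<noteq> {}" using F unfolding facet_of_def by blast
  then show "rel_interior (K \<inter> mir s) \<noteq> {}" using rel_interior_eq_empty[OF conv] by blast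
  assume y: "y \<in> rel_interior (K \<inter> mir s)" and r: "r \<in> refl" "r \<noteq> s"
  show "y \<notin> mir r"
  proof
    assume ym: "y \<in> mir r"
    obtain a where a: "mir r = {x. a \<bullet> x = 0}" "\<forall>x\<in>K. a \<bullet> x \<ge> 0" using wall_sign[OF r(1)] by blast
    have face: "(K \<inter> mir r) face_of K"
      unfolding a(1) using a(2) by (intro face_of_Int_supporting_hyperplane_ge convex_K) auto
    have "y \<in> K" using y rel_interior_subset by blast
    then have nd: "(K \<inter> mir r) \<inter> rel_interior (K \<inter> mir s) \<noteq> {}" using ym y by blast
    have "K \<inter> mir s \<subseteq> K \<inter> mir r" by (rule subset_of_face_of[OF face _ nd]) blast
    then have "K \<inter> mir s \<subseteq> mir r" by blast
    then show False using facet_not_in_other_mirror[OF r(1) S_refl[OF s] r(2) F] by blast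
  qed
qed

end

section \<open>The wall of a simple reflection\<close>

locale vinberg_wall = vinberg_chamber W S \<rho> U K C
  for W (structure) and S :: "'a set" and \<rho> :: "'a \<Rightarrow> 'v::euclidean_space \<Rightarrow> 'v" and U K C +
  fixes s :: 'a and f :: 'v
  assumes sS: "s \<in> S" and f: "f \<in> rel_interior (K \<inter> mir s)"
begin

text \<open>Only mirrors of commuting reflections of \<open>W\<close> are removed;
  \<open>regular_eq\<close> compares this with the complement used in
  \<open>K_Omega\<close>.\<close>

definition regular :: "'v set" where
  "regular = U \<inter> mir s - \<Union>(mir ` commuting s)"

definition cell :: "'v set" where
  "cell = connected_component_set regular f"

lemma s_refl: "s \<in> refl" and s_closed [simp]: "s \<in> carrier W"
  using sS S_refl refl_closed by blast+

lemma commuting_refl: "r \<in> commuting s \<Longrightarrow> r \<in> refl \<and> r \<in> carrier W"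
  using commutingD refl_closed by blast

lemma facet_sub: "rel_interior (K \<inter> mir s) \<subseteq> K \<inter> regular"
proof
  fix y assume y: "y \<in> rel_interior (K \<inter> mir s)"
  have "y \<in> K \<inter> mir s" using y rel_interior_subset by blast
  moreover have "y \<notin> mir r" if "r \<in> commuting s" for r
    using rel_interior_facet(2)[OF sS y] commutingD[OF that] by blast
  ultimately show "y \<in> K \<inter> regular" unfolding regular_def K_eq by blast
qed

lemma f_regular: "f \<in> regular" and f_K: "f \<in> K" using f facet_sub by blast+

lemma regularD:
  assumes "x \<in> regular"
  shows "x \<in> U" "x \<in> mir s" "r \<in> commuting s \<Longrightarrow> x \<notin> mir r"
  using assms unfolding regular_def by blast+

lemma commuting_conj_inv:
  assumes "g \<in> carrier W" "s \<otimes> g = g \<otimes> s" "r \<in> commuting s"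
  shows "inv g \<otimes> r \<otimes> g \<in> commuting s"
  using commuting_conj[OF assms(1) s_refl s_refl assms(2,3)] .

lemma regular_act:
  assumes "g \<in> carrier W" "s \<otimes> g = g \<otimes> s" "x \<in> regular"
  shows "\<rho> g x \<in> regular"
proof -
  note x = regularD[OF assms(3)]
  have "\<rho> g x \<notin> mir r" if r: "r \<in> commuting s" for r
    using mir_conj[OF assms(1), of r x] commuting_conj_inv[OF assms(1,2) r] x(3) commuting_refl[OF r] by blast
  then show ?thesis
    using act_U[OF assms(1) x(1)] mir_commute[OF assms(1) s_refl assms(2)] x(2) unfolding regular_def by blast
qed

text \<open>Both \<open>base\<close> and \<open>f\<close> lie in \<open>K\<close>, so no commuting
  mirror separates them. As conjugation by \<open>g\<close> preserves \<open>commuting s\<close>,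
  none separates their images under \<open>g\<close>.\<close>

lemma inversions_commuting:
  assumes "g \<in> carrier W" "s \<otimes> g = g \<otimes> s" "r \<in> commuting s"
  shows "r \<in> inversions g \<longleftrightarrow> meets r f (\<rho> g f)"
proof -
  have near: "\<not> meets q base f" if q: "q \<in> commuting s" for q
  proof (rule chamber_same_side)
    show "base \<in> K" using base_C C_sub_K by blast
    show "base \<notin> mir q" using base_orbit[OF one_closed, of q] commuting_refl[OF q] by simp
  qed (use commuting_refl[OF q] f_K regularD(3)[OF f_regular q] in blast)+
  have rr: "r \<in> refl" "r \<in> carrier W" using commuting_refl[OF assms(3)] by blast+
  have off: "base \<notin> mir r" "\<rho> g base \<notin> mir r" "f \<notin> mir r" "\<rho> g f \<notin> mir r"
    using base_orbit[OF one_closed rr(1)] base_orbit[OF assms(1) rr(1)] regularD(3)[OF f_regular assms(3)]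
      regularD(3)[OF regular_act[OF assms(1,2) f_regular] assms(3)] by simp_all
  have "\<not> meets r (\<rho> g base) (\<rho> g f)"
    unfolding meets_conj[OF assms(1) rr(2)] by (rule near[OF commuting_conj_inv[OF assms]])
  then have "meets r base (\<rho> g base) \<longleftrightarrow> meets r f (\<rho> g f)"
    using meets_trans[OF rr(1) off(1,3,2)] meets_trans[OF rr(1) off(3,4,2)] near[OF assms(3)] meets_commute by blast
  then show ?thesis unfolding inversions_def using rr by blast
qed

text \<open>
  The segment from \<open>x\<close> to \<open>h f\<close> is folded at the mirror it crosses first; this lowers the number
  of separating mirrors.
\<close>

lemma regular_orbit_cell:
  assumes x: "x \<in> regular"
  shows "\<exists>h\<in>generate W (commuting s). \<forall>r\<in>commuting s. \<not> meets r (\<rho> h f) x"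
proof -
  define \<Sigma> where "\<Sigma> = (\<lambda>h. {r \<in> commuting s. meets r (\<rho> h f) x})"
  obtain h where h: "h \<in> generate W (commuting s)"
    and least: "\<And>k. k \<in> generate W (commuting s) \<Longrightarrow> card (\<Sigma> h) \<le> card (\<Sigma> k)"
    using ex_has_least_nat[of "\<lambda>h. h \<in> generate W (commuting s)" \<one> "\<lambda>h. card (\<Sigma> h)"] generate.one by blast
  have hc: "h \<in> carrier W" using h by (rule generate_in_carrier[OF commuting_sub(2)])
  have hs: "s \<otimes> h = h \<otimes> s" using generate_commuting_commutes[OF sS h] .
  define y where "y = \<rho> h f"
  have y: "y \<in> regular" unfolding y_def by (rule regular_act[OF hc hs f_regular])
  have fin: "finite (\<Sigma> h)"
  proof (rule finite_subset)
    show "\<Sigma> h \<subseteq> {r \<in> refl. meets r y x}" unfolding \<Sigma>_def y_def using commuting_refl by blast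
    show "finite {r \<in> refl. meets r y x}" using segment_refls_finite regularD(1) x y by blast
  qed
  have "\<Sigma> h = {}"
  proof (rule ccontr)
    assume ne: "\<Sigma> h \<noteq> {}"
    \<comment> \<open>The crossings with the separating mirrors form a closed set, so one of them,
      \<open>p\<close>, is nearest to \<open>x\<close>. Any commuting mirror that meets the part
      from \<open>x\<close> to \<open>p\<close> must then pass through \<open>p\<close>.\<close>
    define Z where "Z = closed_segment x y \<inter> \<Union>(mir ` \<Sigma> h)"
    have "closed Z"
      unfolding Z_def
    proof (intro closed_Int closed_UN fin closed_segment ballI)
      fix r assume "r \<in> \<Sigma> h"
      then have "r \<in> refl" unfolding \<Sigma>_def using commuting_refl by blast
      then show "closed (mir r)" using subspace_mir(1) closed_subspace by blast
    qed
    moreover have "Z \<noteq> {}"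
    proof -
      obtain r where "r \<in> \<Sigma> h" using ne by blast
      moreover from this have "meets r x y" unfolding \<Sigma>_def y_def using meets_commute by blast
      ultimately show ?thesis unfolding Z_def meets_def by blast
    qed
    ultimately obtain p where p: "p \<in> Z" "\<forall>z\<in>Z. dist x p \<le> dist x z" using distance_attains_inf by metis
    obtain r where r: "r \<in> \<Sigma> h" "p \<in> mir r" and pxy: "p \<in> closed_segment x y" using p(1) unfolding Z_def by blast
    have rc: "r \<in> commuting s" "meets r y x" using r(1) unfolding \<Sigma>_def y_def by auto
    have rr: "r \<in> refl" "r \<in> carrier W" using commuting_refl[OF rc(1)] by blast+
    have first: "\<not> meets q x p" if q: "q \<in> commuting s" "p \<notin> mir q" for q
    proof
      assume "meets q x p"
      then obtain z where z: "z \<in> closed_segment x p" "z \<in> mir q" unfolding meets_def by blast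
      have zxy: "z \<in> closed_segment x y"
        using z(1) pxy by (meson ends_in_segment(1) subset_closed_segment subsetD)
      then have "meets q y x" using z(2) unfolding meets_def closed_segment_commute[of y x] by blast
      then have "z \<in> Z" unfolding Z_def \<Sigma>_def y_def[symmetric] using zxy z(2) q(1) by blast
      then have le: "dist x p \<le> dist x z" using p(2) by blast
      obtain u where u: "0 \<le> u" "u \<le> 1" "z = (1 - u) *\<^sub>R x + u *\<^sub>R p" using z(1) unfolding in_segment by blast
      have "u \<noteq> 1" using u(3) z(2) q(2) by auto
      have "x - z = u *\<^sub>R (x - p)" using u(3) by (simp add: algebra_simps)
      then have "dist x z = u * dist x p" using u(1) by (simp add: dist_norm)
      then have "(1 - u) * dist x p \<le> 0" using le by (simp add: algebra_simps)
      then have "dist x p \<le> 0" using u(2) \<open>u \<noteq> 1\<close> by (simp add: mult_le_0_iff)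
      then have "x = p" by simp
      then show False using regularD(3)[OF x rc(1)] r(2) by blast
    qed
    have rp: "\<rho> r p = p" using r(2) by (simp add: mem_mir)
    have conj: "r \<otimes> q \<otimes> r \<in> commuting s" if "q \<in> commuting s" for q
      using commuting_closed[OF s_refl rc(1) that] .
    have mconj: "meets q (\<rho> r z) (\<rho> r z') \<longleftrightarrow> meets (r \<otimes> q \<otimes> r) z z'" if "q \<in> commuting s" for q z z'
      using meets_conj[OF rr(2), of q z z'] commuting_refl[OF that] rr(1) by simp
    have pconj: "p \<in> mir (r \<otimes> q \<otimes> r) \<longleftrightarrow> p \<in> mir q" if "q \<in> commuting s" for q
      using mir_conj[OF rr(2), of q p] commuting_refl[OF that] rr(1) rp by simp
    have rs: "s \<otimes> r = r \<otimes> s" using commutingD[OF rc(1)] by simp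
    have ry: "\<rho> r y \<in> regular" by (rule regular_act[OF rr(2) rs y])
    define k where "k = r \<otimes> h"
    have kW: "k \<in> generate W (commuting s)" unfolding k_def using rc(1) h by (intro generate.eng) (auto intro: generate.incl)
    have ky: "\<rho> k f = \<rho> r y" unfolding k_def y_def using act_mult[OF rr(2) hc] .
    \<comment> \<open>If the mirror of \<open>q\<close> passes through \<open>p\<close>, so does
      that of its conjugate, and \<open>p\<close> lies on the segment. Otherwise neither mirror
      separates \<open>x\<close> from \<open>p\<close>, so \<open>q\<close> separates
      \<open>\<rho> r y\<close> from \<open>p\<close>; its conjugate then separates \<open>y\<close>
      from \<open>p\<close>, hence from \<open>x\<close>.\<close>
    have sub: "r \<otimes> q \<otimes> r \<in> \<Sigma> h" if "q \<in> \<Sigma> k" for q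
    proof -
      have q: "q \<in> commuting s" "meets q (\<rho> r y) x" using that unfolding \<Sigma>_def ky by auto
      note qr = commuting_refl[OF q(1)] commuting_refl[OF conj[OF q(1)]]
      have "meets (r \<otimes> q \<otimes> r) y x"
      proof (cases "p \<in> mir q")
        case True
        then have "p \<in> mir (r \<otimes> q \<otimes> r)" using pconj[OF q(1)] by blast
        then show ?thesis using pxy unfolding meets_def closed_segment_commute[of y x] by blast
      next
        case False
        then have F': "p \<notin> mir (r \<otimes> q \<otimes> r)" using pconj[OF q(1)] by blast
        have "meets q (\<rho> r y) p"
          using meets_trans[OF _ regularD(3)[OF ry q(1)] False regularD(3)[OF x q(1)]] first[OF q(1) False] q(2) qr meets_commute
          by blast
        then have "meets (r \<otimes> q \<otimes> r) y p" using mconj[OF q(1), of y p] rp by simp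
        then show ?thesis
          using meets_trans[OF _ regularD(3)[OF y conj[OF q(1)]] F' regularD(3)[OF x conj[OF q(1)]]]
            first[OF conj[OF q(1)] F'] qr meets_commute by blast
      qed
      then show ?thesis unfolding \<Sigma>_def y_def[symmetric] using conj[OF q(1)] by blast
    qed
    have inv2: "r \<otimes> (r \<otimes> q \<otimes> r) \<otimes> r = q" if "q \<in> commuting s" for q
      using commuting_refl[OF that] rr by (simp add: m_assoc)
    have rk: "r \<notin> \<Sigma> k"
    proof
      assume "r \<in> \<Sigma> k"
      then have "meets r (\<rho> r y) x" unfolding \<Sigma>_def ky by blast
      moreover have "meets r (\<rho> r y) y"
        using refl_segment_meets[OF rr(1) regularD(3)[OF y rc(1)]] meets_commute by blast
      ultimately show False
        using meets_trans[OF rr(1) regularD(3)[OF ry rc(1)] regularD(3)[OF y rc(1)] regularD(3)[OF x rc(1)]] rc(2) by blast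
    qed
    have inj: "inj_on (\<lambda>q. r \<otimes> q \<otimes> r) (\<Sigma> k)"
      using inv2 by (intro inj_on_inverseI[where g = "\<lambda>q. r \<otimes> q \<otimes> r"]) (simp add: \<Sigma>_def)
    \<comment> \<open>The strict decrease comes from \<open>r\<close>: it separates \<open>y\<close>
      from \<open>x\<close> but no longer separates \<open>\<rho> r y\<close> from
      \<open>x\<close>.\<close>
    have "(\<lambda>q. r \<otimes> q \<otimes> r) ` \<Sigma> k \<subseteq> \<Sigma> h - {r}"
    proof
      fix q assume "q \<in> (\<lambda>q. r \<otimes> q \<otimes> r) ` \<Sigma> k"
      then obtain q' where q': "q' \<in> \<Sigma> k" "q = r \<otimes> q' \<otimes> r" by blast
      have "q \<noteq> r"
      proof
        assume "q = r"
        then have "r \<otimes> (r \<otimes> q' \<otimes> r) \<otimes> r = r \<otimes> r \<otimes> r" using q' by simp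
        then have "q' = r" using inv2[of q'] q'(1) rr unfolding \<Sigma>_def by (simp add: m_assoc)
        then show False using rk q' by blast
      qed
      then show "q \<in> \<Sigma> h - {r}" using sub q' by blast
    qed
    then have "card ((\<lambda>q. r \<otimes> q \<otimes> r) ` \<Sigma> k) \<le> card (\<Sigma> h - {r})" using fin by (intro card_mono) auto
    then have "card (\<Sigma> k) \<le> card (\<Sigma> h - {r})" using card_image[OF inj] by simp
    also have "\<dots> < card (\<Sigma> h)" using fin r(1) by (intro card_Diff1_less)
    finally show False using least[OF kW] by simp
  qed
  then have "\<forall>r\<in>commuting s. \<not> meets r (\<rho> h f) x" unfolding \<Sigma>_def by blast
  then show ?thesis using h by blast
qed

text \<open>Some \<open>\<rho> h f\<close> is separated from \<open>x\<close> by no commuting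
  mirror. As \<open>g\<close> fixes \<open>x\<close>, the point \<open>\<rho> g (\<rho> h f)\<close>
  is not separated from \<open>\<rho> h f\<close> either. So the conjugate of \<open>g\<close> by
  \<open>h\<close> has no inversion commuting with \<open>s\<close>, and is trivial.\<close>

lemma regular_stabilizer:
  assumes g: "g \<in> generate W (commuting s)" and x: "x \<in> regular" and gx: "\<rho> g x = x"
  shows "g = \<one>"
proof -
  obtain h where h: "h \<in> generate W (commuting s)" "\<forall>r\<in>commuting s. \<not> meets r (\<rho> h f) x"
    using regular_orbit_cell[OF x] by blast
  have c: "h \<in> carrier W" "g \<in> carrier W" using generate_in_carrier[OF commuting_sub(2)] g h(1) by blast+
  have comm: "s \<otimes> h = h \<otimes> s" "s \<otimes> g = g \<otimes> s" using generate_commuting_commutes[OF sS] g h(1) by blast+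
  define k where "k = inv h \<otimes> g \<otimes> h"
  have kW: "k \<in> generate W (commuting s)"
    unfolding k_def using g h(1) generate_m_inv_closed[OF commuting_sub(2)] by (blast intro: generate.eng)
  have kc: "k \<in> carrier W" "s \<otimes> k = k \<otimes> s"
    using generate_in_carrier[OF commuting_sub(2) kW] generate_commuting_commutes[OF sS kW] by blast+
  have hf: "\<rho> h f \<in> regular" by (rule regular_act[OF c(1) comm(1) f_regular])
  have ghf: "\<rho> g (\<rho> h f) \<in> regular" by (rule regular_act[OF c(2) comm(2) hf])
  have "\<not> meets r f (\<rho> k f)" if r: "r \<in> commuting s" for r
  proof -
    define q where "q = h \<otimes> r \<otimes> inv h"
    have q: "q \<in> commuting s" unfolding q_def using commuting_conj'[OF c(1) s_refl s_refl comm(1) r] .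
    have rc: "r \<in> carrier W" using commuting_refl[OF r] by blast
    have "inv h \<otimes> q \<otimes> h = r" unfolding q_def using c rc by (simp add: m_assoc)
    then have "meets r f (\<rho> k f) \<longleftrightarrow> meets q (\<rho> h f) (\<rho> h (\<rho> k f))"
      using meets_conj[OF c(1), of q f "\<rho> k f"] commuting_refl[OF q] by simp
    also have "\<rho> h (\<rho> k f) = \<rho> g (\<rho> h f)" unfolding k_def using c by (simp add: act_mult)
    finally have e: "meets r f (\<rho> k f) \<longleftrightarrow> meets q (\<rho> h f) (\<rho> g (\<rho> h f))" .
    have "\<not> meets q (\<rho> g x) (\<rho> g (\<rho> h f))"
      unfolding meets_conj[OF c(2) commuting_refl[OF q, THEN conjunct2]]
      using h(2) commuting_conj_inv[OF c(2) comm(2) q] meets_commute by blast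
    then have "\<not> meets q x (\<rho> g (\<rho> h f))" unfolding gx .
    moreover have "\<not> meets q (\<rho> h f) x" using h(2) q by blast
    ultimately show ?thesis
      unfolding e using meets_trans[of q "\<rho> h f" x "\<rho> g (\<rho> h f)"] commuting_refl[OF q] regularD(3)[OF hf q]
        regularD(3)[OF x q] regularD(3)[OF ghf q] by blast
  qed
  then have "inversions k \<inter> commuting s = {}" using inversions_commuting[OF kc] by blast
  then have "k = \<one>" by (rule generate_commuting_one[OF sS kW])
  then have "h \<otimes> k \<otimes> inv h = \<one>" using c by simp
  then show "g = \<one>" unfolding k_def using c by (simp add: m_assoc)
qed

text \<open>An element of the subgroup that fixes a regular point is trivial, and the identity
  negates no nonzero vector. So the mirrors of all elements acting as reflections on the wall avoid
  \<open>regular\<close>.\<close>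

lemma regular_eq:
  "U \<inter> mir s - \<Union>{mirror_on (mir s) r | r. r \<in> \<rho> ` W_Omega W S s \<and> reflection_on (mir s) r} = regular"
proof
  let ?M = "\<Union>{mirror_on (mir s) r | r. r \<in> \<rho> ` W_Omega W S s \<and> reflection_on (mir s) r}"
  have "x \<in> ?M" if x: "x \<in> mir s" "x \<in> mir r" and r: "r \<in> commuting s" for x r
  proof -
    have "\<rho> r \<in> \<rho> ` W_Omega W S s" unfolding W_Omega_eq using r by (blast intro: generate.incl)
    moreover have "x \<in> mirror_on (mir s) (\<rho> r)" using x unfolding mirror_on_def mem_mir by blast
    ultimately show ?thesis using commuting_reflection_on[OF sS r] by blast
  qed
  then show "U \<inter> mir s - ?M \<subseteq> regular" unfolding regular_def by blast
  show "regular \<subseteq> U \<inter> mir s - ?M"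
  proof
    fix x assume x: "x \<in> regular"
    have "x \<notin> ?M"
    proof
      assume "x \<in> ?M"
      then obtain g where g: "g \<in> generate W (commuting s)" "reflection_on (mir s) (\<rho> g)" "x \<in> mirror_on (mir s) (\<rho> g)"
        unfolding W_Omega_eq by blast
      have "\<rho> g x = x" using g(3) unfolding mirror_on_def by blast
      then have g1: "g = \<one>" by (rule regular_stabilizer[OF g(1) x])
      obtain H v where H: "subspace H" "v \<notin> H" "\<rho> g v = - v" using g(2) unfolding reflection_on_def by blast
      have "v = - v" using H(3) unfolding g1 act_one .
      from arg_cong[OF this, of "\<lambda>x. v + x"] have "v + v = 0" by simp
      then have "2 *\<^sub>R v = 0" unfolding scaleR_2 .
      then have "v = 0" by simp
      then show False using H subspace_0 by blast
    qed
    then show "x \<in> U \<inter> mir s - ?M" using regularD(1,2)[OF x] by blast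
  qed
qed

section \<open>The cell of the facet, \<open>K_Omega\<close> and its stabilizer\<close>

lemma convex_wall: "convex (U \<inter> mir s)"
  by (rule convex_Int[OF convex_U subspace_imp_convex[OF subspace_mir(1)[OF s_refl]]])

lemma same_side_if_connected:
  assumes "connected T" "T \<subseteq> regular" "x \<in> T" "y \<in> T" "r \<in> commuting s"
  shows "\<not> meets r x y"
proof
  assume m: "meets r x y"
  obtain a where a: "mir r = {x. a \<bullet> x = 0}" using wall_sign commuting_refl[OF assms(5)] by blast
  have off: "z \<notin> mir r" if "z \<in> T" for z using regularD(3) assms(2,5) that by blast
  have "(a \<bullet> x < 0) \<noteq> (a \<bullet> y < 0)" using meets_iff_signs[OF a off[OF assms(3)] off[OF assms(4)]] m by blast
  have "\<exists>z\<in>T. a \<bullet> z = 0"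
  proof (cases "a \<bullet> x < 0")
    case True
    then show ?thesis using connected_ivt_hyperplane[OF assms(1,3,4), of a 0] \<open>(a \<bullet> x < 0) \<noteq> (a \<bullet> y < 0)\<close> by simp
  next
    case False
    then show ?thesis using connected_ivt_hyperplane[OF assms(1,4,3), of a 0] \<open>(a \<bullet> x < 0) \<noteq> (a \<bullet> y < 0)\<close> by simp
  qed
  then show False using off a by blast
qed

text \<open>The wall is convex, so a point not separated from \<open>f\<close> is joined to it by a
  segment of regular points. Conversely, a connected set of regular points cannot change sign at a
  mirror.\<close>

lemma mem_cell: "x \<in> cell \<longleftrightarrow> x \<in> regular \<and> (\<forall>r\<in>commuting s. \<not> meets r f x)"
proof
  assume "x \<in> cell"
  then obtain T where T: "connected T" "T \<subseteq> regular" "f \<in> T" "x \<in> T"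
    unfolding cell_def connected_component_def mem_Collect_eq by blast
  have "x \<in> regular" using T(2,4) by blast
  then show "x \<in> regular \<and> (\<forall>r\<in>commuting s. \<not> meets r f x)"
    using same_side_if_connected[OF T] by simp
next
  assume x: "x \<in> regular \<and> (\<forall>r\<in>commuting s. \<not> meets r f x)"
  have "f \<in> U \<inter> mir s" "x \<in> U \<inter> mir s" using f_regular x unfolding regular_def by blast+
  from closed_segment_subset[OF this convex_wall] have seg: "closed_segment f x \<subseteq> U \<inter> mir s" .
  have "z \<in> regular" if z: "z \<in> closed_segment f x" for z
  proof -
    have "z \<notin> mir r" if "r \<in> commuting s" for r
      using x that z unfolding meets_def by blast
    then show ?thesis using seg z unfolding regular_def by blast
  qed
  then have "closed_segment f x \<subseteq> regular" by (rule subsetI)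
  then have "connected_component regular f x"
    unfolding connected_component_def by (intro exI[of _ "closed_segment f x"]) (simp add: connected_segment)
  then show "x \<in> cell" unfolding cell_def by simp
qed

lemma cell_component: "cell \<in> components regular"
  unfolding cell_def using f_regular by (rule componentsI)

text \<open>Passing to the closure keeps a weak inequality, which is strict again because
  \<open>z\<close> is off the mirror.\<close>

lemma closure_same_side:
  assumes "D \<subseteq> regular" "x \<in> regular" "\<forall>r\<in>commuting s. \<forall>y\<in>D. \<not> meets r x y" "z \<in> closure D" "r \<in> commuting s" "z \<notin> mir r"
  shows "\<not> meets r x z"
proof -
  obtain b where b: "mir r = {x. b \<bullet> x = 0}" using wall_sign commuting_refl[OF assms(5)] by blast
  define a where "a = (if b \<bullet> x < 0 then - b else b)"
  have a: "mir r = {x. a \<bullet> x = 0}" unfolding b a_def by simp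
  have xr: "x \<notin> mir r" using regularD(3)[OF assms(2,5)] .
  then have "b \<bullet> x \<noteq> 0" unfolding b by simp
  then have ax: "a \<bullet> x > 0" unfolding a_def by simp
  have "D \<subseteq> {y. a \<bullet> y \<ge> 0}"
  proof
    fix y assume y: "y \<in> D"
    have "y \<in> regular" using assms(1) y by blast
    then have "y \<notin> mir r" using assms(5) by (rule regularD(3))
    note signs = meets_iff_signs[OF a xr this]
    have "\<not> meets r x y" using assms(3,5) y by blast
    then have "\<not> a \<bullet> y < 0" unfolding signs using ax by simp
    then show "y \<in> {y. a \<bullet> y \<ge> 0}" by simp
  qed
  then have "closure D \<subseteq> {y. a \<bullet> y \<ge> 0}" by (intro closure_minimal closed_halfspace_ge)
  then have "a \<bullet> z \<ge> 0" using assms(4) by blast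
  then show ?thesis using meets_iff_signs[OF a xr assms(6)] ax by simp
qed

lemma facet_sub_closure: "K \<inter> mir s \<subseteq> closure cell"
proof -
  have "rel_interior (K \<inter> mir s) \<subseteq> cell"
  proof
    fix y assume "y \<in> rel_interior (K \<inter> mir s)"
    then have y: "y \<in> K" "y \<in> regular" using facet_sub by blast+
    have "\<not> meets r f y" if r: "r \<in> commuting s" for r
      using chamber_same_side[OF _ f_K y(1) regularD(3)[OF f_regular r] regularD(3)[OF y(2) r]] commuting_refl[OF r] by simp
    then show "y \<in> cell" unfolding mem_cell using y(2) by simp
  qed
  then have "closure (rel_interior (K \<inter> mir s)) \<subseteq> closure cell" by (rule closure_mono)
  moreover have "convex (K \<inter> mir s)" by (rule convex_Int[OF convex_K subspace_imp_convex[OF subspace_mir(1)[OF s_refl]]])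
  then have "closure (rel_interior (K \<inter> mir s)) = closure (K \<inter> mir s)" by (rule convex_closure_rel_interior)
  ultimately show ?thesis using closure_subset[of "K \<inter> mir s"] by simp
qed

text \<open>Any chamber containing the facet contains the regular point \<open>f\<close> in the
  closure of its component. By \<open>closure_same_side\<close> no mirror separates \<open>f\<close>
  from that component, which is therefore \<open>cell\<close>.\<close>

lemma K_Omega_eq: "K_Omega W S \<rho> U K s = U \<inter> mir s \<inter> closure cell"
proof -
  let ?ch = "is_chamber (mir s) (U \<inter> mir s) (\<rho> ` W_Omega W S s)" and ?L = "U \<inter> mir s \<inter> closure cell"
  have ch: "?ch L \<longleftrightarrow> (\<exists>D\<in>components regular. L = U \<inter> mir s \<inter> closure D)" for L
    unfolding is_chamber_def regular_eq ..
  have "(THE L. ?ch L \<and> K \<inter> mir s \<subseteq> L) = ?L"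
  proof (rule the_equality)
    have "K \<inter> mir s \<subseteq> U" unfolding K_eq by blast
    then show "?ch (?L) \<and> K \<inter> mir s \<subseteq> ?L"
      unfolding ch using cell_component facet_sub_closure by blast
    fix L assume "?ch L \<and> K \<inter> mir s \<subseteq> L"
    then obtain D where D: "D \<in> components regular" "L = U \<inter> mir s \<inter> closure D" "K \<inter> mir s \<subseteq> L" unfolding ch by blast
    have "f \<in> closure D" using f_K regularD(2)[OF f_regular] D by blast
    obtain c where c: "c \<in> D" using in_components_nonempty[OF D(1)] by blast
    have Dr: "D \<subseteq> regular" "connected D" using in_components_subset[OF D(1)] in_components_connected[OF D(1)] by blast+
    have "c \<in> cell"
      unfolding mem_cell
    proof (intro conjI ballI)
      show "c \<in> regular" using c Dr by blast
      fix r assume r: "r \<in> commuting s"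
      have "\<not> meets r c f"
        using closure_same_side[OF Dr(1) \<open>c \<in> regular\<close> _ \<open>f \<in> closure D\<close> r regularD(3)[OF f_regular r]]
          same_side_if_connected[OF Dr(2,1) c] by blast
      then show "\<not> meets r f c" using meets_commute by blast
    qed
    then have "D = cell" using components_nonoverlap[OF D(1) cell_component] c by blast
    then show "L = ?L" using D(2) by simp
  qed
  then show ?thesis unfolding K_Omega_def mir_def[symmetric] Let_def facet_mir(2)[OF sS] .
qed

lemma Gamma_closed_inv:
  assumes "g \<in> Gamma s"
  shows "inv g \<in> Gamma s"
proof -
  have g: "g \<in> carrier W" "s \<otimes> g = g \<otimes> s" "s \<notin> inversions g" "inversions g \<inter> commuting s = {}"
    using assms unfolding Gamma_def by auto
  note i = g(1) s_refl s_refl g(2)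
  show ?thesis
    unfolding Gamma_def
    using g(1,3) conj_intertwine(3)[OF i] N_inv_intertwine(1)[OF i] N_inv_intertwine(2)[OF i g(4)]
    by (intro CollectI conjI) simp_all
qed

text \<open>An element without commuting inversions keeps \<open>f\<close>, and with it the whole
  cell, on the same side of all commuting mirrors. Conversely, preserving the half-space gives a
  commutation with \<open>s\<close>, and preserving the chamber keeps the image of \<open>f\<close>
  in the closed cell; being regular, this image is not separated from \<open>f\<close>.\<close>

lemma Gamma_Omega_eq: "Gamma_Omega W S \<rho> U K s = Gamma s"
proof -
  obtain a where a: "mir s = {x. a \<bullet> x = 0}" "\<forall>x\<in>C. a \<bullet> x > 0" "\<forall>x\<in>K. a \<bullet> x \<ge> 0" using wall_sign[OF s_refl] by blast
  define P where "P = {x. a \<bullet> x \<ge> 0}"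
  define L where "L = U \<inter> mir s \<inter> closure cell"
  have HP: "half_space_of (mir s) K = P" unfolding P_def by (rule half_space_eq[OF a])
  have GO: "Gamma_Omega W S \<rho> U K s = {g \<in> carrier W. \<rho> g ` L = L \<and> \<rho> g ` P = P}"
    unfolding Gamma_Omega_def mir_def[symmetric] HP K_Omega_eq L_def ..
  have ab: "a \<bullet> base > 0" using a(2) base_C by blast
  have base: "base \<notin> mir s" using ab unfolding a(1) by simp
  have stable: "\<rho> g ` A = A" if "g \<in> carrier W" "\<rho> g ` A \<subseteq> A" "\<rho> (inv g) ` A \<subseteq> A" for g and A :: "'v set"
  proof
    show "A \<subseteq> \<rho> g ` A"
    proof
      fix x assume "x \<in> A"
      then have "\<rho> (inv g) x \<in> A" using that(3) by blast
      then have "\<rho> g (\<rho> (inv g) x) \<in> \<rho> g ` A" by blast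
      then show "x \<in> \<rho> g ` A" using that(1) by simp
    qed
  qed (rule that(2))
  have "Gamma s \<subseteq> {g \<in> carrier W. \<rho> g ` L = L \<and> \<rho> g ` P = P}"
  proof
    fix g assume gG: "g \<in> Gamma s"
    have main: "\<rho> g ` L \<subseteq> L \<and> \<rho> g ` P \<subseteq> P" if "g \<in> Gamma s" for g
    proof
      have g: "g \<in> carrier W" "s \<otimes> g = g \<otimes> s" "s \<notin> inversions g" "inversions g \<inter> commuting s = {}"
        using that unfolding Gamma_def by auto
      have "\<rho> g ` cell \<subseteq> cell"
      proof
        fix y assume "y \<in> \<rho> g ` cell"
        then obtain x where xc: "x \<in> cell" "y = \<rho> g x" by blast
        then have x: "x \<in> regular" "\<forall>r\<in>commuting s. \<not> meets r f x" "y = \<rho> g x" unfolding mem_cell by simp_all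
        have gf: "\<rho> g f \<in> regular" and gx: "\<rho> g x \<in> regular" by (rule regular_act[OF g(1,2) f_regular], rule regular_act[OF g(1,2) x(1)])
        have "\<not> meets r f (\<rho> g x)" if r: "r \<in> commuting s" for r
        proof -
          note rr = commuting_refl[OF r]
          have "\<not> meets r f (\<rho> g f)" using inversions_commuting[OF g(1,2) r] g(4) r by blast
          moreover have "\<not> meets r (\<rho> g f) (\<rho> g x)"
            unfolding meets_conj[OF g(1) rr[THEN conjunct2]] using x(2) commuting_conj_inv[OF g(1,2) r] by blast
          ultimately show ?thesis
            using meets_trans[of r f "\<rho> g f" "\<rho> g x"] rr regularD(3)[OF f_regular r] regularD(3)[OF gf r] regularD(3)[OF gx r] by blast
        qed
        then show "y \<in> cell" unfolding mem_cell x(3) using gx by blast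
      qed
      then have "closure (\<rho> g ` cell) \<subseteq> closure cell" by (rule closure_mono)
      then have "\<rho> g ` closure cell \<subseteq> closure cell" using closure_linear_image_subset[OF act_linear[OF g(1)], of cell] by blast
      then have cc: "\<rho> g x \<in> closure cell" if "x \<in> closure cell" for x using that by blast
      show "\<rho> g ` L \<subseteq> L"
      proof
        fix y assume "y \<in> \<rho> g ` L"
        then obtain x where x: "x \<in> U" "x \<in> mir s" "x \<in> closure cell" "y = \<rho> g x" unfolding L_def by blast
        have "y \<in> mir s" unfolding x(4) mir_commute[OF g(1) s_refl g(2)] by (rule x(2))
        then show "y \<in> L" unfolding L_def using act_U[OF g(1) x(1)] cc[OF x(3)] x(4) by simp
      qed
      show "\<rho> g ` P \<subseteq> P"
      proof
        fix y assume "y \<in> \<rho> g ` P"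
        then obtain x where x: "a \<bullet> x \<ge> 0" "y = \<rho> g x" unfolding P_def by blast
        show "y \<in> P"
        proof (cases "x \<in> mir s")
          case True
          then have "y \<in> mir s" unfolding x(2) using mir_commute[OF g(1) s_refl g(2)] by blast
          then show ?thesis unfolding P_def a(1) by simp
        next
          case False
          have "\<not> meets s base x" using meets_iff_signs[OF a(1) base False] ab x(1) by simp
          moreover have "inv g \<otimes> s \<otimes> g = s" by (rule conj_intertwine(1)[OF g(1) s_refl s_refl g(2)])
          ultimately have 1: "\<not> meets s (\<rho> g base) (\<rho> g x)" using meets_conj[OF g(1) s_closed] by simp
          have 2: "\<not> meets s base (\<rho> g base)" using g(3) s_refl unfolding inversions_def by blast
          have off: "\<rho> g base \<notin> mir s" "\<rho> g x \<notin> mir s" using base_orbit[OF g(1) s_refl] mir_commute[OF g(1) s_refl g(2)] False by blast+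
          have "\<not> meets s base (\<rho> g x)" using meets_trans[OF s_refl base off] 1 2 by blast
          then show ?thesis unfolding P_def x(2) using meets_iff_signs[OF a(1) base off(2)] ab by simp
        qed
      qed
    qed
    have gc: "g \<in> carrier W" using gG unfolding Gamma_def by blast
    show "g \<in> {g \<in> carrier W. \<rho> g ` L = L \<and> \<rho> g ` P = P}"
    proof (intro CollectI conjI gc)
      note m = main[OF gG] main[OF Gamma_closed_inv[OF gG]]
      show "\<rho> g ` L = L" by (rule stable[OF gc]) (use m in simp_all)
      show "\<rho> g ` P = P" by (rule stable[OF gc]) (use m in simp_all)
    qed
  qed
  moreover have "g \<in> Gamma s" if g: "g \<in> carrier W" "\<rho> g ` L = L" "\<rho> g ` P = P" for g
  proof -
    \<comment> \<open>The mirror consists of the points that lie in the half-space together with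
      their negatives, so a linear map preserving the half-space preserves the mirror.\<close>
    have mirP: "x \<in> mir s \<longleftrightarrow> x \<in> P \<and> - x \<in> P" for x unfolding a(1) P_def by auto
    have Pg: "\<rho> g x \<in> P \<longleftrightarrow> x \<in> P" for x
    proof
      assume "\<rho> g x \<in> P"
      then obtain z where z: "z \<in> P" "\<rho> g x = \<rho> g z" using g(3) by blast
      then have "x = z" using act_inv(1)[OF g(1)] by metis
      then show "x \<in> P" using z(1) by simp
    qed (use g(3) in blast)
    have ms: "\<rho> g x \<in> mir s \<longleftrightarrow> x \<in> mir s" for x
      unfolding mirP using Pg[of x] Pg[of "- x"] linear_neg[OF act_linear[OF g(1)], of x] by simp
    have "mir (inv g \<otimes> s \<otimes> g) = mir s" using mir_conj[OF g(1) s_closed] ms by blast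
    then have "inv g \<otimes> s \<otimes> g = s" using mir_inj refl_conj'[OF g(1) s_refl] s_refl by blast
    then have "g \<otimes> (inv g \<otimes> s \<otimes> g) = g \<otimes> s" by simp
    then have comm: "s \<otimes> g = g \<otimes> s" using g(1) by (simp add: m_assoc)
    have "\<not> meets s base (\<rho> g base)"
    proof -
      have "base \<in> P" using ab unfolding P_def by simp
      then have "a \<bullet> \<rho> g base \<ge> 0" using Pg[of base] unfolding P_def by simp
      then show ?thesis using meets_iff_signs[OF a(1) base base_orbit[OF g(1) s_refl]] ab by simp
    qed
    then have "s \<notin> inversions g" unfolding inversions_def by blast
    moreover have "r \<notin> inversions g" if r: "r \<in> commuting s" for r
    proof -
      have gf: "\<rho> g f \<in> regular" by (rule regular_act[OF g(1) comm f_regular])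
      have "f \<in> closure cell" using facet_sub_closure f_K regularD(2)[OF f_regular] by blast
      then have "f \<in> L" unfolding L_def using regularD(1,2)[OF f_regular] by simp
      then have "\<rho> g f \<in> \<rho> g ` L" by (rule imageI)
      then have gL: "\<rho> g f \<in> closure cell" unfolding g(2) unfolding L_def by simp
      have cr: "cell \<subseteq> regular" using mem_cell by (intro subsetI) simp
      have cs: "\<forall>r\<in>commuting s. \<forall>y\<in>cell. \<not> meets r f y" using mem_cell by simp
      have "\<not> meets r f (\<rho> g f)"
        by (rule closure_same_side[OF cr f_regular cs gL r regularD(3)[OF gf r]])
      then show ?thesis using inversions_commuting[OF g(1) comm r] by blast
    qed
    ultimately show ?thesis unfolding Gamma_def using g(1) comm by (intro CollectI conjI) blast+
  qed
  moreover from this have "{g \<in> carrier W. \<rho> g ` L = L \<and> \<rho> g ` P = P} \<subseteq> Gamma s" by (intro subsetI, elim CollectE conjE)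
  ultimately show ?thesis unfolding GO by (intro equalityI)
qed

end

theorem theorem5:
  fixes W :: "('a, 'm) monoid_scheme" and S :: "'a set" and s :: 'a
    and \<rho> :: "'a \<Rightarrow> 'v::euclidean_space \<Rightarrow> 'v" and U K :: "'v set"
  assumes "coxeter_system W S"
    and "vinberg_rep_chamber W S \<rho> U K"
    and "s \<in> S"
  shows "coxeter_system (W\<lparr>carrier := W_Omega W S s\<rparr>)
           {r_elt W \<gamma> u | \<gamma> u.
              edge_path S (oddly_joined W S) \<gamma> \<and> hd \<gamma> = s \<and> evenly_joined W S (last \<gamma>) u}
       \<and> (\<exists>\<phi> \<in> iso (graph_pi1 S (oddly_joined W S) s) (W\<lparr>carrier := Gamma_Omega W S \<rho> U K s\<rparr>).
            \<forall>\<gamma> \<in> edge_loops S (oddly_joined W S) s.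
              \<phi> (path_class S (oddly_joined W S) \<gamma>) = p_elt W \<gamma>)"
proof -
  obtain C where C: "C \<in> components (U - \<Union>{mirror_on UNIV r | r. r \<in> \<rho> ` carrier W \<and> reflection_on UNIV r})"
    "K = U \<inter> closure C"
    using assms(2) unfolding vinberg_rep_chamber_def is_chamber_def by blast
  interpret group W using assms(1) unfolding coxeter_system_def by blast
  interpret vinberg_chamber W S \<rho> U K C
  proof
    show "generate W S = carrier W" using assms(1) unfolding coxeter_system_def presents_def by blast
  qed (use assms(2) C in \<open>auto simp: vinberg_rep_chamber_def\<close>)
  obtain f where f: "f \<in> rel_interior (K \<inter> mir s)" using rel_interior_facet(1)[OF assms(3)] by blast
  interpret vinberg_wall W S \<rho> U K C s f
    by unfold_locales (rule assms(3), rule f)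
  show ?thesis
    using coxeter_system_commuting[OF assms(3)] pi1_iso[OF assms(3)]
    unfolding W_Omega_eq Gamma_Omega_eq R_set_def by blast
qed

end
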